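(* Let $G$ be a generalised Heisenberg group and let $\psi$ be an automorphism of $G$. Then $$\mathrm{Gr}_{\psi,G}(n)\simeq n^{d_c-r_c}\,d_\psi(n),$$ where the function $d_\psi$ is given as follows: (1) $d_\psi(n)=1$ if $\psi|_{G_2}=-\mathrm{id}$ or if $\psi'(\ker(\psi_{z/c}-\mathrm{id}))$ is non-trivial; (2) otherwise, $d_\psi(n)=1$ if $\mathfrak d_\psi\ge 3$; (3) otherwise, $d_\psi(n)=\ln(n)$ if $\mathfrak d_\psi=2$; (4) otherwise, $d_\psi(n)=n$ if $\mathfrak d_\psi=1$; (5) otherwise, $d_\psi(n)=n^2$ if $\mathfrak d_\psi=0$.
   Context: Write $[g,h]=ghg^{-1}h^{-1}$. A group $G$ is $2$-step nilpotent if $[G,G]\subset Z(G)$; $G_2=\sqrt{[G,G]}=\{g\in G: g^n\in[G,G]\text{ for some }n\ge1\}$ is the isolator of $[G,G]$. A generalised Heisenberg group is a finitely generated $2$-step nilpotent group with $G_2\cong\mathbb Z$. Then $G$ is torsion free, $G_2\subset Z(G)$, and $G/G_2$, $G/Z(G)$, $Z(G)/G_2$ are finitely generated free abelian. Fix an identification $G_2\cong\mathbb Z$. The commutator induces a skew-symmetric bilinear map $\omega:G/G_2\times G/G_2\to\mathbb Z$, $\omega(gG_2,hG_2)=[g,h]$. Let $H_\omega$ be the group on the set $G/G_2\times\mathbb Z$ with product $(a,c)(a',c')=(a+a',c+c'+\omega(a,a'))$. The group $G$ is regarded as an index-$2$ subgroup of $H_\omega$ as follows: fix $a_1,\dots,a_k\in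 G$ whose images form a basis of $G/G_2$ and a generator $c$ of $G_2$ (the one corresponding to $1\in\mathbb Z$), and embed by $a_i\mapsto(a_iG_2,0)$, $c\mapsto(0,2)$; under this embedding the first coordinate of $g\in G$ is $gG_2$. An automorphism $\psi$ of $G$ extends uniquely to an automorphism of $H_\omega$, still denoted $\psi$, of the form $\psi(g,h)=(\psi_c(g),\psi|_{G_2}(h)+\psi'(g))$, where $\psi_c$ is the automorphism of $G/G_2$ induced by $\psi$, $\psi|_{G_2}\in\{\mathrm{id},-\mathrm{id}\}$ is the restriction of $\psi$ to $G_2$, and $\psi':G/G_2\to\mathbb Z$ is $\mathbb Z$-linear. Let $d_c=\dim(G/G_2)$ and $r_c=\mathrm{rank}(\psi_c-\mathrm{id})$. Let $\psi_{z/c}$ be the restriction of $\psi_c$ to $Z(G)/G_2$, $d_{z/c}=\dim(Z(G)/G_2)$ and $r_{z/c}=\mathrm{rank}(\psi_{z/c}-\mathrm{id})$. Let $\mathfrak d_\psi=(d_c-r_c)-(d_{z/c}-r_{z/c})$. For a finite generating set $S$ of $G$, $\|g\|_S$ is the word norm with respect to $S\cup S^{-1}$. $x\sim_\psi y$ means $gx\psi(g)^{-1}=y$ for some $g\in G$; $[x]_\psi$ is the class of $x$; $\mathrm{Gr}^S_{\psi,G}(n)=\#\{[g]_\psi: g\in G,\|g\|_S\le n\}$. For non-decreasing functions $f,g$, $f\prec g$ means there is a natural $c\ge1$ with $\max(1,f(n))\le c\max(1,g(cn))$ for all $n\ge1$; $f\simeq g$ means $f\prec g$ and $g\prec f$.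 Up to $\simeq$, $\mathrm{Gr}^S_{\psi,G}$ does not depend on $S$, and one writes $\mathrm{Gr}_{\psi,G}$. *)

theory Defs
  imports "HOL-Algebra.Algebra"
begin

section \<open>Generalised Heisenberg groups\<close>

definition commutator :: "('a, 'b) monoid_scheme \<Rightarrow> 'a \<Rightarrow> 'a \<Rightarrow> 'a" where
  "commutator G g h = g \<otimes>\<^bsub>G\<^esub> h \<otimes>\<^bsub>G\<^esub> inv\<^bsub>G\<^esub> g \<otimes>\<^bsub>G\<^esub> inv\<^bsub>G\<^esub> h"

definition group_center :: "('a, 'b) monoid_scheme \<Rightarrow> 'a set" where
  "group_center G = {z \<in> carrier G. \<forall>g \<in> carrier G. z \<otimes>\<^bsub>G\<^esub> g = g \<otimes>\<^bsub>G\<^esub> z}"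

definition isolator :: "('a, 'b) monoid_scheme \<Rightarrow> 'a set" where
  "isolator G = {g \<in> carrier G. \<exists>n::nat. n \<ge> 1 \<and> g [^]\<^bsub>G\<^esub> n \<in> derived G (carrier G)}"

definition two_step_nilpotent :: "('a, 'b) monoid_scheme \<Rightarrow> bool" where
  "two_step_nilpotent G \<longleftrightarrow> group G \<and> derived G (carrier G) \<subseteq> group_center G"

definition finite_generating_set :: "('a, 'b) monoid_scheme \<Rightarrow> 'a set \<Rightarrow> bool" where
  "finite_generating_set G S \<longleftrightarrow> finite S \<and> S \<subseteq> carrier G \<and> generate G S = carrier G"

definition generalised_Heisenberg :: "('a, 'b) monoid_scheme \<Rightarrow> bool" where
  "generalised_Heisenberg G \<longleftrightarrow>
     two_step_nilpotent G \<and> (\<exists>S. finite_generating_set G S) \<and>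
     G\<lparr>carrier := isolator G\<rparr> \<cong> integer_group"


section \<open>Dimension and rank for finitely generated free abelian groups\<close>

text \<open>A \<open>\<int>\<close>-basis indexed by \<open>{..<k}\<close>. The group is written multiplicatively, so integer linear
  combinations appear as products of powers.\<close>

definition int_basis :: "('a, 'b) monoid_scheme \<Rightarrow> nat \<Rightarrow> (nat \<Rightarrow> 'a) \<Rightarrow> bool" where
  "int_basis A k b \<longleftrightarrow>
     (\<forall>i<k. b i \<in> carrier A) \<and>
     (\<forall>x \<in> carrier A. \<exists>!m::nat \<Rightarrow> int.
        m \<in> {..<k} \<rightarrow>\<^sub>E UNIV \<and> x = (\<Otimes>\<^bsub>A\<^esub>i\<in>{..<k}. b i [^]\<^bsub>A\<^esub> m i))"

text \<open>Only meaningful when \<open>A\<close> is free abelian of finite rank.\<close>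

definition int_dim :: "('a, 'b) monoid_scheme \<Rightarrow> nat" where
  "int_dim A = (THE k. \<exists>b. int_basis A k b)"

text \<open>The map \<open>f - id\<close>, in multiplicative notation, and its rank, the dimension of its image.\<close>

definition minus_id :: "('a, 'b) monoid_scheme \<Rightarrow> ('a \<Rightarrow> 'a) \<Rightarrow> 'a \<Rightarrow> 'a" where
  "minus_id A f x = f x \<otimes>\<^bsub>A\<^esub> inv\<^bsub>A\<^esub> x"

definition rank_minus_id :: "('a, 'b) monoid_scheme \<Rightarrow> ('a \<Rightarrow> 'a) \<Rightarrow> nat" where
  "rank_minus_id A f = int_dim (A\<lparr>carrier := minus_id A f ` carrier A\<rparr>)"


section \<open>The quotients and the induced automorphisms\<close>

definition quot_c :: "('a, 'b) monoid_scheme \<Rightarrow> 'a set monoid" where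
  "quot_c G = G Mod isolator G"

definition quot_zc :: "('a, 'b) monoid_scheme \<Rightarrow> 'a set monoid" where
  "quot_zc G = G\<lparr>carrier := group_center G\<rparr> Mod isolator G"

text \<open>An automorphism \<open>\<psi>\<close> of \<open>G\<close> preserves the isolator, so the map it induces on cosets is
  taking images: \<open>\<psi> ` (G\<^sub>2 g) = G\<^sub>2 \<psi>(g)\<close>. The carrier of \<open>quot_zc G\<close> is a subset of that of
  \<open>quot_c G\<close>, and the same map describes the restriction.\<close>

definition induced_map :: "('a \<Rightarrow> 'a) \<Rightarrow> 'a set \<Rightarrow> 'a set" where
  "induced_map \<psi> P = \<psi> ` P"

definition d_c :: "('a, 'b) monoid_scheme \<Rightarrow> nat" where
  "d_c G = int_dim (quot_c G)"

definition r_c :: "('a, 'b) monoid_scheme \<Rightarrow> ('a \<Rightarrow> 'a) \<Rightarrow> nat" where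
  "r_c G \<psi> = rank_minus_id (quot_c G) (induced_map \<psi>)"

definition d_zc :: "('a, 'b) monoid_scheme \<Rightarrow> nat" where
  "d_zc G = int_dim (quot_zc G)"

definition r_zc :: "('a, 'b) monoid_scheme \<Rightarrow> ('a \<Rightarrow> 'a) \<Rightarrow> nat" where
  "r_zc G \<psi> = rank_minus_id (quot_zc G) (induced_map \<psi>)"

definition defect :: "('a, 'b) monoid_scheme \<Rightarrow> ('a \<Rightarrow> 'a) \<Rightarrow> int" where
  "defect G \<psi> = (int (d_c G) - int (r_c G \<psi>)) - (int (d_zc G) - int (r_zc G \<psi>))"


section \<open>The group \<open>H\<^sub>\<omega>\<close> and the map \<open>\<psi>'\<close>\<close>

text \<open>Throughout, \<open>\<iota>\<close> is an isomorphism from the isolator onto \<open>\<int>\<close>.\<close>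

definition omega :: "('a, 'b) monoid_scheme \<Rightarrow> ('a \<Rightarrow> int) \<Rightarrow> 'a set \<Rightarrow> 'a set \<Rightarrow> int" where
  "omega G \<iota> P Q = (THE m. \<forall>g \<in> P. \<forall>h \<in> Q. \<iota> (commutator G g h) = m)"

definition H_omega :: "('a, 'b) monoid_scheme \<Rightarrow> ('a \<Rightarrow> int) \<Rightarrow> ('a set \<times> int) monoid" where
  "H_omega G \<iota> =
     \<lparr>carrier = carrier (quot_c G) \<times> UNIV,
      monoid.mult = (\<lambda>(P, c) (Q, c'). (P \<otimes>\<^bsub>quot_c G\<^esub> Q, c + c' + omega G \<iota> P Q)),
      one = (\<one>\<^bsub>quot_c G\<^esub>, 0)\<rparr>"

definition lifts_basis :: "('a, 'b) monoid_scheme \<Rightarrow> nat \<Rightarrow> (nat \<Rightarrow> 'a) \<Rightarrow> bool" where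
  "lifts_basis G k a \<longleftrightarrow>
     (\<forall>i<k. a i \<in> carrier G) \<and> int_basis (quot_c G) k (\<lambda>i. isolator G #>\<^bsub>G\<^esub> a i)"

text \<open>The embedding of \<open>G\<close> into \<open>H\<^sub>\<omega>\<close>. The generator of the isolator goes to \<open>(0, 2)\<close> because
  commutators in \<open>H\<^sub>\<omega>\<close> are \<open>(0, 2\<omega>)\<close>. The elements \<open>a i\<close> and \<open>inv_into (isolator G) \<iota> 1\<close>
  generate \<open>G\<close>, so the homomorphism is unique once its value outside the carrier is fixed by
  extensionality.\<close>

definition H_embed ::
  "('a, 'b) monoid_scheme \<Rightarrow> ('a \<Rightarrow> int) \<Rightarrow> nat \<Rightarrow> (nat \<Rightarrow> 'a) \<Rightarrow> 'a \<Rightarrow> 'a set \<times> int" where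
  "H_embed G \<iota> k a =
     (THE e. e \<in> hom G (H_omega G \<iota>) \<inter> extensional (carrier G) \<and>
             (\<forall>i<k. e (a i) = (isolator G #>\<^bsub>G\<^esub> a i, 0)) \<and>
             e (inv_into (isolator G) \<iota> 1) = (\<one>\<^bsub>quot_c G\<^esub>, 2))"

definition H_extend ::
  "('a, 'b) monoid_scheme \<Rightarrow> ('a \<Rightarrow> int) \<Rightarrow> nat \<Rightarrow> (nat \<Rightarrow> 'a) \<Rightarrow> ('a \<Rightarrow> 'a)
     \<Rightarrow> 'a set \<times> int \<Rightarrow> 'a set \<times> int" where
  "H_extend G \<iota> k a \<psi> =
     (THE \<Psi>. \<Psi> \<in> auto (H_omega G \<iota>) \<and>
             (\<forall>g \<in> carrier G. \<Psi> (H_embed G \<iota> k a g) = H_embed G \<iota> k a (\<psi> g)))"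

text \<open>The extension sends \<open>(P, h)\<close> to \<open>(\<psi>\<^sub>c P, \<plusminus>h + \<psi>' P)\<close>; take \<open>h = 0\<close>.\<close>

definition psi_prime ::
  "('a, 'b) monoid_scheme \<Rightarrow> ('a \<Rightarrow> int) \<Rightarrow> nat \<Rightarrow> (nat \<Rightarrow> 'a) \<Rightarrow> ('a \<Rightarrow> 'a) \<Rightarrow> 'a set \<Rightarrow> int" where
  "psi_prime G \<iota> k a \<psi> P = snd (H_extend G \<iota> k a \<psi> (P, 0))"


section \<open>Twisted conjugacy growth\<close>

definition word_norm :: "('a, 'b) monoid_scheme \<Rightarrow> 'a set \<Rightarrow> 'a \<Rightarrow> nat" where
  "word_norm G S g =
     (LEAST n. \<exists>ws. length ws = n \<and> set ws \<subseteq> S \<union> m_inv G ` S \<and>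
        foldr (\<otimes>\<^bsub>G\<^esub>) ws \<one>\<^bsub>G\<^esub> = g)"

definition twisted_class :: "('a, 'b) monoid_scheme \<Rightarrow> ('a \<Rightarrow> 'a) \<Rightarrow> 'a \<Rightarrow> 'a set" where
  "twisted_class G \<psi> x =
     {y \<in> carrier G. \<exists>g \<in> carrier G. g \<otimes>\<^bsub>G\<^esub> x \<otimes>\<^bsub>G\<^esub> inv\<^bsub>G\<^esub> (\<psi> g) = y}"

definition twisted_growth ::
  "('a, 'b) monoid_scheme \<Rightarrow> 'a set \<Rightarrow> ('a \<Rightarrow> 'a) \<Rightarrow> nat \<Rightarrow> nat" where
  "twisted_growth G S \<psi> n =
     card (twisted_class G \<psi> ` {g \<in> carrier G. word_norm G S g \<le> n})"

definition growth_le :: "(nat \<Rightarrow> real) \<Rightarrow> (nat \<Rightarrow> real) \<Rightarrow> bool" where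
  "growth_le f g \<longleftrightarrow>
     (\<exists>c::nat. c \<ge> 1 \<and> (\<forall>n\<ge>1. max 1 (f n) \<le> real c * max 1 (g (c * n))))"

definition growth_equiv :: "(nat \<Rightarrow> real) \<Rightarrow> (nat \<Rightarrow> real) \<Rightarrow> bool" where
  "growth_equiv f g \<longleftrightarrow> growth_le f g \<and> growth_le g f"

text \<open>The final case is \<open>defect G \<psi> = 0\<close>: the defect is never negative, as it is the rank of
  \<open>ker (\<psi>\<^sub>c - id)\<close> minus the rank of its subgroup \<open>ker (\<psi>\<^sub>z\<^sub>/\<^sub>c - id)\<close>.\<close>

definition d_psi ::
  "('a, 'b) monoid_scheme \<Rightarrow> ('a \<Rightarrow> int) \<Rightarrow> nat \<Rightarrow> (nat \<Rightarrow> 'a) \<Rightarrow> ('a \<Rightarrow> 'a) \<Rightarrow> nat \<Rightarrow> real" where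
  "d_psi G \<iota> k a \<psi> n =
     (if (\<forall>x \<in> isolator G. \<psi> x = inv\<^bsub>G\<^esub> x) \<or>
         psi_prime G \<iota> k a \<psi> ` kernel (quot_zc G) (quot_zc G) (minus_id (quot_zc G) (induced_map \<psi>)) \<noteq> {0}
      then 1
      else if defect G \<psi> \<ge> 3 then 1
      else if defect G \<psi> = 2 then ln (real n)
      else if defect G \<psi> = 1 then real n
      else (real n)\<^sup>2)"

end

(* Choosing coordinates embeds G into H_omega as the pairs (v, h), with v in Z^k and h in a coset of 2Z
   determined by v; psi acts by (v, h) |-> (A v, eps h + f v). Twisted conjugation by (w, s) moves v by
   -D w, where D = A - 1, and if D w = 0 it moves h by (1 - eps) s - f w + 2 omega(w, v). The ball of
   radius n is comparable to |v| <= n, |h| <= n^2, so there are about n^(d_c - r_c) values of v modulo the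
   image of D, and over each of them the number of classes is the index in Z of the group of possible height
   changes, cut off at n^2.

   If eps = -1 or f does not vanish on the central part of ker D, this index is bounded. Otherwise it is
   the greatest common divisor of an affine function of v with values in Z^d, where d is the defect, and
   this function is injective up to finite index on a rank d quotient. Hence the growth is n^(d_c - r_c - d)
   times the sum of the greatest common divisors of the integer vectors of norm at most n in Z^d: of order
   n^2 for d = 0 (only the cut-off contributes) and d = 1, n^2 ln n for d = 2, and n^d for d >= 3. *)

theory Submission
  imports Defs "HOL-Library.Function_Algebras"
begin

(* HOL-Algebra.IntRing adds transitivity rules for int with premises of the form x : UNIV, which would
   otherwise be left over in calculations. *)
declare int.le_trans [trans del] int.lless_trans [trans del]

section \<open>Linear algebra over the integers\<close>

text \<open>Over \<int> one cannot divide: the image of \<open>D\<close> need not be a direct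
  summand, and its cokernel may have torsion. Two scalars replace the rational splitting:
  \<open>\<Lambda>\<close> maps the cokernel to \<int>^p, \<open>N\<close> kills what
  \<open>\<Lambda>\<close> misses and \<open>M\<close> kills what it forgets. Upper bounds keep
  track of residues modulo \<open>M\<close>; lower bounds use only values of
  \<open>\<Lambda>\<close> in N \<int>^p. The latter confine the gcd sums to vectors 2Nx - mu, whose
  residue classes may share a factor with 2N, so that counts of coprime pairs do not apply; the
  bound of order n^2 ln n is therefore proved for pairs in arbitrary residue classes. An element of
  the isolator changes the height by an even number, which is the source of the many factors 2: the
  gcd attached to v is the exact period along the isolator up to a factor of at most 2, and the
  growth relation ignores such factors. The map \<psi>' is given by definite descriptions over
  H_omega. The height coordinate makes the embedding explicit, and \<psi>' becomes an additive map
  \<open>f\<close> on \<int>^k.\<close>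

definition int_vecs :: "nat \<Rightarrow> (nat \<Rightarrow> int) set" where
  "int_vecs k = {x. \<forall>i\<ge>k. x i = 0}"

definition unit_vec :: "nat \<Rightarrow> nat \<Rightarrow> int" where
  "unit_vec i = (\<lambda>j. if j = i then 1 else 0)"

definition additive_on :: "nat \<Rightarrow> ((nat \<Rightarrow> int) \<Rightarrow> 'v::ab_group_add) \<Rightarrow> bool" where
  "additive_on k f \<longleftrightarrow> (\<forall>x\<in>int_vecs k. \<forall>y\<in>int_vecs k. f (x + y) = f x + f y)"

definition lattice_aut :: "nat \<Rightarrow> ((nat \<Rightarrow> int) \<Rightarrow> (nat \<Rightarrow> int)) \<Rightarrow> bool" where
  "lattice_aut k T \<longleftrightarrow> bij_betw T (int_vecs k) (int_vecs k) \<and> additive_on k T"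

text \<open>A basis of \<open>L\<close>, in the form of the isomorphism that it induces; the rank of
  \<open>L\<close> is the \<open>m\<close> of any such map.\<close>

definition lattice_param :: "nat \<Rightarrow> ((nat \<Rightarrow> int) \<Rightarrow> (nat \<Rightarrow> int)) \<Rightarrow> (nat \<Rightarrow> int) set \<Rightarrow> bool" where
  "lattice_param m \<theta> L \<longleftrightarrow> bij_betw \<theta> (int_vecs m) L \<and> additive_on m \<theta>"

definition dot :: "nat \<Rightarrow> (nat \<Rightarrow> int) \<Rightarrow> (nat \<Rightarrow> int) \<Rightarrow> int" where
  "dot k x y = (\<Sum>i<k. x i * y i)"

definition trunc :: "nat \<Rightarrow> (nat \<Rightarrow> int) \<Rightarrow> (nat \<Rightarrow> int)" where
  "trunc s x = (\<lambda>i. if i < s then x i else 0)"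

section \<open>Additive maps on \<int>^k\<close>

lemma int_vecsI: "(\<And>i. i \<ge> k \<Longrightarrow> x i = 0) \<Longrightarrow> x \<in> int_vecs k"
  by (simp add: int_vecs_def)

lemma int_vecsD: "x \<in> int_vecs k \<Longrightarrow> i \<ge> k \<Longrightarrow> x i = 0"
  by (simp add: int_vecs_def)

lemma int_vecs_closed [simp, intro]:
  "0 \<in> int_vecs k"
  "x \<in> int_vecs k \<Longrightarrow> y \<in> int_vecs k \<Longrightarrow> x + y \<in> int_vecs k"
  "x \<in> int_vecs k \<Longrightarrow> y \<in> int_vecs k \<Longrightarrow> x - y \<in> int_vecs k"
  "x \<in> int_vecs k \<Longrightarrow> - x \<in> int_vecs k"
  "x \<in> int_vecs k \<Longrightarrow> (\<lambda>i. c * x i) \<in> int_vecs k"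
  by (auto simp: int_vecs_def)

text \<open>This nesting is the reason for representing vectors by functions that vanish from
  \<open>k\<close> on: lattices of different rank are subsets of one another, with a common
  addition.\<close>

lemma int_vecs_mono: "k \<le> m \<Longrightarrow> int_vecs k \<subseteq> int_vecs m"
  by (auto simp: int_vecs_def)

lemma int_vecs_0 [simp]: "int_vecs 0 = {0}"
  by (auto simp: int_vecs_def fun_eq_iff)

lemma unit_vec_in [simp, intro]: "i < k \<Longrightarrow> unit_vec i \<in> int_vecs k"
  by (auto simp: int_vecs_def unit_vec_def)

lemma trunc_in [simp, intro]: "trunc s x \<in> int_vecs s"
  "x \<in> int_vecs k \<Longrightarrow> trunc s x \<in> int_vecs k"
  by (auto simp: int_vecs_def trunc_def)

lemma trunc_in_le: "s \<le> k \<Longrightarrow> trunc s x \<in> int_vecs k"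
  by (auto simp: int_vecs_def trunc_def)

lemma additive_onD:
  "additive_on k f \<Longrightarrow> x \<in> int_vecs k \<Longrightarrow> y \<in> int_vecs k \<Longrightarrow> f (x + y) = f x + f y"
  by (simp add: additive_on_def)

lemma additive_on_0: "additive_on k f \<Longrightarrow> f 0 = 0"
  using additive_onD[of k f 0 0] by simp

lemma additive_on_minus: "additive_on k f \<Longrightarrow> x \<in> int_vecs k \<Longrightarrow> f (- x) = - f x"
  using additive_onD[of k f x "- x"] additive_on_0[of k f]
  by (simp add: add_eq_0_iff)

lemma additive_on_diff:
  "additive_on k f \<Longrightarrow> x \<in> int_vecs k \<Longrightarrow> y \<in> int_vecs k \<Longrightarrow> f (x - y) = f x - f y"
  using additive_onD[of k f x "- y"] additive_on_minus[of k f y] by simp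

lemma additive_on_mono: "additive_on k f \<Longrightarrow> m \<le> k \<Longrightarrow> additive_on m f"
  using int_vecs_mono[of m k] by (auto simp: additive_on_def)

lemma additive_on_coord: "additive_on k F \<Longrightarrow> additive_on k (\<lambda>x. F x j)"
  by (simp add: additive_on_def)

lemma additive_on_coordI: "(\<And>j. additive_on k (\<lambda>x. F x j)) \<Longrightarrow> additive_on k F"
  by (simp add: additive_on_def fun_eq_iff)

lemma additive_on_comp:
  "additive_on k f \<Longrightarrow> additive_on m g \<Longrightarrow> (\<And>x. x \<in> int_vecs m \<Longrightarrow> g x \<in> int_vecs k) \<Longrightarrow>
   additive_on m (\<lambda>x. f (g x))"
  by (simp add: additive_on_def)

lemma additive_on_scale_nat:
  fixes f :: "(nat \<Rightarrow> int) \<Rightarrow> int"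
  assumes "additive_on k f" "x \<in> int_vecs k"
  shows "f (\<lambda>i. int n * x i) = int n * f x"
proof (induction n)
  case 0
  have "(\<lambda>i. int 0 * x i) = 0" by (simp add: fun_eq_iff)
  then show ?case using additive_on_0[OF assms(1)] by simp
next
  case (Suc n)
  have "(\<lambda>i. int (Suc n) * x i) = x + (\<lambda>i. int n * x i)" by (simp add: fun_eq_iff algebra_simps)
  then show ?case using additive_onD[OF assms(1) assms(2), of "\<lambda>i. int n * x i"] assms(2) Suc
    by (simp add: algebra_simps)
qed

lemma additive_on_scale:
  fixes f :: "(nat \<Rightarrow> int) \<Rightarrow> int"
  assumes "additive_on k f" "x \<in> int_vecs k"
  shows "f (\<lambda>i. c * x i) = c * f x"
proof (cases "c \<ge> 0")
  case True
  then show ?thesis using additive_on_scale_nat[OF assms, of "nat c"] by simp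
next
  case False
  have "(\<lambda>i. c * x i) = - (\<lambda>i. int (nat (- c)) * x i)" using False by (simp add: fun_eq_iff)
  then have "f (\<lambda>i. c * x i) = - f (\<lambda>i. int (nat (- c)) * x i)"
    using additive_on_minus[OF assms(1) int_vecs_closed(5)[OF assms(2)]] by (simp only:)
  then show ?thesis
    using additive_on_scale_nat[OF assms, of "nat (-c)"] False by simp
qed

lemma additive_on_scale_vec:
  fixes F :: "(nat \<Rightarrow> int) \<Rightarrow> (nat \<Rightarrow> int)"
  assumes "additive_on k F" "x \<in> int_vecs k"
  shows "F (\<lambda>i. c * x i) = (\<lambda>j. c * F x j)"
  using additive_on_scale[OF additive_on_coord[OF assms(1)] assms(2)] by (simp add: fun_eq_iff)

lemma trunc_Suc: "trunc (Suc s) x = trunc s x + (\<lambda>i. x s * unit_vec s i)"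
  by (auto simp: trunc_def unit_vec_def fun_eq_iff less_Suc_eq)

lemma trunc_id: "x \<in> int_vecs k \<Longrightarrow> trunc k x = x"
  by (auto simp: trunc_def int_vecs_def fun_eq_iff)

text \<open>Formulated for truncations because maps that depend on the first \<open>s\<close>
  coordinates alone are later shown to vanish by testing \<open>s\<close> unit vectors.\<close>

lemma additive_on_trunc:
  fixes f :: "(nat \<Rightarrow> int) \<Rightarrow> int"
  assumes "additive_on k f" "s \<le> k"
  shows "f (trunc s x) = (\<Sum>i<s. x i * f (unit_vec i))"
  using assms(2)
proof (induction s)
  case 0
  have "trunc 0 x = 0" by (simp add: trunc_def fun_eq_iff)
  then have "f (trunc 0 x) = 0" using additive_on_0[OF assms(1)] by (simp only:)
  then show ?case by simp
next
  case (Suc s)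
  have "f (trunc (Suc s) x) = f (trunc s x) + f (\<lambda>i. x s * unit_vec s i)"
    unfolding trunc_Suc by (rule additive_onD[OF assms(1)]) (use Suc in \<open>auto simp: trunc_in_le\<close>)
  then show ?case
    using Suc additive_on_scale[OF assms(1), of "unit_vec s" "x s"] by simp
qed

lemma additive_on_expand:
  fixes f :: "(nat \<Rightarrow> int) \<Rightarrow> int"
  assumes "additive_on k f" "x \<in> int_vecs k"
  shows "f x = (\<Sum>i<k. x i * f (unit_vec i))"
  using additive_on_trunc[OF assms(1) order_refl, of x] assms(2) by (simp add: trunc_id)

lemma additive_on_expand_vec:
  fixes F :: "(nat \<Rightarrow> int) \<Rightarrow> (nat \<Rightarrow> int)"
  assumes "additive_on k F" "x \<in> int_vecs k"
  shows "F x j = (\<Sum>i<k. x i * F (unit_vec i) j)"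
  using additive_on_expand[OF additive_on_coord[OF assms(1)] assms(2)] .

text \<open>The sum of the absolute values of the matrix entries serves as operator norm;
  restricting to \<open>j < m\<close> makes this a finite sum.\<close>

lemma additive_on_bounded:
  fixes F :: "(nat \<Rightarrow> int) \<Rightarrow> (nat \<Rightarrow> int)"
  assumes "additive_on k F"
  obtains C :: nat where "C \<ge> 1"
    "\<And>x B j. x \<in> int_vecs k \<Longrightarrow> (\<And>i. \<bar>x i\<bar> \<le> B) \<Longrightarrow> j < m \<Longrightarrow> \<bar>F x j\<bar> \<le> int C * B"
proof
  define C where "C = nat (\<Sum>j<m. \<Sum>i<k. \<bar>F (unit_vec i) j\<bar>) + 1"
  show "C \<ge> 1" by (simp add: C_def)
  fix x B j assume x: "x \<in> int_vecs k" and B: "\<And>i. \<bar>x i\<bar> \<le> (B::int)" and j: "j < m"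
  have B0: "B \<ge> 0" using B[of 0] by linarith
  have "\<bar>F x j\<bar> \<le> (\<Sum>i<k. \<bar>x i * F (unit_vec i) j\<bar>)"
    by (subst additive_on_expand_vec[OF assms x]) (rule sum_abs)
  also have "\<dots> \<le> (\<Sum>i<k. B * \<bar>F (unit_vec i) j\<bar>)"
    by (rule sum_mono) (simp add: abs_mult mult_right_mono B)
  also have "\<dots> = (\<Sum>i<k. \<bar>F (unit_vec i) j\<bar>) * B" by (simp add: sum_distrib_left mult.commute)
  also have "\<dots> \<le> (\<Sum>j<m. \<Sum>i<k. \<bar>F (unit_vec i) j\<bar>) * B"
    using j by (intro mult_right_mono B0 member_le_sum) (auto intro: sum_nonneg)
  also have "\<dots> \<le> int C * B"
    by (intro mult_right_mono B0) (simp add: C_def sum_nonneg)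
  finally show "\<bar>F x j\<bar> \<le> int C * B" .
qed

lemma lattice_aut_in: "lattice_aut k T \<Longrightarrow> x \<in> int_vecs k \<Longrightarrow> T x \<in> int_vecs k"
  by (auto simp: lattice_aut_def bij_betw_def)

lemma lattice_aut_comp: "lattice_aut k T \<Longrightarrow> lattice_aut k T' \<Longrightarrow> lattice_aut k (\<lambda>x. T (T' x))"
  using bij_betw_trans[of T' "int_vecs k" "int_vecs k" T "int_vecs k"]
  by (auto simp: lattice_aut_def comp_def bij_betw_def intro!: additive_on_comp[of k T])

lemma lattice_aut_add: "lattice_aut k T \<Longrightarrow> additive_on k T"
  by (simp add: lattice_aut_def)

lemma lattice_autI:
  assumes "additive_on k T" "\<And>x. x \<in> int_vecs k \<Longrightarrow> T x \<in> int_vecs k"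
    "\<And>x. x \<in> int_vecs k \<Longrightarrow> S x \<in> int_vecs k"
    "\<And>x. x \<in> int_vecs k \<Longrightarrow> S (T x) = x" "\<And>x. x \<in> int_vecs k \<Longrightarrow> T (S x) = x"
  shows "lattice_aut k T"
  unfolding lattice_aut_def
  by (intro conjI assms(1) bij_betw_byWitness[where f' = S]) (use assms in auto)

lemma lattice_param_inv:
  assumes "lattice_param m \<theta> L"
  obtains \<theta>' where "\<And>x. x \<in> L \<Longrightarrow> \<theta>' x \<in> int_vecs m" "\<And>x. x \<in> L \<Longrightarrow> \<theta> (\<theta>' x) = x"
    "\<And>x. x \<in> int_vecs m \<Longrightarrow> \<theta>' (\<theta> x) = x"
    "\<And>x y. x \<in> L \<Longrightarrow> y \<in> L \<Longrightarrow> x + y \<in> L \<and> \<theta>' (x + y) = \<theta>' x + \<theta>' y"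
proof
  let ?i = "inv_into (int_vecs m) \<theta>"
  have b: "bij_betw \<theta> (int_vecs m) L" and a: "additive_on m \<theta>"
    using assms by (auto simp: lattice_param_def)
  show 1: "?i x \<in> int_vecs m" if "x \<in> L" for x
    using that b by (metis bij_betw_imp_surj_on inv_into_into)
  show 2: "\<theta> (?i x) = x" if "x \<in> L" for x
    using that b by (metis bij_betw_imp_surj_on f_inv_into_f)
  show 3: "?i (\<theta> x) = x" if "x \<in> int_vecs m" for x
    using that b by (meson bij_betw_inv_into_left)
  show "x + y \<in> L \<and> ?i (x + y) = ?i x + ?i y" if "x \<in> L" "y \<in> L" for x y
  proof -
    have s: "\<theta> (?i x + ?i y) = x + y"
      using additive_onD[OF a 1[OF that(1)] 1[OF that(2)]] that by (simp add: 2)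
    have "?i x + ?i y \<in> int_vecs m" using 1 that by simp
    then show ?thesis using s 3[of "?i x + ?i y"] b by (metis bij_betwE)
  qed
qed

text \<open>The Euclidean algorithm, performed by coordinate changes that fix the first \<open>s\<close> coordinates.\<close>

lemma euclid_aut:
  fixes f :: "nat \<Rightarrow> int"
  assumes "s < k"
  shows "\<exists>T g. lattice_aut k T \<and> (\<forall>x\<in>int_vecs k. \<forall>i<s. T x i = x i) \<and>
    (\<forall>x\<in>int_vecs k. (\<forall>i<s. x i = 0) \<longrightarrow> (\<Sum>i<k. f i * T x i) = g * x s)"
proof (induction "\<Sum>i\<in>{s..<k}. nat \<bar>f i\<bar>" arbitrary: f rule: less_induct)
  case less
  show ?case
  proof (cases "\<exists>i j. i \<noteq> j \<and> i \<in> {s..<k} \<and> j \<in> {s..<k} \<and> f i \<noteq> 0 \<and> f j \<noteq> 0")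
    case True
    then obtain i j where ij: "i \<noteq> j" "i \<in> {s..<k}" "j \<in> {s..<k}" "f i \<noteq> 0" "f j \<noteq> 0"
      "\<bar>f j\<bar> \<le> \<bar>f i\<bar>"
      by (metis linear)
    \<comment> \<open>With this sign the new entry has absolute value \<bar>f i\<bar> - \<bar>f
      j\<bar>, so that the induction measure drops.\<close>
    define \<sigma> where "\<sigma> = sgn (f i) * sgn (f j)"
    define f' where "f' = f(i := f i - \<sigma> * f j)"
    have "\<bar>f i - \<sigma> * f j\<bar> < \<bar>f i\<bar>"
      using ij unfolding \<sigma>_def by (auto simp: sgn_if)
    then have "(\<Sum>l\<in>{s..<k}. nat \<bar>f' l\<bar>) < (\<Sum>l\<in>{s..<k}. nat \<bar>f l\<bar>)"
      by (intro sum_strict_mono2[where b = i] sum_strict_mono_ex1) (use ij in \<open>auto simp: f'_def\<close>)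
    from less[OF this] obtain T' g where T': "lattice_aut k T'"
      "\<And>x i. x \<in> int_vecs k \<Longrightarrow> i < s \<Longrightarrow> T' x i = x i"
      "\<And>x. x \<in> int_vecs k \<Longrightarrow> (\<forall>i<s. x i = 0) \<Longrightarrow> (\<Sum>i<k. f' i * T' x i) = g * x s"
      by metis
    \<comment> \<open>The change of the functional from \<open>f\<close> to \<open>f'\<close> in
      entry \<open>i\<close> is dual to this change of coordinate \<open>j\<close> of the
      vector.\<close>
    define T1 :: "(nat \<Rightarrow> int) \<Rightarrow> nat \<Rightarrow> int" where "T1 x = x(j := x j - \<sigma> * x i)" for x
    define S1 :: "(nat \<Rightarrow> int) \<Rightarrow> nat \<Rightarrow> int" where "S1 x = x(j := x j + \<sigma> * x i)" for x
    have T1: "lattice_aut k T1"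
      by (rule lattice_autI[where S = S1])
        (use ij in \<open>auto simp: T1_def S1_def additive_on_def int_vecs_def fun_eq_iff algebra_simps\<close>)
    have sum1: "(\<Sum>l<k. f l * T1 x l) = (\<Sum>l<k. f' l * x l)" for x
    proof -
      have "(\<Sum>l<k. f l * T1 x l) = (\<Sum>l<k. f l * x l + (if l = j then - \<sigma> * f j * x i else 0))"
        by (rule sum.cong) (auto simp: T1_def algebra_simps)
      also have "\<dots> = (\<Sum>l<k. f l * x l) - \<sigma> * f j * x i"
        using ij by (simp add: sum.distrib)
      also have "\<dots> = (\<Sum>l<k. f l * x l + (if l = i then - \<sigma> * f j * x i else 0))"
        using ij by (simp add: sum.distrib)
      also have "\<dots> = (\<Sum>l<k. f' l * x l)"
        by (rule sum.cong) (auto simp: f'_def algebra_simps)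
      finally show ?thesis .
    qed
    have "\<forall>x\<in>int_vecs k. \<forall>i<s. T1 (T' x) i = x i" using T'(2) ij by (simp add: T1_def)
    moreover have "\<forall>x\<in>int_vecs k. (\<forall>i<s. x i = 0) \<longrightarrow> (\<Sum>i<k. f i * T1 (T' x) i) = g * x s"
      using T'(3) by (simp add: sum1)
    ultimately show ?thesis using lattice_aut_comp[OF T1 T'(1)]
      by (intro exI[of _ "\<lambda>x. T1 (T' x)"] exI[of _ g]) simp
  next
    case False
    \<comment> \<open>At most one entry from \<open>s\<close> on is left. Moving its coordinate to
      position \<open>s\<close> by a transposition ends the algorithm; \<open>g\<close> is this
      entry and may be 0.\<close>
    obtain j where j: "j \<in> {s..<k}" "\<And>i. i \<in> {s..<k} \<Longrightarrow> i \<noteq> j \<Longrightarrow> f i = 0"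
    proof (cases "\<exists>j\<in>{s..<k}. f j \<noteq> 0")
      case True
      then show ?thesis using False that by blast
    next
      case no: False
      then show ?thesis using that[of s] assms by auto
    qed
    define T :: "(nat \<Rightarrow> int) \<Rightarrow> nat \<Rightarrow> int" where "T x = x(j := x s, s := x j)" for x
    have T: "lattice_aut k T"
      by (rule lattice_autI[where S = T])
        (use j assms in \<open>auto simp: T_def additive_on_def int_vecs_def fun_eq_iff\<close>)
    have "(\<Sum>i<k. f i * T x i) = f j * x s" if "x \<in> int_vecs k" "\<forall>i<s. x i = 0" for x
    proof -
      have "(\<Sum>i<k. f i * T x i) = (\<Sum>i<k. if i = j then f j * x s else 0)"
      proof (rule sum.cong)
        fix i assume "i \<in> {..<k}"
        then show "f i * T x i = (if i = j then f j * x s else 0)"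
          using j(2)[of i] j(1) that(2) by (cases "i < s") (auto simp: T_def)
      qed simp
      then show ?thesis using j by simp
    qed
    moreover have "\<forall>x\<in>int_vecs k. \<forall>i<s. T x i = x i" using j by (simp add: T_def)
    ultimately show ?thesis using T by (intro exI[of _ T] exI[of _ "f j"]) simp
  qed
qed

text \<open>The functionals are treated one at a time. On the vectors whose first \<open>s\<close>
  coordinates vanish, the Euclidean algorithm turns the next functional into \<open>g\<close> times
  coordinate \<open>s\<close>, and \<open>s\<close> grows exactly if \<open>g\<close> is not 0.
  Hence \<open>s\<close> is the rank, and the common kernel is spanned by the last k - s vectors of
  a basis of \<int>^k.\<close>

lemma echelon:
  fixes F :: "(nat \<Rightarrow> int) \<Rightarrow> (nat \<Rightarrow> int)"
  assumes F: "additive_on k F"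
  shows "\<exists>T s. lattice_aut k T \<and> s \<le> k \<and> s \<le> m \<and>
    (\<forall>x\<in>int_vecs k. (\<forall>j<m. F (T x) j = 0) \<longleftrightarrow> (\<forall>i<s. x i = 0))"
proof (induction m)
  case 0
  have "lattice_aut k (\<lambda>x. x)" by (rule lattice_autI[where S = "\<lambda>x. x"]) (auto simp: additive_on_def)
  then show ?case by (intro exI[of _ "\<lambda>x. x"] exI[of _ 0]) simp
next
  case (Suc m)
  then obtain T s where T: "lattice_aut k T" "s \<le> k" "s \<le> m"
    "\<And>x. x \<in> int_vecs k \<Longrightarrow> (\<forall>j<m. F (T x) j = 0) \<longleftrightarrow> (\<forall>i<s. x i = 0)" by blast
  have FT: "additive_on k (\<lambda>x. F (T x))"
    by (rule additive_on_comp[OF F]) (use T in \<open>auto simp: lattice_aut_in lattice_aut_add\<close>)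
  show ?case
  proof (cases "s = k")
    case True
    have "F (T x) m = 0" if "x \<in> int_vecs k" "\<forall>i<s. x i = 0" for x
    proof -
      have "x = 0" using that True by (auto simp: fun_eq_iff int_vecs_def not_less[symmetric])
      then show ?thesis using additive_on_0[OF FT] by simp
    qed
    then show ?thesis using T
      by (intro exI[of _ T] exI[of _ s]) (auto simp: less_Suc_eq)
  next
    case False
    then have sk: "s < k" using T by simp
    obtain T' g where T': "lattice_aut k T'" "\<forall>x\<in>int_vecs k. \<forall>i<s. T' x i = x i"
      "\<forall>x\<in>int_vecs k. (\<forall>i<s. x i = 0) \<longrightarrow> (\<Sum>i<k. F (T (unit_vec i)) m * T' x i) = g * x s"
      using euclid_aut[OF sk, of "\<lambda>i. F (T (unit_vec i)) m"] by blast
    have Fm: "F (T (T' x)) m = g * x s" if "x \<in> int_vecs k" "\<forall>i<s. x i = 0" for x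
      using T'(3) that additive_on_expand_vec[OF FT lattice_aut_in[OF T'(1) that(1)], of m]
      by (simp add: mult.commute)
    have old: "(\<forall>j<m. F (T (T' x)) j = 0) \<longleftrightarrow> (\<forall>i<s. x i = 0)" if "x \<in> int_vecs k" for x
      using T(4)[OF lattice_aut_in[OF T'(1) that]] T'(2) that by simp
    have comp: "lattice_aut k (\<lambda>x. T (T' x))" by (rule lattice_aut_comp[OF T(1) T'(1)])
    show ?thesis
    proof (cases "g = 0")
      case True
      have "\<forall>x\<in>int_vecs k. (\<forall>j<Suc m. F (T (T' x)) j = 0) \<longleftrightarrow> (\<forall>i<s. x i = 0)"
        using old Fm True by (metis less_Suc_eq mult_zero_left)
      then show ?thesis using comp T(2,3)
        by (intro exI[of _ "\<lambda>x. T (T' x)"] exI[of _ s]) simp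
    next
      case g: False
      have "\<forall>x\<in>int_vecs k. (\<forall>j<Suc m. F (T (T' x)) j = 0) \<longleftrightarrow> (\<forall>i<Suc s. x i = 0)"
        using old Fm g by (metis less_Suc_eq mult_eq_0_iff)
      then show ?thesis using comp T(3) sk
        by (intro exI[of _ "\<lambda>x. T (T' x)"] exI[of _ "Suc s"]) simp
    qed
  qed
qed

text \<open>If there were fewer than \<open>k\<close> pivots, the basis vector at position
  \<open>s\<close> of the echelon form would be killed by all \<open>m\<close> functionals.\<close>

lemma injective_dim_le:
  fixes F :: "(nat \<Rightarrow> int) \<Rightarrow> (nat \<Rightarrow> int)"
  assumes F: "additive_on k F" and inj: "\<And>x. x \<in> int_vecs k \<Longrightarrow> \<forall>j<m. F x j = 0 \<Longrightarrow> x = 0"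
  shows "k \<le> m"
proof -
  obtain T s where T: "lattice_aut k T" "s \<le> k" "s \<le> m"
    "\<forall>x\<in>int_vecs k. (\<forall>j<m. F (T x) j = 0) \<longleftrightarrow> (\<forall>i<s. x i = 0)"
    using echelon[OF F, of m] by blast
  have "s = k"
  proof (rule ccontr)
    assume "s \<noteq> k"
    then have s: "unit_vec s \<in> int_vecs k" using T by simp
    then have "\<forall>j<m. F (T (unit_vec s)) j = 0" using T(4) s by (auto simp: unit_vec_def)
    then have "T (unit_vec s) = T 0"
      using inj[OF lattice_aut_in[OF T(1) s]] additive_on_0[OF lattice_aut_add[OF T(1)]] by simp
    then have "unit_vec s = (0 :: nat \<Rightarrow> int)"
      using T(1) s unfolding lattice_aut_def bij_betw_def by (meson inj_onD int_vecs_closed(1))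
    then have "unit_vec s s = (0::int)" by simp
    then show False by (simp add: unit_vec_def)
  qed
  then show ?thesis using T by simp
qed

text \<open>A right inverse up to the scalar \<open>N\<close>, which stands in for inversion over
  the rationals. \<open>N\<close> is the product of the individual multipliers, and the cofactor
  \<open>M i\<close> brings the i-th one up to \<open>N\<close>.\<close>

lemma scaled_section:
  fixes F :: "(nat \<Rightarrow> int) \<Rightarrow> (nat \<Rightarrow> int)"
  assumes F: "additive_on k F"
    and ex: "\<And>i. i < r \<Longrightarrow> \<exists>n x. n > 0 \<and> x \<in> int_vecs k \<and> (\<forall>j<r. F x j = n * unit_vec i j)"
  obtains N :: int and Z where "N > 0" "additive_on r Z" "\<And>y. Z y \<in> int_vecs k"
    "\<And>y j. j < r \<Longrightarrow> F (Z y) j = N * y j"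
proof -
  obtain n b where nb: "\<And>i. i < r \<Longrightarrow> n i > 0 \<and> b i \<in> int_vecs k \<and> (\<forall>j<r. F (b i) j = n i * unit_vec i j)"
    using ex by metis
  define N where "N = (\<Prod>i<r. n i)"
  define M where "M i = (\<Prod>l\<in>{..<r} - {i}. n l)" for i
  have NM: "N = M i * n i" if "i < r" for i
    using that prod.remove[of "{..<r}" i n] by (simp add: N_def M_def mult.commute)
  define Z where "Z y = (\<lambda>l. \<Sum>i<r. y i * M i * b i l)" for y :: "nat \<Rightarrow> int"
  have Z: "Z y \<in> int_vecs k" for y
    unfolding Z_def by (intro int_vecsI sum.neutral) (use nb in \<open>auto simp: int_vecs_def\<close>)
  have "F (Z y) j = N * y j" if "j < r" for y j
  proof -
    have "F (Z y) j = (\<Sum>l<k. (\<Sum>i<r. y i * M i * b i l) * F (unit_vec l) j)"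
      using additive_on_expand_vec[OF F Z] by (simp add: Z_def)
    also have "\<dots> = (\<Sum>i<r. y i * M i * (\<Sum>l<k. b i l * F (unit_vec l) j))"
      unfolding sum_distrib_left sum_distrib_right by (subst sum.swap) (simp add: mult.assoc)
    also have "\<dots> = (\<Sum>i<r. y i * M i * F (b i) j)"
      using additive_on_expand_vec[OF F] nb by (intro sum.cong) auto
    also have "\<dots> = (\<Sum>i<r. if i = j then N * y j else 0)"
      using nb that by (intro sum.cong) (auto simp: unit_vec_def NM)
    finally show ?thesis using that by simp
  qed
  moreover have "N > 0" unfolding N_def using nb by (intro prod_pos) auto
  moreover have "additive_on r Z"
    by (simp add: additive_on_def Z_def fun_eq_iff distrib_right sum.distrib)
  ultimately show ?thesis using that Z by blast
qed

lemma injective_finite_index: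
  fixes F :: "(nat \<Rightarrow> int) \<Rightarrow> (nat \<Rightarrow> int)"
  assumes F: "additive_on r F" and inj: "\<And>x. x \<in> int_vecs r \<Longrightarrow> \<forall>j<r. F x j = 0 \<Longrightarrow> x = 0"
  obtains N :: int and Z where "N > 0" "additive_on r Z" "\<And>y. Z y \<in> int_vecs r"
    "\<And>y j. j < r \<Longrightarrow> F (Z y) j = N * y j"
proof (rule scaled_section[OF F])
  show "\<exists>n x. n > 0 \<and> x \<in> int_vecs r \<and> (\<forall>j<r. F x j = n * unit_vec i j)" if "i < r" for i
  proof (rule ccontr)
    assume no: "\<not> ?thesis"
    \<comment> \<open>If no positive multiple of the i-th unit vector were attained, adjoining that
      vector as a further column would give an injective additive map from rank r + 1 to rank
      r.\<close>
    define F' where "F' x = (\<lambda>j. F (trunc r x) j - x r * unit_vec i j)" for x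
    have tr: "trunc r (x + y) = trunc r x + trunc r y" for x y
      by (auto simp: trunc_def fun_eq_iff)
    have "additive_on (Suc r) F'"
      by (auto simp: additive_on_def F'_def tr fun_eq_iff additive_onD[OF F] algebra_simps)
    then have "Suc r \<le> r"
    proof (rule injective_dim_le)
      fix x assume x: "x \<in> int_vecs (Suc r)" "\<forall>j<r. F' x j = 0"
      have F1: "\<forall>j<r. F (trunc r x) j = x r * unit_vec i j" using x by (simp add: F'_def)
      then have F2: "\<forall>j<r. F (- trunc r x) j = (- x r) * unit_vec i j"
        using additive_on_minus[OF F, of "trunc r x"] by simp
      have xr: "x r = 0"
      proof (rule ccontr)
        assume "x r \<noteq> 0"
        then consider "x r > 0" | "- x r > 0" by linarith
        then show False
          using no F1 F2 trunc_in(1)[of r x] int_vecs_closed(4)[OF trunc_in(1)[of r x]] by cases blast+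
      qed
      then have "trunc r x = 0" using F1 inj[OF trunc_in(1)] by simp
      then have "x i = 0" if "i < r" for i using that by (auto simp: trunc_def fun_eq_iff split: if_splits)
      then show "x = 0" using x(1) xr by (auto simp: fun_eq_iff int_vecs_def) (metis le_neq_implies_less not_less Suc_leI)
    qed
    then show False by simp
  qed
qed (rule that)

section \<open>Bases adapted to an additive map\<close>

definition shift :: "nat \<Rightarrow> (nat \<Rightarrow> int) \<Rightarrow> (nat \<Rightarrow> int)" where
  "shift s x = (\<lambda>i. if i < s then 0 else x (i - s))"

lemma additive_on_dot_left:
  "additive_on m F \<Longrightarrow> additive_on m (\<lambda>x. dot k (F x) v)"
  by (simp add: additive_on_def dot_def distrib_right sum.distrib)

lemma additive_on_dot: "additive_on m (dot k x)"
  by (simp add: additive_on_def dot_def distrib_left sum.distrib)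

lemma additive_on_cut:
  fixes F :: "(nat \<Rightarrow> int) \<Rightarrow> nat \<Rightarrow> int"
  shows "(\<And>j. j < m \<Longrightarrow> additive_on k (\<lambda>x. F x j)) \<Longrightarrow> additive_on k (\<lambda>x j. if j < m then F x j else 0)"
  by (simp add: additive_on_def fun_eq_iff)

lemma dot_unit_left: "i < k \<Longrightarrow> dot k (unit_vec i) v = v i"
proof -
  assume "i < k"
  have "dot k (unit_vec i) v = (\<Sum>j<k. if j = i then v i else 0)"
    unfolding dot_def by (rule sum.cong) (auto simp: unit_vec_def)
  then show ?thesis using \<open>i < k\<close> by simp
qed

lemma dot_unit_right: "i < k \<Longrightarrow> dot k v (unit_vec i) = v i"
  using dot_unit_left[of i k v] by (simp add: dot_def mult.commute)

lemma lattice_param_in: "lattice_param m \<theta> L \<Longrightarrow> x \<in> int_vecs m \<Longrightarrow> \<theta> x \<in> L"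
  by (auto simp: lattice_param_def bij_betw_def)

lemma lattice_param_surj: "lattice_param m \<theta> L \<Longrightarrow> v \<in> L \<Longrightarrow> \<exists>x\<in>int_vecs m. v = \<theta> x"
  by (auto simp: lattice_param_def bij_betw_def)

lemma lattice_param_add: "lattice_param m \<theta> L \<Longrightarrow> additive_on m \<theta>"
  by (simp add: lattice_param_def)

lemma lattice_param_ker:
  assumes "lattice_param m \<theta> L" "x \<in> int_vecs m" "\<theta> x = 0"
  shows "x = 0"
proof -
  have "\<theta> x = \<theta> 0" using assms additive_on_0[OF lattice_param_add[OF assms(1)]] by simp
  then show ?thesis using assms(1,2) by (auto simp: lattice_param_def bij_betw_def inj_on_def)
qed

lemma int_vecs_eqI: "x \<in> int_vecs k \<Longrightarrow> y \<in> int_vecs k \<Longrightarrow> (\<And>i. i < k \<Longrightarrow> x i = y i) \<Longrightarrow> x = y"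
  by (auto simp: fun_eq_iff int_vecs_def) (metis not_le)

lemma int_vecs_eq_0I: "x \<in> int_vecs k \<Longrightarrow> (\<And>i. i < k \<Longrightarrow> x i = 0) \<Longrightarrow> x = 0"
  by (rule int_vecs_eqI) auto

text \<open>Rank-nullity over \<int>: after the echelon change of coordinates the last m - s basis
  vectors of \<open>L\<close> form a basis of the kernel of \<open>F\<close> on \<open>L\<close>,
  and the first \<open>s\<close> are mapped to a basis of the image. Kernels, images and radicals
  all receive their parametrisations from here.\<close>

lemma adapted_param:
  fixes F :: "(nat \<Rightarrow> int) \<Rightarrow> (nat \<Rightarrow> int)"
  assumes \<theta>: "lattice_param m \<theta> L" and L: "L \<subseteq> int_vecs k" and F: "additive_on k F"
    and Fq: "\<And>x. x \<in> int_vecs k \<Longrightarrow> F x \<in> int_vecs q"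
  shows "\<exists>s \<theta>'. s \<le> m \<and> s \<le> q \<and> lattice_param m \<theta>' L \<and>
    (\<forall>x\<in>int_vecs m. F (\<theta>' x) = 0 \<longleftrightarrow> (\<forall>i<s. x i = 0)) \<and>
    (\<forall>x\<in>int_vecs m. F (\<theta>' x) = F (\<theta>' (trunc s x))) \<and>
    lattice_param s (\<lambda>x. F (\<theta>' x)) (F ` L) \<and>
    lattice_param (m - s) (\<lambda>x. \<theta>' (shift s x)) {x \<in> L. F x = 0}"
proof -
  have b: "bij_betw \<theta> (int_vecs m) L" and a: "additive_on m \<theta>"
    using \<theta> by (auto simp: lattice_param_def)
  have \<theta>k: "\<theta> x \<in> int_vecs k" if "x \<in> int_vecs m" for x
    using that b L by (auto simp: bij_betw_def)
  have F\<theta>: "additive_on m (\<lambda>x. F (\<theta> x))" by (rule additive_on_comp[OF F a \<theta>k])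
  obtain T s where T: "lattice_aut m T" "s \<le> m" "s \<le> q"
    and Ts: "\<forall>x\<in>int_vecs m. (\<forall>j<q. F (\<theta> (T x)) j = 0) \<longleftrightarrow> (\<forall>i<s. x i = 0)"
    using echelon[OF F\<theta>, of q] by blast
  define \<theta>' where "\<theta>' x = \<theta> (T x)" for x
  have b': "bij_betw \<theta>' (int_vecs m) L"
    unfolding \<theta>'_def using bij_betw_trans[OF _ b, of T "int_vecs m"] T(1)
    by (auto simp: lattice_aut_def comp_def)
  have a': "additive_on m \<theta>'"
    unfolding \<theta>'_def by (rule additive_on_comp[OF a]) (use T(1) in \<open>auto simp: lattice_aut_add lattice_aut_in\<close>)
  have \<theta>'L: "\<theta>' x \<in> L" if "x \<in> int_vecs m" for x using that b' by (auto simp: bij_betw_def)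
  have \<theta>'k: "\<theta>' x \<in> int_vecs k" if "x \<in> int_vecs m" for x using \<theta>'L[OF that] L by auto
  have F': "additive_on m (\<lambda>x. F (\<theta>' x))" by (rule additive_on_comp[OF F a' \<theta>'k])
  have ker: "F (\<theta>' x) = 0 \<longleftrightarrow> (\<forall>i<s. x i = 0)" if "x \<in> int_vecs m" for x
  proof -
    have "F (\<theta>' x) = 0 \<longleftrightarrow> (\<forall>j<q. F (\<theta>' x) j = 0)"
      using Fq[OF \<theta>'k[OF that]] by (auto simp: fun_eq_iff int_vecs_def not_le[symmetric])
    then show ?thesis using Ts that by (simp add: \<theta>'_def)
  qed
  have tr: "F (\<theta>' x) = F (\<theta>' (trunc s x))" if x: "x \<in> int_vecs m" for x
  proof -
    have t: "trunc s x \<in> int_vecs m" using T(2) by (rule trunc_in_le)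
    have "F (\<theta>' (x - trunc s x)) = 0" using x t by (subst ker) (auto simp: trunc_def)
    then show ?thesis using additive_on_diff[OF F' x t] by simp
  qed
  have sm: "int_vecs s \<subseteq> int_vecs m" using T(2) by (rule int_vecs_mono)
  have p1: "lattice_param s (\<lambda>x. F (\<theta>' x)) (F ` L)"
    unfolding lattice_param_def bij_betw_def
  proof (intro conjI)
    show "additive_on s (\<lambda>x. F (\<theta>' x))" using additive_on_mono[OF F' T(2)] .
    show "inj_on (\<lambda>x. F (\<theta>' x)) (int_vecs s)"
    proof (rule inj_onI)
      fix x y assume xy: "x \<in> int_vecs s" "y \<in> int_vecs s" "F (\<theta>' x) = F (\<theta>' y)"
      then have "F (\<theta>' (x - y)) = 0" using additive_on_diff[OF F', of x y] sm by auto
      then have "\<forall>i<s. (x - y) i = 0" using ker[of "x - y"] xy sm by auto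
      then show "x = y" using xy(1,2) by (auto simp: fun_eq_iff int_vecs_def) (metis not_le)
    qed
    show "(\<lambda>x. F (\<theta>' x)) ` int_vecs s = F ` L"
    proof
      show "(\<lambda>x. F (\<theta>' x)) ` int_vecs s \<subseteq> F ` L" using \<theta>'L sm by auto
      show "F ` L \<subseteq> (\<lambda>x. F (\<theta>' x)) ` int_vecs s"
      proof
        fix z assume "z \<in> F ` L"
        then obtain x where "x \<in> int_vecs m" "z = F (\<theta>' x)" using b' by (auto simp: bij_betw_def)
        then show "z \<in> (\<lambda>x. F (\<theta>' x)) ` int_vecs s" using tr trunc_in(1) by blast
      qed
    qed
  qed
  have sh: "shift s x \<in> int_vecs m" "\<forall>i<s. shift s x i = 0" if "x \<in> int_vecs (m - s)" for x
    using that by (auto simp: shift_def int_vecs_def)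
  have p2: "lattice_param (m - s) (\<lambda>x. \<theta>' (shift s x)) {x \<in> L. F x = 0}"
    unfolding lattice_param_def bij_betw_def
  proof (intro conjI)
    have "shift s (x + y) = shift s x + shift s y" for x y by (auto simp: shift_def fun_eq_iff)
    then have "additive_on (m - s) (shift s)" by (simp add: additive_on_def)
    then show "additive_on (m - s) (\<lambda>x. \<theta>' (shift s x))" by (rule additive_on_comp[OF a']) (rule sh)
    show "inj_on (\<lambda>x. \<theta>' (shift s x)) (int_vecs (m - s))"
    proof (rule inj_onI)
      fix x y assume xy: "x \<in> int_vecs (m - s)" "y \<in> int_vecs (m - s)" "\<theta>' (shift s x) = \<theta>' (shift s y)"
      then have e: "shift s x = shift s y" using b' sh(1) by (auto simp: bij_betw_def inj_on_def)
      have "x i = y i" for i using fun_cong[OF e, of "i + s"] by (simp add: shift_def)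
      then show "x = y" by (rule ext)
    qed
    show "(\<lambda>x. \<theta>' (shift s x)) ` int_vecs (m - s) = {x \<in> L. F x = 0}"
    proof
      show "(\<lambda>x. \<theta>' (shift s x)) ` int_vecs (m - s) \<subseteq> {x \<in> L. F x = 0}"
        using sh \<theta>'L ker by auto
      show "{x \<in> L. F x = 0} \<subseteq> (\<lambda>x. \<theta>' (shift s x)) ` int_vecs (m - s)"
      proof
        fix z assume "z \<in> {x \<in> L. F x = 0}"
        then obtain x where x: "x \<in> int_vecs m" "z = \<theta>' x" "F (\<theta>' x) = 0"
          using b' by (auto simp: bij_betw_def)
        then have "\<forall>i<s. x i = 0" using ker by blast
        then have "x = shift s (\<lambda>i. x (i + s))" by (auto simp: shift_def fun_eq_iff)
        moreover have "(\<lambda>i. x (i + s)) \<in> int_vecs (m - s)" using x(1) by (auto simp: int_vecs_def)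
        ultimately show "z \<in> (\<lambda>x. \<theta>' (shift s x)) ` int_vecs (m - s)"
          using x(2) image_eqI[of z "\<lambda>x. \<theta>' (shift s x)" "\<lambda>i. x (i + s)"] by simp
      qed
    qed
  qed
  have "lattice_param m \<theta>' L" using b' a' by (simp add: lattice_param_def)
  then show ?thesis using T(2,3) ker tr p1 p2 by blast
qed

section \<open>Uniqueness of the rank and extension of independent systems\<close>

lemma lattice_param_le:
  assumes "lattice_param m \<theta> L" "lattice_param m' \<theta>' L'" "L \<subseteq> L'"
  shows "m \<le> m'"
proof -
  obtain \<phi> where \<phi>: "\<And>x. x \<in> L' \<Longrightarrow> \<phi> x \<in> int_vecs m'" "\<And>x. x \<in> L' \<Longrightarrow> \<theta>' (\<phi> x) = x"
    "\<And>x. x \<in> int_vecs m' \<Longrightarrow> \<phi> (\<theta>' x) = x"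
    "\<And>x y. x \<in> L' \<Longrightarrow> y \<in> L' \<Longrightarrow> x + y \<in> L' \<and> \<phi> (x + y) = \<phi> x + \<phi> y"
    using lattice_param_inv[OF assms(2)] by metis
  have \<theta>: "\<theta> x \<in> L'" if "x \<in> int_vecs m" for x
    using assms(1,3) that by (auto simp: lattice_param_def bij_betw_def)
  have a: "additive_on m \<theta>" using assms(1) by (simp add: lattice_param_def)
  have "additive_on m (\<lambda>x. \<phi> (\<theta> x))"
    using \<phi>(4) \<theta> by (simp add: additive_on_def additive_onD[OF a])
  then show ?thesis
  proof (rule injective_dim_le)
    fix x assume x: "x \<in> int_vecs m" "\<forall>j<m'. \<phi> (\<theta> x) j = 0"
    then have "\<phi> (\<theta> x) = 0" using int_vecsD[OF \<phi>(1)[OF \<theta>[OF x(1)]]] by (simp add: fun_eq_iff) (metis not_le)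
    then have "\<theta> x = \<theta>' 0" using \<phi>(2)[OF \<theta>[OF x(1)]] by simp
    moreover have "\<theta>' 0 = \<theta> 0"
      using assms(1,2) additive_on_0[of m \<theta>] additive_on_0[of m' \<theta>'] by (simp add: lattice_param_def)
    ultimately have "\<theta> x = \<theta> 0" by simp
    then show "x = 0" using assms(1) x(1) by (auto simp: lattice_param_def bij_betw_def inj_on_def)
  qed
qed

lemma lattice_param_unique:
  "lattice_param m \<theta> L \<Longrightarrow> lattice_param m' \<theta>' L \<Longrightarrow> m = m'"
  using lattice_param_le[of m \<theta> L m' \<theta>' L] lattice_param_le[of m' \<theta>' L m \<theta> L] by simp

text \<open>The new unit vector is sent to a unit vector of the target no positive multiple of which
  lies in the image. Such a vector exists: otherwise a section up to a scalar would embed \<int>^q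
  into \<int>^d.\<close>

lemma extend_injective_Suc:
  fixes \<phi> :: "(nat \<Rightarrow> int) \<Rightarrow> (nat \<Rightarrow> int)"
  assumes \<phi>: "additive_on d \<phi>" "\<And>x. x \<in> int_vecs d \<Longrightarrow> \<phi> x \<in> int_vecs q"
    "\<And>x. x \<in> int_vecs d \<Longrightarrow> \<phi> x = 0 \<Longrightarrow> x = 0" and d: "d < q"
  obtains \<phi>' where "additive_on (Suc d) \<phi>'" "\<And>x. x \<in> int_vecs (Suc d) \<Longrightarrow> \<phi>' x \<in> int_vecs q"
    "\<And>x. x \<in> int_vecs (Suc d) \<Longrightarrow> \<phi>' x = 0 \<Longrightarrow> x = 0" "\<And>x. x \<in> int_vecs d \<Longrightarrow> \<phi>' x = \<phi> x"
proof -
  have "\<exists>i<q. \<forall>n x. n > 0 \<longrightarrow> x \<in> int_vecs d \<longrightarrow> \<phi> x \<noteq> (\<lambda>j. n * unit_vec i j)"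
  proof (rule ccontr)
    assume "\<not> ?thesis"
    then have "\<exists>n x. n > 0 \<and> x \<in> int_vecs d \<and> (\<forall>j<q. \<phi> x j = n * unit_vec i j)" if "i < q" for i
      using that by (metis (no_types, lifting))
    then obtain N Z where NZ: "(N::int) > 0" "additive_on q Z" "\<And>y. Z y \<in> int_vecs d"
      "\<And>y j. j < q \<Longrightarrow> \<phi> (Z y) j = N * y j"
      using scaled_section[OF \<phi>(1), of q] by metis
    have "q \<le> d"
    proof (rule injective_dim_le[OF NZ(2)])
      fix y assume y: "y \<in> int_vecs q" "\<forall>j<d. Z y j = 0"
      then have "Z y = 0" using int_vecsD[OF NZ(3)] by (simp add: fun_eq_iff) (metis not_le)
      then have "N * y j = 0" if "j < q" for j
        using NZ(4)[OF that, of y] additive_on_0[OF \<phi>(1)] by simp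
      then show "y = 0" using NZ(1) y(1) by (auto simp: fun_eq_iff int_vecs_def) (metis not_le)
    qed
    then show False using d by simp
  qed
  then obtain i where i: "i < q" "\<And>n x. n > 0 \<Longrightarrow> x \<in> int_vecs d \<Longrightarrow> \<phi> x \<noteq> (\<lambda>j. n * unit_vec i j)"
    by blast
  define \<phi>' where "\<phi>' x = \<phi> (trunc d x) + (\<lambda>j. x d * unit_vec i j)" for x
  show ?thesis
  proof
    have t: "trunc d (x + y) = trunc d x + trunc d y" for x y by (auto simp: trunc_def fun_eq_iff)
    show "additive_on (Suc d) \<phi>'"
      by (auto simp: additive_on_def \<phi>'_def t additive_onD[OF \<phi>(1)] fun_eq_iff algebra_simps)
    show "\<phi>' x \<in> int_vecs q" for x
      unfolding \<phi>'_def by (intro int_vecs_closed unit_vec_in \<phi>(2) trunc_in i)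
    show "\<phi>' x = \<phi> x" if "x \<in> int_vecs d" for x
      using that by (simp add: \<phi>'_def trunc_id int_vecsD fun_eq_iff)
    show "x = 0" if x: "x \<in> int_vecs (Suc d)" "\<phi>' x = 0" for x
    proof -
      have e: "\<phi> (trunc d x) j = - x d * unit_vec i j" for j
        using fun_cong[OF x(2), of j] by (simp add: \<phi>'_def)
      then have "\<phi> (trunc d x) = (\<lambda>j. - x d * unit_vec i j)" by (rule ext)
      \<comment> \<open>The index \<open>i\<close> excludes positive multiples only, so that both
        signs of \<open>x d\<close> have to be treated.\<close>
      moreover have "\<phi> (- trunc d x) = (\<lambda>j. x d * unit_vec i j)"
        using additive_on_minus[OF \<phi>(1) trunc_in(1)] e by (simp add: fun_eq_iff)
      ultimately have "\<not> x d < 0" "\<not> x d > 0"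
        using i(2)[OF _ trunc_in(1)[of d x]] i(2)[OF _ int_vecs_closed(4)[OF trunc_in(1)[of d x]]]
        by (metis neg_0_less_iff_less, metis)
      then have xd: "x d = 0" by simp
      then have "trunc d x = 0" using \<phi>(3)[OF trunc_in(1)[of d x]] e by (simp add: fun_eq_iff)
      then have "trunc d x j = 0" for j by simp
      then have "x j = 0" if "j < d" for j using that by (simp add: trunc_def split: if_splits) metis
      then show "x = 0" using x(1) xd by (auto simp: fun_eq_iff int_vecs_def) (metis not_less_eq_eq le_neq_implies_less not_le)
    qed
  qed
qed

lemma extend_injective:
  fixes \<phi> :: "(nat \<Rightarrow> int) \<Rightarrow> (nat \<Rightarrow> int)"
  assumes \<phi>: "additive_on d \<phi>" "\<And>x. x \<in> int_vecs d \<Longrightarrow> \<phi> x \<in> int_vecs q"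
    "\<And>x. x \<in> int_vecs d \<Longrightarrow> \<phi> x = 0 \<Longrightarrow> x = 0" and d: "d \<le> p" "p \<le> q"
  shows "\<exists>\<phi>'. additive_on p \<phi>' \<and> (\<forall>x\<in>int_vecs p. \<phi>' x \<in> int_vecs q) \<and>
    (\<forall>x\<in>int_vecs p. \<phi>' x = 0 \<longrightarrow> x = 0) \<and> (\<forall>x\<in>int_vecs d. \<phi>' x = \<phi> x)"
  using d
proof (induction p rule: dec_induct)
  case base
  then show ?case using \<phi> by blast
next
  case (step n)
  then obtain \<psi> where \<psi>: "additive_on n \<psi>" "\<And>x. x \<in> int_vecs n \<Longrightarrow> \<psi> x \<in> int_vecs q"
    "\<And>x. x \<in> int_vecs n \<Longrightarrow> \<psi> x = 0 \<Longrightarrow> x = 0" "\<And>x. x \<in> int_vecs d \<Longrightarrow> \<psi> x = \<phi> x"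
    by (metis Suc_leD)
  have "n < q" using step by simp
  from extend_injective_Suc[OF \<psi>(1-3) this] obtain \<phi>' where
    \<phi>': "additive_on (Suc n) \<phi>'" "\<And>x. x \<in> int_vecs (Suc n) \<Longrightarrow> \<phi>' x \<in> int_vecs q"
    "\<And>x. x \<in> int_vecs (Suc n) \<Longrightarrow> \<phi>' x = 0 \<Longrightarrow> x = 0" "\<And>x. x \<in> int_vecs n \<Longrightarrow> \<phi>' x = \<psi> x"
    by metis
  have "\<forall>x\<in>int_vecs d. \<phi>' x = \<phi> x" using \<phi>'(4) \<psi>(4) int_vecs_mono[OF step(1)] by auto
  then show ?case using \<phi>'(1-3) by blast
qed


section \<open>An endomorphism of \<int>^k together with a compatible bilinear form\<close>

locale twisted_form =
  fixes k :: nat and D :: "(nat \<Rightarrow> int) \<Rightarrow> (nat \<Rightarrow> int)"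
    and om :: "(nat \<Rightarrow> int) \<Rightarrow> (nat \<Rightarrow> int) \<Rightarrow> int"
  assumes D_add: "additive_on k D" and D_in: "x \<in> int_vecs k \<Longrightarrow> D x \<in> int_vecs k"
    and om_add_left: "v \<in> int_vecs k \<Longrightarrow> additive_on k (\<lambda>w. om w v)"
    and om_add_right: "w \<in> int_vecs k \<Longrightarrow> additive_on k (om w)"
    and om_D: "w \<in> int_vecs k \<Longrightarrow> v \<in> int_vecs k \<Longrightarrow> D w = 0 \<Longrightarrow> om w (D v) = 0"
begin

definition rad :: "(nat \<Rightarrow> int) set" where
  "rad = {v \<in> int_vecs k. \<forall>y\<in>int_vecs k. om v y = 0}"

text \<open>The coefficient vector of the functional \<open>om w\<close>. It makes the radical the
  kernel of an additive map, to which adapted bases apply.\<close>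

definition flat :: "(nat \<Rightarrow> int) \<Rightarrow> (nat \<Rightarrow> int)" where
  "flat w = (\<lambda>i. if i < k then om w (unit_vec i) else 0)"

lemma flat_in: "flat w \<in> int_vecs k"
  by (simp add: flat_def int_vecs_def)

lemma flat_add: "additive_on k flat"
  unfolding flat_def by (intro additive_on_cut om_add_left unit_vec_in)

lemma dot_flat: "w \<in> int_vecs k \<Longrightarrow> v \<in> int_vecs k \<Longrightarrow> dot k (flat w) v = om w v"
  using additive_on_expand[OF om_add_right, of w v] by (simp add: dot_def flat_def mult.commute)

lemma flat_eq_0: "w \<in> int_vecs k \<Longrightarrow> flat w = 0 \<longleftrightarrow> w \<in> rad"
proof
  assume w: "w \<in> int_vecs k" "flat w = 0"
  then have "om w y = 0" if "y \<in> int_vecs k" for y using dot_flat[OF w(1) that] by (simp add: dot_def)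
  then show "w \<in> rad" using w by (simp add: rad_def)
next
  assume "w \<in> rad"
  then show "flat w = 0" by (simp add: rad_def flat_def fun_eq_iff)
qed

text \<open>The transposed matrix: its kernel consists of the functionals, written as coefficient
  vectors, that vanish on the image of \<open>D\<close>.\<close>

definition D_transpose :: "(nat \<Rightarrow> int) \<Rightarrow> (nat \<Rightarrow> int)" where
  "D_transpose f = (\<lambda>j. if j < k then dot k f (D (unit_vec j)) else 0)"

lemma dot_D_transpose: "v \<in> int_vecs k \<Longrightarrow> dot k (D_transpose f) v = dot k f (D v)"
proof -
  assume v: "v \<in> int_vecs k"
  have "additive_on k (\<lambda>v. dot k f (D v))"
    by (rule additive_on_comp[OF additive_on_dot D_add D_in])
  from additive_on_expand[OF this v] show ?thesis
    by (simp add: D_transpose_def dot_def mult.commute)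
qed

lemma id_param: "lattice_param k (\<lambda>x. x) (int_vecs k)"
  by (simp add: lattice_param_def additive_on_def bij_betw_def)

text \<open>Transposition does not raise the rank, so that the kernel of the transpose has rank at
  least k - r.\<close>

lemma annihilator_rank:
  assumes r: "lattice_param r \<theta>D (D ` int_vecs k)"
  obtains q \<theta> where "lattice_param q \<theta> {f \<in> int_vecs k. D_transpose f = 0}" "q \<le> k" "k - r \<le> q"
proof -
  obtain r' T where T: "r' \<le> k" "lattice_param k T (int_vecs k)"
    "\<forall>x\<in>int_vecs k. D (T x) = D (T (trunc r' x))"
    "lattice_param r' (\<lambda>x. D (T x)) (D ` int_vecs k)"
    using adapted_param[OF id_param order_refl D_add D_in] by blast
  have "r' = r" by (rule lattice_param_unique[OF T(4) r])
  note T = T[unfolded this]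
  have DT_add: "additive_on k D_transpose"
    unfolding D_transpose_def by (intro additive_on_cut additive_on_dot_left) (simp add: additive_on_def)
  have DT_in: "D_transpose f \<in> int_vecs k" for f by (simp add: D_transpose_def int_vecs_def)
  obtain s U where U: "s \<le> k" "lattice_param k U (int_vecs k)"
    "\<forall>x\<in>int_vecs k. D_transpose (U x) = 0 \<longleftrightarrow> (\<forall>i<s. x i = 0)"
    "lattice_param (k - s) (\<lambda>x. U (shift s x)) {f \<in> int_vecs k. D_transpose f = 0}"
    using adapted_param[OF id_param order_refl DT_add DT_in] by blast
  have Tk: "T x \<in> int_vecs k" if "x \<in> int_vecs k" for x
    using T(2) that by (auto simp: lattice_param_def bij_betw_def)
  have Ta: "additive_on k T" using T(2) by (simp add: lattice_param_def)
  have Ua: "additive_on k U" using U(2) by (simp add: lattice_param_def)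
  have DTa: "additive_on k (\<lambda>x. D (T x))" by (rule additive_on_comp[OF D_add Ta Tk])
  \<comment> \<open>A functional that vanishes on the \<open>r\<close> generators of the image of
    \<open>D\<close> is in the kernel of the transpose. So pairing with these generators is
    injective on the span of the first \<open>s\<close> vectors of the basis
    \<open>U\<close>.\<close>
  have "s \<le> r"
  proof (rule injective_dim_le[of s "\<lambda>x j. dot k (U x) (D (T (unit_vec j)))"])
    show "additive_on s (\<lambda>x j. dot k (U x) (D (T (unit_vec j))))"
      by (intro additive_on_coordI additive_on_dot_left additive_on_mono[OF Ua U(1)])
    fix x assume x: "x \<in> int_vecs s" "\<forall>j<r. dot k (U x) (D (T (unit_vec j))) = 0"
    have "dot k (U x) (D v) = 0" if "v \<in> int_vecs k" for v
    proof -
      obtain y where y: "y \<in> int_vecs k" "v = T y" using lattice_param_surj[OF T(2) \<open>v \<in> _\<close>] by blast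
      have a: "additive_on k (\<lambda>y. dot k (U x) (D (T y)))"
        by (rule additive_on_comp[OF additive_on_dot DTa D_in[OF Tk]])
      have "dot k (U x) (D (T (trunc r y))) = 0"
        using additive_on_trunc[OF a T(1), of y] x(2) by simp
      then show ?thesis using T(3) y by simp
    qed
    then have "D_transpose (U x) = 0" by (simp add: D_transpose_def fun_eq_iff)
    moreover have "x \<in> int_vecs k" using x(1) int_vecs_mono[OF U(1)] by blast
    ultimately have "\<forall>i<s. x i = 0" using U(3) by blast
    then show "x = 0" using x(1) by (auto simp: fun_eq_iff int_vecs_def) (metis not_le)
  qed
  then show ?thesis using that[OF U(4)] by simp
qed


text \<open>The functionals \<open>om w\<close> with \<open>w\<close> in the kernel of \<open>D\<close> annihilate the image of \<open>D\<close>. They form a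
  lattice of rank \<open>dd\<close>, which is extended to a full rank sublattice of the annihilator; its functionals are
  the coordinates of \<open>\<Lambda>\<close>.\<close>

lemma adapted_coordinates:
  obtains r p dd dz rz :: nat and \<theta>D \<theta>R \<theta>DR \<kappa> \<Lambda> g :: "(nat \<Rightarrow> int) \<Rightarrow> (nat \<Rightarrow> int)"
    and t :: "nat \<Rightarrow> (nat \<Rightarrow> int)" and N M :: int
  where "r + p = k" "dd \<le> p" "rz \<le> dz" "int k - int r - (int dz - int rz) = int dd"
    "lattice_param r \<theta>D (D ` int_vecs k)" "lattice_param dz \<theta>R rad"
    "lattice_param rz \<theta>DR (D ` rad)" "lattice_param p \<kappa> {w \<in> int_vecs k. D w = 0}"
    "\<forall>x\<in>int_vecs p. \<kappa> x \<in> rad \<longleftrightarrow> (\<forall>i<dd. x i = 0)"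
    "additive_on k \<Lambda>" "\<forall>v. \<Lambda> v \<in> int_vecs p"
    "\<forall>v\<in>int_vecs k. \<Lambda> (D v) = 0"
    "\<forall>v\<in>int_vecs k. \<forall>j<dd. \<Lambda> v j = om (\<kappa> (unit_vec j)) v"
    "N > 0" "\<forall>i<p. t i \<in> int_vecs k \<and> \<Lambda> (t i) = (\<lambda>j. N * unit_vec i j)"
    "M > 0" "additive_on k g" "\<forall>u\<in>int_vecs k. g u \<in> int_vecs k"
    "\<forall>u\<in>int_vecs k. \<Lambda> u = 0 \<longrightarrow> D (g u) = (\<lambda>j. M * u j)"
proof -
  obtain r T1 where T1: "r \<le> k" "lattice_param k T1 (int_vecs k)"
    "\<forall>x\<in>int_vecs k. D (T1 x) = 0 \<longleftrightarrow> (\<forall>i<r. x i = 0)"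
    "lattice_param r (\<lambda>x. D (T1 x)) (D ` int_vecs k)"
    "lattice_param (k - r) (\<lambda>x. T1 (shift r x)) {w \<in> int_vecs k. D w = 0}"
    using adapted_param[OF id_param order_refl D_add D_in] by blast
  define p where "p = k - r"
  have rp: "r + p = k" using T1(1) by (simp add: p_def)
  \<comment> \<open>The basis of the kernel of \<open>D\<close> is adapted to \<open>flat\<close>:
    its members from \<open>dd\<close> on span the part inside the radical, and \<open>dd\<close> is
    the rank of the kernel modulo that part.\<close>
  let ?K = "{w \<in> int_vecs k. D w = 0}"
  obtain dd \<kappa> where \<kappa>: "dd \<le> p" "lattice_param p \<kappa> ?K"
    "\<forall>x\<in>int_vecs p. flat (\<kappa> x) = 0 \<longleftrightarrow> (\<forall>i<dd. x i = 0)"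
    "lattice_param (p - dd) (\<lambda>x. \<kappa> (shift dd x)) {w \<in> ?K. flat w = 0}"
    using adapted_param[OF T1(5)[folded p_def] _ flat_add flat_in] by blast
  obtain s0 T2 where T2: "lattice_param (k - s0) (\<lambda>x. T2 (shift s0 x)) {w \<in> int_vecs k. flat w = 0}"
    using adapted_param[OF id_param order_refl flat_add flat_in] by blast
  have rad_flat: "{w \<in> int_vecs k. flat w = 0} = rad" using flat_eq_0 by (auto simp: rad_def)
  define dz where "dz = k - s0"
  have rad_k: "rad \<subseteq> int_vecs k" by (auto simp: rad_def)
  have \<theta>R: "lattice_param dz (\<lambda>x. T2 (shift s0 x)) rad" using T2 by (simp add: rad_flat dz_def)
  obtain rz T3 where T3: "rz \<le> dz" "lattice_param rz (\<lambda>x. D (T3 x)) (D ` rad)"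
    "lattice_param (dz - rz) (\<lambda>x. T3 (shift rz x)) {w \<in> rad. D w = 0}"
    using adapted_param[OF \<theta>R rad_k D_add D_in] by blast
  \<comment> \<open>One lattice, the kernel of \<open>D\<close> on the radical, reached in two ways:
    its rank is p - dd from one side and dz - rz from the other. This identifies \<open>dd\<close>
    with the defect.\<close>
  have "{w \<in> ?K. flat w = 0} = {w \<in> rad. D w = 0}" using flat_eq_0 rad_k by auto
  then have "p - dd = dz - rz" using lattice_param_unique[OF \<kappa>(4)] T3(3) by simp
  then have defect: "int k - int r - (int dz - int rz) = int dd"
    using \<kappa>(1) T3(1) rp by linarith
  have \<kappa>k: "\<kappa> x \<in> int_vecs k" "D (\<kappa> x) = 0" if "x \<in> int_vecs p" for x
    using lattice_param_in[OF \<kappa>(2) that] by auto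
  have \<kappa>a: "additive_on p \<kappa>" using \<kappa>(2) by (rule lattice_param_add)
  define An where "An = {f \<in> int_vecs k. D_transpose f = 0}"
  obtain q \<theta> where \<theta>: "lattice_param q \<theta> An" "p \<le> q"
    using annihilator_rank[OF T1(4)] unfolding p_def An_def by metis
  \<comment> \<open>Here the compatibility of the form with \<open>D\<close> enters.\<close>
  have flatAn: "flat (\<kappa> c) \<in> An" if "c \<in> int_vecs p" for c
  proof -
    have "dot k (flat (\<kappa> c)) (D (unit_vec j)) = 0" if "j < k" for j
      using dot_flat[of "\<kappa> c" "D (unit_vec j)"] om_D[of "\<kappa> c" "unit_vec j"] \<kappa>k \<open>c \<in> _\<close> D_in that by simp
    then show ?thesis by (simp add: An_def flat_in D_transpose_def fun_eq_iff)
  qed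
  obtain \<theta>i where \<theta>i: "\<And>x. x \<in> An \<Longrightarrow> \<theta>i x \<in> int_vecs q" "\<And>x. x \<in> An \<Longrightarrow> \<theta> (\<theta>i x) = x"
    "\<And>x y. x \<in> An \<Longrightarrow> y \<in> An \<Longrightarrow> x + y \<in> An \<and> \<theta>i (x + y) = \<theta>i x + \<theta>i y"
    using lattice_param_inv[OF \<theta>(1)] by metis
  have ddp: "int_vecs dd \<subseteq> int_vecs p" using \<kappa>(1) by (rule int_vecs_mono)
  \<comment> \<open>In a basis of the annihilator the \<open>dd\<close> functionals
    \<open>om (\<kappa> c)\<close> are independent. They are extended to \<open>p\<close>
    independent ones, for which the annihilator has room because p \<le> q.\<close>
  have "\<exists>\<phi>. additive_on p \<phi> \<and> (\<forall>x\<in>int_vecs p. \<phi> x \<in> int_vecs q) \<and>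
    (\<forall>x\<in>int_vecs p. \<phi> x = 0 \<longrightarrow> x = 0) \<and> (\<forall>x\<in>int_vecs dd. \<phi> x = \<theta>i (flat (\<kappa> x)))"
  proof (rule extend_injective)
    have fa: "additive_on p (\<lambda>c. flat (\<kappa> c))" by (rule additive_on_comp[OF flat_add \<kappa>a \<kappa>k(1)])
    then show "additive_on dd (\<lambda>c. \<theta>i (flat (\<kappa> c)))"
      using \<theta>i(3) flatAn ddp additive_onD[OF fa] by (simp add: additive_on_def subset_iff)
    show "\<theta>i (flat (\<kappa> x)) \<in> int_vecs q" if "x \<in> int_vecs dd" for x using \<theta>i(1) flatAn ddp that by auto
    show "x = 0" if x: "x \<in> int_vecs dd" "\<theta>i (flat (\<kappa> x)) = 0" for x
    proof -
      have xp: "x \<in> int_vecs p" using x ddp by auto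
      have "flat (\<kappa> x) = \<theta> 0" using \<theta>i(2)[OF flatAn[OF xp]] x(2) by simp
      then have "flat (\<kappa> x) = 0" using additive_on_0[OF lattice_param_add[OF \<theta>(1)]] by simp
      then show "x = 0" using \<kappa>(3) xp x(1) int_vecs_eq_0I by blast
    qed
    show "dd \<le> p" "p \<le> q" by fact+
  qed
  then obtain \<phi> where \<phi>: "additive_on p \<phi>" "\<forall>x\<in>int_vecs p. \<phi> x \<in> int_vecs q"
    "\<forall>x\<in>int_vecs p. \<phi> x = 0 \<longrightarrow> x = 0" "\<forall>x\<in>int_vecs dd. \<phi> x = \<theta>i (flat (\<kappa> x))" by blast
  define f where "f c = \<theta> (\<phi> c)" for c
  have f_add: "additive_on p f" unfolding f_def
    by (rule additive_on_comp[OF lattice_param_add[OF \<theta>(1)] \<phi>(1)]) (use \<phi>(2) in auto)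
  have f_An: "f c \<in> An" if "c \<in> int_vecs p" for c
    unfolding f_def using lattice_param_in[OF \<theta>(1)] \<phi>(2) that by auto
  have f_inj: "c = 0" if "c \<in> int_vecs p" "f c = 0" for c
    using that lattice_param_ker[OF \<theta>(1)] \<phi>(2,3) unfolding f_def by blast
  have f_dd: "f c = flat (\<kappa> c)" if "c \<in> int_vecs dd" for c
    unfolding f_def using \<phi>(4) \<theta>i(2) flatAn ddp that by auto
  define \<Lambda> where "\<Lambda> v = (\<lambda>i. if i < p then dot k (f (unit_vec i)) v else 0)" for v
  have \<Lambda>a: "additive_on k \<Lambda>" unfolding \<Lambda>_def by (intro additive_on_cut additive_on_dot)
  have \<Lambda>in: "\<Lambda> v \<in> int_vecs p" for v by (simp add: \<Lambda>_def int_vecs_def)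
  have \<Lambda>D: "\<Lambda> (D v) = 0" if v: "v \<in> int_vecs k" for v
  proof -
    have "dot k (f (unit_vec i)) (D v) = 0" if "i < p" for i
      using dot_D_transpose[OF v, of "f (unit_vec i)"] f_An[of "unit_vec i"] that
      by (simp add: An_def dot_def)
    then show ?thesis by (simp add: \<Lambda>_def fun_eq_iff)
  qed
  have \<Lambda>om: "\<Lambda> v j = om (\<kappa> (unit_vec j)) v" if "v \<in> int_vecs k" "j < dd" for v j
    using that f_dd[of "unit_vec j"] \<kappa>(1) dot_flat[OF \<kappa>k(1)] by (simp add: \<Lambda>_def)
  have f\<Lambda>: "dot k (f c) v = (\<Sum>i<p. c i * \<Lambda> v i)" if "c \<in> int_vecs p" for c v
    using additive_on_expand[OF additive_on_dot_left[OF f_add] that, of k v] by (simp add: \<Lambda>_def)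
  obtain s T where T: "s \<le> k" "s \<le> p" "lattice_param k T (int_vecs k)"
    "\<forall>x\<in>int_vecs k. \<Lambda> (T x) = 0 \<longleftrightarrow> (\<forall>i<s. x i = 0)"
    "\<forall>x\<in>int_vecs k. \<Lambda> (T x) = \<Lambda> (T (trunc s x))"
    using adapted_param[OF id_param order_refl \<Lambda>a \<Lambda>in] by blast
  have Ta: "additive_on k T" using T(3) by (rule lattice_param_add)
  have Tk: "T x \<in> int_vecs k" if "x \<in> int_vecs k" for x using T(3) that by (rule lattice_param_in)
  have \<Lambda>T: "additive_on k (\<lambda>x. \<Lambda> (T x))" by (rule additive_on_comp[OF \<Lambda>a Ta Tk])
  \<comment> \<open>Again a comparison of row and column rank: a combination of the functionals that
    vanishes on \<open>s\<close> vectors generating modulo the kernel of \<open>\<Lambda>\<close>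
    vanishes altogether, and the functionals are independent.\<close>
  have "p \<le> s"
  proof (rule injective_dim_le[of p "\<lambda>c j. dot k (f c) (T (unit_vec j))"])
    show "additive_on p (\<lambda>c j. dot k (f c) (T (unit_vec j)))"
      by (intro additive_on_coordI additive_on_dot_left f_add)
    fix c assume c: "c \<in> int_vecs p" "\<forall>j<s. dot k (f c) (T (unit_vec j)) = 0"
    have "dot k (f c) v = 0" if "v \<in> int_vecs k" for v
    proof -
      obtain y where y: "y \<in> int_vecs k" "v = T y" using lattice_param_surj[OF T(3) \<open>v \<in> _\<close>] by blast
      have "dot k (f c) (T y) = dot k (f c) (T (trunc s y))"
        using T(5) y(1) by (simp add: f\<Lambda>[OF c(1)])
      also have "\<dots> = 0"
        using additive_on_trunc[OF additive_on_comp[OF additive_on_dot Ta Tk] T(1), of k "f c" y] c(2) by simp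
      finally show ?thesis using y(2) by simp
    qed
    then have "f c i = 0" if "i < k" for i using dot_unit_right[OF that, of "f c"] that by simp
    then have "f c = 0" using f_An[OF c(1)] by (auto simp: An_def intro: int_vecs_eq_0I)
    then show "c = 0" using f_inj c(1) by blast
  qed
  then have sp: "s = p" using T(2) by simp
  note T = T[unfolded sp]
  have pk: "int_vecs p \<subseteq> int_vecs k" using T(1) by (rule int_vecs_mono)
  have "x = 0" if "x \<in> int_vecs p" "\<forall>j<p. \<Lambda> (T x) j = 0" for x
  proof -
    have "\<Lambda> (T x) = 0" using that(2) \<Lambda>in by (auto intro: int_vecs_eq_0I)
    then have "\<forall>i<p. x i = 0" using T(4) that(1) pk by blast
    then show ?thesis using that(1) int_vecs_eq_0I by blast
  qed
  \<comment> \<open>On the span of the first \<open>p\<close> vectors of \<open>T\<close> the map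
    \<open>\<Lambda>\<close> is injective into \<int>^p, hence of finite index. This yields
    \<open>N\<close> and the preimages \<open>t i\<close>.\<close>
  from injective_finite_index[OF additive_on_mono[OF \<Lambda>T T(1)] this]
  obtain N Z where NZ: "(N::int) > 0" "\<And>y. Z y \<in> int_vecs p" "\<And>y j. j < p \<Longrightarrow> \<Lambda> (T (Z y)) j = N * y j"
    by metis
  define t where "t i = T (Z (unit_vec i))" for i
  have t: "\<forall>i<p. t i \<in> int_vecs k \<and> \<Lambda> (t i) = (\<lambda>j. N * unit_vec i j)"
  proof (intro allI impI conjI)
    fix i assume i: "i < p"
    show "t i \<in> int_vecs k" unfolding t_def using Tk NZ(2) pk by blast
    show "\<Lambda> (t i) = (\<lambda>j. N * unit_vec i j)"
      by (rule int_vecs_eqI[OF \<Lambda>in]) (use i NZ(3) in \<open>auto simp: t_def\<close>)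
  qed
  obtain S where S: "\<And>x. x \<in> int_vecs k \<Longrightarrow> S x \<in> int_vecs k" "\<And>x. x \<in> int_vecs k \<Longrightarrow> T (S x) = x"
    "\<And>x y. x \<in> int_vecs k \<Longrightarrow> y \<in> int_vecs k \<Longrightarrow> x + y \<in> int_vecs k \<and> S (x + y) = S x + S y"
    using lattice_param_inv[OF T(3)] by metis
  have Sa: "additive_on k S" using S(3) by (simp add: additive_on_def)
  have rk: "int_vecs r \<subseteq> int_vecs k" using T1(1) by (rule int_vecs_mono)
  have T1k: "T1 x \<in> int_vecs k" if "x \<in> int_vecs k" for x using T1(2) that by (rule lattice_param_in)
  have T1a: "additive_on k T1" using T1(2) by (rule lattice_param_add)
  \<comment> \<open>\<open>D\<close> in the coordinates \<open>T1\<close> of the source and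
    \<open>T\<close> of the target. Since \<open>\<Lambda>\<close> kills the image of
    \<open>D\<close>, only the last r = k - p target coordinates survive; there \<open>E\<close> is
    injective on \<int>^r, hence of finite index, and this yields \<open>M\<close>.\<close>
  define E where "E x = S (D (T1 x))" for x
  have Ea: "additive_on k E" unfolding E_def
    by (rule additive_on_comp[OF Sa additive_on_comp[OF D_add T1a T1k] D_in[OF T1k]])
  have Ek: "E x \<in> int_vecs k" if "x \<in> int_vecs k" for x unfolding E_def using S(1) D_in T1k that by blast
  have TE: "T (E x) = D (T1 x)" if "x \<in> int_vecs k" for x unfolding E_def using S(2) D_in T1k that by blast
  have E0: "E x i = 0" if "x \<in> int_vecs k" "i < p" for x i
    using T(4)[rule_format, OF Ek[OF that(1)]] TE[OF that(1)] \<Lambda>D[OF T1k[OF that(1)]] that(2) by simp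
  have "additive_on r (\<lambda>x j. E x (p + j))"
    by (rule additive_on_coordI, rule additive_on_coord, rule additive_on_mono[OF Ea T1(1)])
  moreover have "x = 0" if x: "x \<in> int_vecs r" "\<forall>j<r. E x (p + j) = 0" for x
  proof -
    have xk: "x \<in> int_vecs k" using x(1) rk by blast
    have "E x = 0"
    proof (rule int_vecs_eq_0I[OF Ek[OF xk]])
      fix i assume "i < k"
      then show "E x i = 0" using E0[OF xk] x(2)[rule_format, of "i - p"] rp by (cases "i < p") auto
    qed
    then have "D (T1 x) = 0" using TE[OF xk] additive_on_0[OF Ta] by simp
    then show "x = 0" using T1(3) xk x(1) int_vecs_eq_0I by blast
  qed
  ultimately obtain M Y where MY: "(M::int) > 0" "additive_on r Y" "\<And>y. Y y \<in> int_vecs r"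
    "\<And>y j. j < r \<Longrightarrow> E (Y y) (p + j) = M * y j"
    using injective_finite_index[of r "\<lambda>x j. E x (p + j)"] by metis
  \<comment> \<open>The inverse of \<open>E\<close> up to the factor \<open>M\<close>, fed with the
    last \<open>r\<close> coordinates of \<open>u\<close>; if \<open>\<Lambda> u = 0\<close>, the
    other coordinates of \<open>u\<close> vanish and nothing is lost.\<close>
  define g where "g u = T1 (Y (\<lambda>j. S u (p + j)))" for u
  have gk: "g u \<in> int_vecs k" for u unfolding g_def using T1k MY(3) rk by blast
  have Sr: "(\<lambda>j. S u (p + j)) \<in> int_vecs r" if "u \<in> int_vecs k" for u
    using S(1)[OF that] rp by (auto simp: int_vecs_def)
  have ga: "additive_on k g" unfolding g_def
  proof (rule additive_on_comp[OF T1a])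
    show "additive_on k (\<lambda>u. Y (\<lambda>j. S u (p + j)))"
      by (rule additive_on_comp[OF MY(2) _ Sr]) (rule additive_on_coordI, rule additive_on_coord, rule Sa)
    show "Y (\<lambda>j. S x (p + j)) \<in> int_vecs k" for x using MY(3) rk by blast
  qed
  have gD: "D (g u) = (\<lambda>j. M * u j)" if u: "u \<in> int_vecs k" "\<Lambda> u = 0" for u
  proof -
    let ?y = "\<lambda>j. S u (p + j)"
    have Yk: "Y ?y \<in> int_vecs k" using MY(3) rk by blast
    have Su: "S u i = 0" if "i < p" for i
      using T(4)[rule_format, OF S(1)[OF u(1)]] S(2)[OF u(1)] u(2) that by simp
    have "E (Y ?y) = (\<lambda>i. M * S u i)"
    proof (rule int_vecs_eqI[OF Ek[OF Yk] int_vecs_closed(5)[OF S(1)[OF u(1)]]])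
      fix i assume "i < k"
      then show "E (Y ?y) i = M * S u i"
        using E0[OF Yk] Su MY(4)[of "i - p" ?y] rp by (cases "i < p") auto
    qed
    then have "D (g u) = T (\<lambda>i. M * S u i)" using TE[OF Yk] by (simp add: g_def)
    also have "\<dots> = (\<lambda>j. M * u j)"
      using additive_on_scale_vec[OF Ta S(1)[OF u(1)], of M] S(2)[OF u(1)] by simp
    finally show ?thesis .
  qed
  have \<kappa>rad: "\<forall>x\<in>int_vecs p. \<kappa> x \<in> rad \<longleftrightarrow> (\<forall>i<dd. x i = 0)"
    using \<kappa>(3) flat_eq_0 \<kappa>k(1) by blast
  show ?thesis
    by (rule that[OF rp \<kappa>(1) T3(1) defect T1(4) \<theta>R T3(2) \<kappa>(2) \<kappa>rad \<Lambda>a _ _ _ NZ(1) t MY(1) ga])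
      (use \<Lambda>in \<Lambda>D \<Lambda>om gk gD in auto)
qed

end

section \<open>Bases of free abelian groups\<close>

definition additive_hom :: "nat \<Rightarrow> ('a, 'b) monoid_scheme \<Rightarrow> ((nat \<Rightarrow> int) \<Rightarrow> 'a) \<Rightarrow> bool" where
  "additive_hom m A h \<longleftrightarrow> (\<forall>x\<in>int_vecs m. h x \<in> carrier A) \<and>
     (\<forall>x\<in>int_vecs m. \<forall>y\<in>int_vecs m. h (x + y) = h x \<otimes>\<^bsub>A\<^esub> h y)"

lemma additive_hom_closed: "additive_hom m A h \<Longrightarrow> x \<in> int_vecs m \<Longrightarrow> h x \<in> carrier A"
  by (simp add: additive_hom_def)

lemma additive_hom_add:
  "additive_hom m A h \<Longrightarrow> x \<in> int_vecs m \<Longrightarrow> y \<in> int_vecs m \<Longrightarrow> h (x + y) = h x \<otimes>\<^bsub>A\<^esub> h y"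
  by (simp add: additive_hom_def)

lemma additive_hom_one:
  assumes "group A" "additive_hom m A h"
  shows "h 0 = \<one>\<^bsub>A\<^esub>"
proof -
  interpret group A by fact
  have "h (0 + 0) = h 0 \<otimes>\<^bsub>A\<^esub> h 0" by (rule additive_hom_add[OF assms(2)]) auto
  then have "h 0 \<otimes>\<^bsub>A\<^esub> h 0 = h 0" by (simp only: add_0)
  then show ?thesis using additive_hom_closed[OF assms(2), of 0] by simp
qed

lemma additive_hom_minus:
  assumes "group A" "additive_hom m A h" "x \<in> int_vecs m"
  shows "h (- x) = inv\<^bsub>A\<^esub> h x"
proof -
  interpret group A by fact
  have "h (- x + x) = h (- x) \<otimes>\<^bsub>A\<^esub> h x" by (rule additive_hom_add[OF assms(2) _ assms(3)]) (use assms(3) in auto)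
  then have "h (- x) \<otimes>\<^bsub>A\<^esub> h x = \<one>\<^bsub>A\<^esub>"
    using additive_hom_one[OF assms(1,2)] by simp
  moreover have "h x \<in> carrier A" "h (- x) \<in> carrier A"
    using additive_hom_closed[OF assms(2)] assms(3) by auto
  ultimately show ?thesis by (rule inv_equality[symmetric])
qed

lemma additive_hom_scale:
  assumes "group A" "additive_hom m A h" "x \<in> int_vecs m"
  shows "h (\<lambda>i. c * x i) = h x [^]\<^bsub>A\<^esub> (c::int)"
proof -
  interpret group A by fact
  have hx: "h x \<in> carrier A" using additive_hom_closed assms by blast
  have nat: "h (\<lambda>i. int n * x i) = h x [^]\<^bsub>A\<^esub> (int n)" for n
  proof (induction n)
    case 0
    have "(\<lambda>i. int 0 * x i) = 0" by (simp add: fun_eq_iff)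
    from arg_cong[OF this, of h] show ?case using additive_hom_one[OF assms(1,2)] by simp
  next
    case (Suc n)
    have "(\<lambda>i. int (Suc n) * x i) = (\<lambda>i. int n * x i) + x" by (simp add: fun_eq_iff algebra_simps)
    from arg_cong[OF this, of h] have "h (\<lambda>i. int (Suc n) * x i) = h (\<lambda>i. int n * x i) \<otimes>\<^bsub>A\<^esub> h x"
      using additive_hom_add[OF assms(2) int_vecs_closed(5)[OF assms(3)] assms(3), of "int n"] by (rule trans)
    also have "\<dots> = h x [^]\<^bsub>A\<^esub> (int n + 1)" using Suc hx int_pow_mult[of "h x" "int n" 1] by simp
    finally show ?case by (simp add: add.commute)
  qed
  show ?thesis
  proof (cases "c \<ge> 0")
    case True
    then show ?thesis using nat[of "nat c"] by simp
  next
    case False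
    have "(\<lambda>i. c * x i) = - (\<lambda>i. int (nat (- c)) * x i)" using False by (simp add: fun_eq_iff)
    then have "h (\<lambda>i. c * x i) = h (- (\<lambda>i. int (nat (- c)) * x i))" by (rule arg_cong)
    also have "\<dots> = inv\<^bsub>A\<^esub> h (\<lambda>i. int (nat (- c)) * x i)"
      by (rule additive_hom_minus[OF assms(1,2) int_vecs_closed(5)[OF assms(3)]])
    also have "\<dots> = h x [^]\<^bsub>A\<^esub> c" using nat[of "nat (- c)"] False hx int_pow_neg[of "h x" "- c"] by simp
    finally show ?thesis .
  qed
qed

text \<open>By induction the product over the first \<open>j\<close> basis elements is the value of
  \<open>h\<close> at a truncation; at j = m, existence and uniqueness of coefficients become
  surjectivity and injectivity of \<open>h\<close>.\<close>

lemma int_basis_of_param: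
  assumes A: "comm_group A" and b: "bij_betw h (int_vecs m) (carrier A)" and hom: "additive_hom m A h"
  shows "int_basis A m (\<lambda>i. h (unit_vec i))"
proof -
  interpret comm_group A by fact
  have hc: "h x \<in> carrier A" if "x \<in> int_vecs m" for x using hom that by (rule additive_hom_closed)
  have uc: "h (unit_vec i) [^]\<^bsub>A\<^esub> (x::int) \<in> carrier A" if "i < m" for i x using hc that by simp
  have fp: "(\<Otimes>\<^bsub>A\<^esub>i\<in>{..<j}. h (unit_vec i) [^]\<^bsub>A\<^esub> x i) = h (trunc j x)" if "j \<le> m" for j x
    using that
  proof (induction j)
    case 0
    have "trunc 0 x = 0" by (simp add: trunc_def fun_eq_iff)
    from arg_cong[OF this, of h] show ?case using additive_hom_one[OF is_group hom] by simp
  next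
    case (Suc j)
    have "(\<Otimes>\<^bsub>A\<^esub>i\<in>{..<Suc j}. h (unit_vec i) [^]\<^bsub>A\<^esub> x i)
      = h (unit_vec j) [^]\<^bsub>A\<^esub> x j \<otimes>\<^bsub>A\<^esub> (\<Otimes>\<^bsub>A\<^esub>i\<in>{..<j}. h (unit_vec i) [^]\<^bsub>A\<^esub> x i)"
      unfolding lessThan_Suc by (rule finprod_insert) (use uc Suc.prems in auto)
    also have "\<dots> = h (\<lambda>i. x j * unit_vec j i) \<otimes>\<^bsub>A\<^esub> h (trunc j x)"
      using additive_hom_scale[OF is_group hom, of "unit_vec j" "x j"] Suc by simp
    also have "\<dots> = h (trunc (Suc j) x)"
      unfolding trunc_Suc add.commute[of "trunc j x"]
      by (rule additive_hom_add[OF hom, symmetric]) (use Suc.prems in \<open>auto simp: trunc_in_le\<close>)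
    finally show ?case .
  qed
  show ?thesis
    unfolding int_basis_def
  proof (intro conjI allI impI ballI)
    show "h (unit_vec i) \<in> carrier A" if "i < m" for i using hc that by simp
    fix P assume P: "P \<in> carrier A"
    then obtain x where x: "x \<in> int_vecs m" "P = h x" using b by (auto simp: bij_betw_def)
    show "\<exists>!y. y \<in> {..<m} \<rightarrow>\<^sub>E UNIV \<and> P = (\<Otimes>\<^bsub>A\<^esub>i\<in>{..<m}. h (unit_vec i) [^]\<^bsub>A\<^esub> (y i :: int))"
    \<comment> \<open>Coefficient families in \<open>int_basis\<close> are \<open>undefined\<close>
      from \<open>m\<close> on, vectors in \<open>int_vecs\<close> are 0 there;
      \<open>restrict\<close> and \<open>trunc\<close> translate between the two
      conventions.\<close>
    proof (rule ex1I[of _ "restrict x {..<m}"])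
      have "trunc m (restrict x {..<m}) = x" using x(1) by (auto simp: trunc_def fun_eq_iff int_vecs_def)
      then show "restrict x {..<m} \<in> {..<m} \<rightarrow>\<^sub>E UNIV \<and>
          P = (\<Otimes>\<^bsub>A\<^esub>i\<in>{..<m}. h (unit_vec i) [^]\<^bsub>A\<^esub> restrict x {..<m} i)"
        using x(2) fp[of m "restrict x {..<m}"] by (simp only: order_refl) simp
      fix y :: "nat \<Rightarrow> int" assume y: "y \<in> {..<m} \<rightarrow>\<^sub>E UNIV \<and> P = (\<Otimes>\<^bsub>A\<^esub>i\<in>{..<m}. h (unit_vec i) [^]\<^bsub>A\<^esub> y i)"
      then have "h (trunc m y) = h x" using fp[of m y] x(2) by simp
      then have "trunc m y = x" using b x(1) trunc_in(1)[of m y] by (auto simp: bij_betw_def inj_on_def)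
      then have "y i = x i" if "i < m" for i using that by (auto simp: trunc_def)
      then show "y = restrict x {..<m}" using y by (auto simp: fun_eq_iff restrict_def PiE_def extensional_def)
    qed
  qed
qed

lemma param_of_int_basis:
  assumes A: "comm_group A" and b: "int_basis A m b"
  defines "h \<equiv> \<lambda>x. \<Otimes>\<^bsub>A\<^esub>i\<in>{..<m}. b i [^]\<^bsub>A\<^esub> (x i :: int)"
  shows "bij_betw h (int_vecs m) (carrier A)"
    "\<And>x y. h (x + y) = h x \<otimes>\<^bsub>A\<^esub> h y"
    "\<And>i. i < m \<Longrightarrow> h (unit_vec i) = b i"
proof -
  interpret comm_group A by fact
  have bc: "b i \<in> carrier A" if "i < m" for i using b that by (simp add: int_basis_def)
  have hc: "h x \<in> carrier A" for x unfolding h_def by (rule finprod_closed) (use bc in auto)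
  show add: "h (x + y) = h x \<otimes>\<^bsub>A\<^esub> h y" for x y
  proof -
    have "h (x + y) = (\<Otimes>\<^bsub>A\<^esub>i\<in>{..<m}. b i [^]\<^bsub>A\<^esub> x i \<otimes>\<^bsub>A\<^esub> b i [^]\<^bsub>A\<^esub> y i)"
      unfolding h_def by (rule finprod_cong') (use bc in \<open>auto simp: int_pow_mult\<close>)
    also have "\<dots> = h x \<otimes>\<^bsub>A\<^esub> h y" unfolding h_def by (rule finprod_multf) (use bc in auto)
    finally show ?thesis .
  qed
  have hr: "h (restrict x {..<m}) = h x" for x unfolding h_def by (rule finprod_cong') (use bc in auto)
  have ext: "restrict x {..<m} = restrict y {..<m} \<Longrightarrow> x \<in> int_vecs m \<Longrightarrow> y \<in> int_vecs m \<Longrightarrow> x = y" for x y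
    by (rule int_vecs_eqI) (auto simp: restrict_def fun_eq_iff split: if_splits)
  show "bij_betw h (int_vecs m) (carrier A)"
    unfolding bij_betw_def
  proof
    show "inj_on h (int_vecs m)"
    proof (rule inj_onI)
      fix x y assume xy: "x \<in> int_vecs m" "y \<in> int_vecs m" "h x = h y"
      have "\<exists>!z. z \<in> {..<m} \<rightarrow>\<^sub>E UNIV \<and> h x = h z"
        using b hc[of x] unfolding int_basis_def h_def by blast
      then have "restrict x {..<m} = restrict y {..<m}"
        by (rule ex1E) (metis hr restrict_PiE_iff UNIV_I xy(3))
      then show "x = y" using ext xy by blast
    qed
    show "h ` int_vecs m = carrier A"
    proof
      show "h ` int_vecs m \<subseteq> carrier A" using hc by auto
      show "carrier A \<subseteq> h ` int_vecs m"
      proof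
        fix P assume "P \<in> carrier A"
        then obtain z where z: "P = h z" using b unfolding int_basis_def h_def by blast
        have "h z = h (trunc m z)" unfolding h_def by (rule finprod_cong') (use bc in \<open>auto simp: trunc_def\<close>)
        then show "P \<in> h ` int_vecs m" using z trunc_in(1) by blast
      qed
    qed
  qed
  show "h (unit_vec i) = b i" if "i < m" for i
  proof -
    have "h (unit_vec i) = (\<Otimes>\<^bsub>A\<^esub>j\<in>{..<m}. if i = j then b j else \<one>\<^bsub>A\<^esub>)"
      unfolding h_def by (rule finprod_cong') (use bc in \<open>auto simp: unit_vec_def\<close>)
    also have "\<dots> = b i" using finprod_singleton[of i "{..<m}" b] that bc by auto
    finally show ?thesis .
  qed
qed

text \<open>Any second basis, read in the coordinates \<open>h\<close>, parametrises all of
  \<int>^m; the uniqueness of the rank then evaluates the definite description.\<close>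

lemma int_dim_eqI:
  assumes A: "comm_group A" and b: "bij_betw h (int_vecs m) (carrier A)" and hom: "additive_hom m A h"
  shows "int_dim A = m"
  unfolding int_dim_def
proof (rule the_equality)
  show "\<exists>b. int_basis A m b" using int_basis_of_param[OF assms] by blast
  fix m' assume "\<exists>b. int_basis A m' b"
  then obtain b' where b': "int_basis A m' b'" by blast
  obtain h' where h': "bij_betw h' (int_vecs m') (carrier A)" "\<And>x y. h' (x + y) = h' x \<otimes>\<^bsub>A\<^esub> h' y"
    using param_of_int_basis[OF A b'] by blast
  define \<theta> where "\<theta> x = inv_into (int_vecs m) h (h' x)" for x
  have \<theta>: "bij_betw \<theta> (int_vecs m') (int_vecs m)"
    unfolding \<theta>_def using bij_betw_trans[OF h'(1) bij_betw_inv_into[OF b]] by (simp add: comp_def)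
  have h\<theta>: "h (\<theta> x) = h' x" if "x \<in> int_vecs m'" for x
  proof -
    have "h' x \<in> h ` int_vecs m" using that h'(1) b by (auto simp: bij_betw_def)
    then show ?thesis unfolding \<theta>_def by (rule f_inv_into_f)
  qed
  have "additive_on m' \<theta>"
    unfolding additive_on_def
  proof (intro ballI)
    fix x y assume xy: "x \<in> int_vecs m'" "y \<in> int_vecs m'"
    have in\<theta>: "\<theta> x \<in> int_vecs m" "\<theta> y \<in> int_vecs m" "\<theta> (x + y) \<in> int_vecs m"
      using \<theta> xy by (auto simp: bij_betw_def)
    have "h (\<theta> (x + y)) = h (\<theta> x + \<theta> y)" using h\<theta> xy h'(2) additive_hom_add[OF hom] in\<theta> by simp
    then show "\<theta> (x + y) = \<theta> x + \<theta> y" using b in\<theta> by (auto simp: bij_betw_def inj_on_def)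
  qed
  with \<theta> have "lattice_param m' \<theta> (int_vecs m)" by (simp add: lattice_param_def)
  moreover have "lattice_param m (\<lambda>x. x) (int_vecs m)"
    by (simp add: lattice_param_def additive_on_def bij_betw_def)
  ultimately show "m' = m" by (rule lattice_param_unique)
qed

section \<open>Two-step nilpotent groups\<close>

locale two_step = group G for G :: "('a, 'b) monoid_scheme" (structure) +
  assumes derived_center: "derived G (carrier G) \<subseteq> group_center G"
begin

lemma center_comm: "z \<in> group_center G \<Longrightarrow> g \<in> carrier G \<Longrightarrow> z \<otimes> g = g \<otimes> z"
  by (simp add: group_center_def)

lemma center_carrier: "z \<in> group_center G \<Longrightarrow> z \<in> carrier G"
  by (simp add: group_center_def)

lemma commutator_closed [simp]: "g \<in> carrier G \<Longrightarrow> h \<in> carrier G \<Longrightarrow> commutator G g h \<in> carrier G"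
  by (simp add: commutator_def)

lemma commutator_derived:
  "g \<in> carrier G \<Longrightarrow> h \<in> carrier G \<Longrightarrow> commutator G g h \<in> derived G (carrier G)"
  unfolding derived_def commutator_def by (rule generate.incl) blast

lemma commutator_center:
  "g \<in> carrier G \<Longrightarrow> h \<in> carrier G \<Longrightarrow> commutator G g h \<in> group_center G"
  using commutator_derived derived_center by blast

lemma commutator_swap:
  "g \<in> carrier G \<Longrightarrow> h \<in> carrier G \<Longrightarrow> g \<otimes> h = commutator G g h \<otimes> (h \<otimes> g)"
proof -
  assume gh: "g \<in> carrier G" "h \<in> carrier G"
  have "commutator G g h \<otimes> (h \<otimes> g) = g \<otimes> h \<otimes> inv g \<otimes> (inv h \<otimes> h) \<otimes> g"
    using gh unfolding commutator_def by (simp only: m_assoc m_closed inv_closed)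
  then show ?thesis using gh by (simp add: m_assoc)
qed

text \<open>Lets a commutator be read off from an equation between products, without handling
  inverses.\<close>

lemma commutator_unique:
  "g \<in> carrier G \<Longrightarrow> h \<in> carrier G \<Longrightarrow> z \<in> carrier G \<Longrightarrow> g \<otimes> h = z \<otimes> (h \<otimes> g) \<Longrightarrow> commutator G g h = z"
  using commutator_swap[of g h] right_cancel[of "h \<otimes> g" "commutator G g h" z] by simp

lemma commutator_mult_left:
  assumes "g \<in> carrier G" "g' \<in> carrier G" "h \<in> carrier G"
  shows "commutator G (g \<otimes> g') h = commutator G g h \<otimes> commutator G g' h"
proof (rule commutator_unique)
  let ?c = "commutator G g h" and ?c' = "commutator G g' h"
  have cc: "?c \<in> carrier G" "?c' \<in> carrier G" using assms by auto
  have "g \<otimes> g' \<otimes> h = g \<otimes> (?c' \<otimes> (h \<otimes> g'))" using assms commutator_swap[of g' h] by (simp add: m_assoc)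
  also have "\<dots> = (?c' \<otimes> g) \<otimes> (h \<otimes> g')"
    using assms cc center_comm[OF commutator_center[of g' h], of g] by (simp add: m_assoc)
  also have "\<dots> = ?c' \<otimes> ((g \<otimes> h) \<otimes> g')" using assms cc by (simp add: m_assoc)
  also have "\<dots> = ?c' \<otimes> ((?c \<otimes> (h \<otimes> g)) \<otimes> g')" using commutator_swap[of g h] assms by simp
  also have "\<dots> = (?c' \<otimes> ?c) \<otimes> (h \<otimes> (g \<otimes> g'))" using assms cc by (simp add: m_assoc)
  also have "?c' \<otimes> ?c = ?c \<otimes> ?c'" using assms center_comm[OF commutator_center[of g' h] cc(1)] by simp
  finally show "g \<otimes> g' \<otimes> h = ?c \<otimes> ?c' \<otimes> (h \<otimes> (g \<otimes> g'))" .
qed (use assms in auto)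

lemma commutator_inv:
  assumes "g \<in> carrier G" "h \<in> carrier G"
  shows "commutator G h g = inv (commutator G g h)"
proof -
  have "commutator G h g = h \<otimes> g \<otimes> inv (g \<otimes> h)" using assms by (simp add: commutator_def inv_mult_group m_assoc)
  moreover have "commutator G g h = g \<otimes> h \<otimes> inv (h \<otimes> g)" using assms by (simp add: commutator_def inv_mult_group m_assoc)
  ultimately show ?thesis using assms by (simp add: inv_mult_group)
qed

lemma commutator_mult_right:
  assumes "g \<in> carrier G" "h \<in> carrier G" "h' \<in> carrier G"
  shows "commutator G g (h \<otimes> h') = commutator G g h \<otimes> commutator G g h'"
proof -
  have "commutator G g (h \<otimes> h') = inv (commutator G h g \<otimes> commutator G h' g)"
    using commutator_inv[of "h \<otimes> h'" g] commutator_mult_left[of h h' g] assms by simp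
  also have "\<dots> = commutator G g h' \<otimes> commutator G g h"
    using assms commutator_inv[of h g] commutator_inv[of h' g] by (simp add: inv_mult_group)
  also have "\<dots> = commutator G g h \<otimes> commutator G g h'"
    using center_comm[OF commutator_center[of g h']] assms by simp
  finally show ?thesis .
qed

lemma commutator_central:
  assumes "z \<in> carrier G" "h \<in> carrier G" "z \<otimes> h = h \<otimes> z"
  shows "commutator G z h = \<one>"
  by (rule commutator_unique) (use assms in auto)

lemma commutator_pow:
  assumes "g \<in> carrier G" "h \<in> carrier G"
  shows "commutator G (g [^] (n::nat)) h = commutator G g h [^] n"
proof (induction n)
  case 0
  then show ?case using assms by (simp add: commutator_central)
next
  case (Suc n)
  then show ?case using assms by (simp add: commutator_mult_left)
qed

end


section \<open>Coordinates on a generalised Heisenberg group\<close>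

locale heisenberg = two_step G for G :: "('a, 'b) monoid_scheme" (structure) +
  fixes \<iota> :: "'a \<Rightarrow> int" and k :: nat and a :: "nat \<Rightarrow> 'a"
  assumes iota: "\<iota> \<in> iso (G\<lparr>carrier := isolator G\<rparr>) integer_group"
    and lifts: "lifts_basis G k a"
begin

lemma iota_mult: "y \<in> isolator G \<Longrightarrow> z \<in> isolator G \<Longrightarrow> \<iota> (y \<otimes> z) = \<iota> y + \<iota> z"
  using iota by (auto simp: iso_def hom_def)

lemma iota_inj: "y \<in> isolator G \<Longrightarrow> z \<in> isolator G \<Longrightarrow> \<iota> y = \<iota> z \<Longrightarrow> y = z"
  using iota by (auto simp: iso_def bij_betw_def inj_on_def)

lemma derived_subgroup: "subgroup (derived G (carrier G)) G"
  by (rule derived_is_subgroup) simp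

lemma derived_isolator: "derived G (carrier G) \<subseteq> isolator G"
proof
  fix y assume y: "y \<in> derived G (carrier G)"
  then have "y \<in> carrier G" using derived_in_carrier by blast
  then show "y \<in> isolator G" using y unfolding isolator_def by (auto intro!: exI[of _ "1::nat"])
qed

lemma isolatorI: "y \<in> carrier G \<Longrightarrow> n \<ge> 1 \<Longrightarrow> y [^] (n::nat) \<in> derived G (carrier G) \<Longrightarrow> y \<in> isolator G"
  unfolding isolator_def by blast

lemma isolator_carrier: "y \<in> isolator G \<Longrightarrow> y \<in> carrier G"
  by (simp add: isolator_def)

lemma one_isolator: "\<one> \<in> isolator G"
  using derived_isolator subgroup.one_closed[OF derived_subgroup] by blast

lemma iota_one: "\<iota> \<one> = 0"
  using iota_mult[OF one_isolator one_isolator] by simp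

text \<open>Confined to the derived subgroup because the isolator is known to be closed under
  products only after it has been shown to be central.\<close>

lemma iota_pow_derived:
  assumes "y \<in> derived G (carrier G)"
  shows "y [^] (n::nat) \<in> derived G (carrier G) \<and> \<iota> (y [^] n) = int n * \<iota> y"
proof (induction n)
  case 0
  then show ?case using subgroup.one_closed[OF derived_subgroup] iota_one by simp
next
  case (Suc n)
  then show ?case
    using assms iota_mult[of "y [^] n" y] derived_isolator subgroup.m_closed[OF derived_subgroup, of "y [^] n" y]
    by (auto simp: algebra_simps)
qed

text \<open>If a power of \<open>z\<close> lies in the derived subgroup, that power is central, so
  that the same power of the commutator of \<open>z\<close> with any element is trivial. The derived
  subgroup is torsion free, since \<open>\<iota>\<close> embeds it into \<int>; thus the commutator
  itself is trivial.\<close>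

lemma isolator_center: "isolator G \<subseteq> group_center G"
proof
  fix z assume z: "z \<in> isolator G"
  then obtain n :: nat where n: "n \<ge> 1" "z [^] n \<in> derived G (carrier G)" by (auto simp: isolator_def)
  have zc: "z \<in> carrier G" using z by (rule isolator_carrier)
  have "z \<otimes> h = h \<otimes> z" if h: "h \<in> carrier G" for h
  proof -
    let ?c = "commutator G z h"
    have "?c [^] n = \<one>"
      using commutator_pow[OF zc h, of n] commutator_central[of "z [^] n" h] zc h n(2) derived_center center_comm
      by auto
    then have "int n * \<iota> ?c = 0" using iota_pow_derived[OF commutator_derived[OF zc h], of n] iota_one by simp
    then have "\<iota> ?c = \<iota> \<one>" using n(1) iota_one by simp
    then have "?c = \<one>"
      using iota_inj one_isolator commutator_derived[OF zc h] derived_isolator by blast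
    then show ?thesis using commutator_swap[OF zc h] zc h by simp
  qed
  then show "z \<in> group_center G" using zc by (simp add: group_center_def)
qed

lemma isolator_subgroup: "subgroup (isolator G) G"
proof (rule subgroupI)
  show "isolator G \<subseteq> carrier G" using isolator_carrier by blast
  show "isolator G \<noteq> {}" using one_isolator by blast
  fix y assume y: "y \<in> isolator G"
  then obtain n :: nat where n: "n \<ge> 1" "y [^] n \<in> derived G (carrier G)" by (auto simp: isolator_def)
  have "(inv y) [^] n = inv (y [^] n)" using y isolator_carrier by (simp add: nat_pow_inv)
  then have "(inv y) [^] n \<in> derived G (carrier G)"
    using subgroup.m_inv_closed[OF derived_subgroup n(2)] by simp
  then show "inv y \<in> isolator G" by (intro isolatorI[OF _ n(1)]) (use isolator_carrier[OF y] in auto)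
  fix z assume z: "z \<in> isolator G"
  then obtain m :: nat where m: "m \<ge> 1" "z [^] m \<in> derived G (carrier G)" by (auto simp: isolator_def)
  have yz: "y \<in> carrier G" "z \<in> carrier G" using y z isolator_carrier by auto
  have "(y \<otimes> z) [^] (n * m) = y [^] (n * m) \<otimes> z [^] (n * m)"
    using pow_mult_distrib[OF _ yz] center_comm[OF subsetD[OF isolator_center y] yz(2)] by simp
  also have "\<dots> = (y [^] n) [^] m \<otimes> (z [^] m) [^] n"
    using yz by (simp add: nat_pow_pow mult.commute)
  also have "\<dots> \<in> derived G (carrier G)"
    by (intro subgroup.m_closed[OF derived_subgroup] conjunct1[OF iota_pow_derived] n(2) m(2))
  finally have "(y \<otimes> z) [^] (n * m) \<in> derived G (carrier G)" .
  then show "y \<otimes> z \<in> isolator G" by (rule isolatorI[rotated 2]) (use yz n(1) m(1) in auto)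
qed

lemma isolator_closed [simp]:
  "y \<in> isolator G \<Longrightarrow> z \<in> isolator G \<Longrightarrow> y \<otimes> z \<in> isolator G"
  "y \<in> isolator G \<Longrightarrow> inv y \<in> isolator G"
  using subgroup.m_closed[OF isolator_subgroup] subgroup.m_inv_closed[OF isolator_subgroup] by auto

lemma isolator_comm: "z \<in> isolator G \<Longrightarrow> g \<in> carrier G \<Longrightarrow> z \<otimes> g = g \<otimes> z"
  using isolator_center center_comm by blast

lemma isolator_normal: "isolator G \<lhd> G"
proof (subst normal_inv_iff, intro conjI ballI)
  show "subgroup (isolator G) G" by (rule isolator_subgroup)
  fix g z assume gz: "g \<in> carrier G" "z \<in> isolator G"
  have "g \<otimes> z \<otimes> inv g = z \<otimes> g \<otimes> inv g" using isolator_comm[OF gz(2,1)] by simp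
  also have "\<dots> = z" using gz(1) isolator_carrier[OF gz(2)] by (simp add: m_assoc)
  finally show "g \<otimes> z \<otimes> inv g \<in> isolator G" using gz(2) by simp
qed

lemma commutator_isolator: "g \<in> carrier G \<Longrightarrow> h \<in> carrier G \<Longrightarrow> commutator G g h \<in> isolator G"
  using commutator_derived derived_isolator by blast

definition zeta :: "int \<Rightarrow> 'a" where
  "zeta t = inv_into (isolator G) \<iota> t"

lemma zeta_in: "zeta t \<in> isolator G" and iota_zeta: "\<iota> (zeta t) = t"
proof -
  have "t \<in> \<iota> ` isolator G" using iota by (auto simp: iso_def bij_betw_def)
  then show "zeta t \<in> isolator G" "\<iota> (zeta t) = t"
    unfolding zeta_def by (rule inv_into_into, rule f_inv_into_f)
qed

lemma zeta_closed [simp]: "zeta t \<in> carrier G"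
  using zeta_in isolator_carrier by blast

lemma zeta_iota: "z \<in> isolator G \<Longrightarrow> zeta (\<iota> z) = z"
  by (rule iota_inj) (auto simp: zeta_in iota_zeta)

lemma zeta_mult: "zeta t \<otimes> zeta u = zeta (t + u)"
  by (rule iota_inj) (auto simp: zeta_in iota_zeta iota_mult)

lemma zeta_0: "zeta 0 = \<one>"
  using zeta_iota[OF one_isolator] iota_one by simp

lemma zeta_comm: "g \<in> carrier G \<Longrightarrow> zeta t \<otimes> g = g \<otimes> zeta t"
  using isolator_comm zeta_in by blast

abbreviation Q :: "'a set monoid" where "Q \<equiv> quot_c G"
abbreviation cos :: "'a \<Rightarrow> 'a set" where "cos g \<equiv> isolator G #> g"

lemma Q_carrier: "carrier Q = cos ` carrier G"
  by (auto simp: quot_c_def FactGroup_def RCOSETS_def)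

lemma cos_mult: "g \<in> carrier G \<Longrightarrow> h \<in> carrier G \<Longrightarrow> cos g \<otimes>\<^bsub>Q\<^esub> cos h = cos (g \<otimes> h)"
  by (simp add: quot_c_def FactGroup_def normal.rcos_sum[OF isolator_normal])

lemma cos_eq_iff:
  assumes "g \<in> carrier G" "h \<in> carrier G"
  shows "cos g = cos h \<longleftrightarrow> (\<exists>t. g = h \<otimes> zeta t)"
proof
  assume "cos g = cos h"
  then have "g \<in> cos h" using rcos_self[OF assms(1) isolator_subgroup] by simp
  then obtain z where z: "z \<in> isolator G" "g = z \<otimes> h" by (auto simp: r_coset_def)
  then have "g = h \<otimes> zeta (\<iota> z)" using isolator_comm assms by (simp add: zeta_iota)
  then show "\<exists>t. g = h \<otimes> zeta t" by blast
next
  assume "\<exists>t. g = h \<otimes> zeta t"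
  then obtain t where "g = zeta t \<otimes> h" using zeta_comm assms by auto
  then have "g \<in> cos h" using zeta_in by (auto simp: r_coset_def)
  then show "cos g = cos h" using repr_independence[OF _ assms(2) isolator_subgroup] by simp
qed

lemma Q_comm_group: "comm_group Q"
proof -
  have "group Q" unfolding quot_c_def by (rule normal.factorgroup_is_group[OF isolator_normal])
  then show ?thesis
  proof (rule group.group_comm_groupI)
    fix P P' assume "P \<in> carrier Q" "P' \<in> carrier Q"
    then obtain g h where gh: "g \<in> carrier G" "h \<in> carrier G" "P = cos g" "P' = cos h"
      by (auto simp: Q_carrier)
    have "cos (g \<otimes> h) = cos (h \<otimes> g)"
    proof -
      have "g \<otimes> h = (h \<otimes> g) \<otimes> zeta (\<iota> (commutator G g h))"
        using commutator_swap[OF gh(1,2)] isolator_comm[OF commutator_isolator[OF gh(1,2)], of "h \<otimes> g"] gh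
        by (simp add: zeta_iota commutator_isolator)
      then show ?thesis using cos_eq_iff gh by blast
    qed
    then show "P \<otimes>\<^bsub>Q\<^esub> P' = P' \<otimes>\<^bsub>Q\<^esub> P" using gh cos_mult by simp
  qed
qed

lemma Q_group: "group Q"
  using Q_comm_group comm_group.axioms(2) by blast

text \<open>The isomorphism of \<int>^k with the quotient by the isolator that the chosen basis
  induces; \<open>vec\<close> is its inverse, evaluated on representatives.\<close>

definition phi :: "(nat \<Rightarrow> int) \<Rightarrow> 'a set" where
  "phi x = (\<Otimes>\<^bsub>Q\<^esub>i\<in>{..<k}. cos (a i) [^]\<^bsub>Q\<^esub> (x i :: int))"

lemma a_closed: "i < k \<Longrightarrow> a i \<in> carrier G"
  using lifts by (simp add: lifts_basis_def)

lemma phi_bij: "bij_betw phi (int_vecs k) (carrier Q)"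
  and phi_add: "phi (x + y) = phi x \<otimes>\<^bsub>Q\<^esub> phi y"
  and phi_unit: "i < k \<Longrightarrow> phi (unit_vec i) = cos (a i)"
  using param_of_int_basis[OF Q_comm_group, of k "\<lambda>i. cos (a i)"] lifts
  unfolding phi_def[abs_def] lifts_basis_def by auto

lemma phi_hom: "additive_hom k Q phi"
  using phi_bij phi_add by (auto simp: additive_hom_def bij_betw_def)

definition vec :: "'a \<Rightarrow> (nat \<Rightarrow> int)" where
  "vec g = inv_into (int_vecs k) phi (cos g)"

lemma vec_in [simp]: "g \<in> carrier G \<Longrightarrow> vec g \<in> int_vecs k"
  and phi_vec: "g \<in> carrier G \<Longrightarrow> phi (vec g) = cos g"
proof -
  assume "g \<in> carrier G"
  then have "cos g \<in> phi ` int_vecs k" using phi_bij by (auto simp: bij_betw_def Q_carrier)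
  then show "vec g \<in> int_vecs k" "phi (vec g) = cos g"
    unfolding vec_def by (rule inv_into_into, rule f_inv_into_f)
qed

lemma phi_inj: "x \<in> int_vecs k \<Longrightarrow> y \<in> int_vecs k \<Longrightarrow> phi x = phi y \<Longrightarrow> x = y"
  using phi_bij by (auto simp: bij_betw_def inj_on_def)

lemma vec_unique: "g \<in> carrier G \<Longrightarrow> x \<in> int_vecs k \<Longrightarrow> phi x = cos g \<Longrightarrow> vec g = x"
  by (rule phi_inj) (auto simp: phi_vec)

lemma vec_mult: "g \<in> carrier G \<Longrightarrow> h \<in> carrier G \<Longrightarrow> vec (g \<otimes> h) = vec g + vec h"
  by (rule vec_unique) (auto simp: phi_add phi_vec cos_mult)

lemma vec_eq_iff: "g \<in> carrier G \<Longrightarrow> h \<in> carrier G \<Longrightarrow> vec g = vec h \<longleftrightarrow> (\<exists>t. g = h \<otimes> zeta t)"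
proof -
  assume gh: "g \<in> carrier G" "h \<in> carrier G"
  have "vec g = vec h \<longleftrightarrow> cos g = cos h"
    using vec_unique[OF gh(1) vec_in[OF gh(2)]] phi_vec[OF gh(1)] phi_vec[OF gh(2)] by auto
  then show ?thesis using cos_eq_iff[OF gh] by simp
qed

lemma vec_zeta [simp]: "vec (zeta t) = 0"
proof -
  have "vec (\<one> \<otimes> \<one>) = vec \<one> + vec \<one>" by (rule vec_mult) auto
  then have "vec \<one> = 0" by simp
  moreover have "vec (zeta t) = vec \<one>" by (subst vec_eq_iff) auto
  ultimately show ?thesis by simp
qed

lemma vec_one [simp]: "vec \<one> = 0"
  using vec_zeta[of 0] by (simp add: zeta_0)

lemma vec_a: "i < k \<Longrightarrow> vec (a i) = unit_vec i"
  by (rule vec_unique) (auto simp: a_closed phi_unit)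

lemma vec_inv: "g \<in> carrier G \<Longrightarrow> vec (inv g) = - vec g"
  using vec_mult[of "inv g" g] by (simp add: eq_neg_iff_add_eq_0)

lemma vec_pow: "g \<in> carrier G \<Longrightarrow> vec (g [^] (n::int)) = (\<lambda>i. n * vec g i)"
proof -
  assume g: "g \<in> carrier G"
  have nat: "vec (g [^] m) = (\<lambda>i. int m * vec g i)" for m :: nat
  proof (induction m)
    case 0
    show ?case by (rule ext) simp
  next
    case (Suc m)
    have "vec (g [^] Suc m) = vec (g [^] m) + vec g" using g by (simp add: vec_mult)
    then show ?case by (simp only: Suc) (rule ext, simp add: algebra_simps)
  qed
  show ?thesis
  proof (cases n rule: int_cases2)
    case (nonneg m)
    then have "vec (g [^] n) = vec (g [^] m)" by (simp only: int_pow_int)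
    then show ?thesis using nonneg by (simp only: nat)
  next
    case (nonpos m)
    then have "vec (g [^] n) = - vec (g [^] m)" using g by (simp only: int_pow_neg_int[OF g] vec_inv nat_pow_closed)
    then show ?thesis using nonpos by (simp only: nat) (rule ext, simp)
  qed
qed

text \<open>An arbitrary set-theoretic section of \<open>vec\<close>. It is not a homomorphism, and
  whatever is defined through it has to be shown independent of the choice.\<close>

definition lift :: "(nat \<Rightarrow> int) \<Rightarrow> 'a" where
  "lift x = (SOME g. g \<in> carrier G \<and> vec g = x)"

lemma lift: assumes "x \<in> int_vecs k" shows "lift x \<in> carrier G" "vec (lift x) = x"
proof -
  have "phi x \<in> carrier Q" using phi_bij assms by (auto simp: bij_betw_def)
  then obtain g where "g \<in> carrier G" "phi x = cos g" by (auto simp: Q_carrier)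
  then have "\<exists>g. g \<in> carrier G \<and> vec g = x" using vec_unique assms by blast
  then have "lift x \<in> carrier G \<and> vec (lift x) = x" unfolding lift_def by (rule someI_ex)
  then show "lift x \<in> carrier G" "vec (lift x) = x" by auto
qed

definition om :: "(nat \<Rightarrow> int) \<Rightarrow> (nat \<Rightarrow> int) \<Rightarrow> int" where
  "om x y = \<iota> (commutator G (lift x) (lift y))"

lemma commutator_zeta:
  "g \<in> carrier G \<Longrightarrow> h \<in> carrier G \<Longrightarrow> commutator G (g \<otimes> zeta t) h = commutator G g h"
  "g \<in> carrier G \<Longrightarrow> h \<in> carrier G \<Longrightarrow> commutator G g (h \<otimes> zeta t) = commutator G g h"
  using commutator_central[of "zeta t" h] commutator_central[of "zeta t" g] commutator_inv[of "zeta t" g]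
  by (auto simp: commutator_mult_left commutator_mult_right zeta_comm)

text \<open>Elements with equal \<open>vec\<close> differ by a factor from the isolator, which drops
  out of commutators; so the form does not depend on the section.\<close>

lemma iota_commutator:
  assumes "g \<in> carrier G" "h \<in> carrier G"
  shows "\<iota> (commutator G g h) = om (vec g) (vec h)"
proof -
  let ?g = "lift (vec g)" and ?h = "lift (vec h)"
  have l: "?g \<in> carrier G" "?h \<in> carrier G" using lift assms by auto
  obtain t u where tu: "g = ?g \<otimes> zeta t" "h = ?h \<otimes> zeta u"
    using vec_eq_iff[OF assms(1) l(1)] vec_eq_iff[OF assms(2) l(2)] lift(2) assms by auto
  have "commutator G g h = commutator G (?g \<otimes> zeta t) (?h \<otimes> zeta u)" by (rule arg_cong2[OF tu])
  also have "\<dots> = commutator G ?g ?h"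
    using commutator_zeta(1)[of ?g ?h] commutator_zeta(2)[of "?g \<otimes> zeta t" ?h u] l by simp
  finally have "commutator G g h = commutator G ?g ?h" .
  then have "\<iota> (commutator G g h) = \<iota> (commutator G ?g ?h)" by (rule arg_cong)
  then show ?thesis by (simp add: om_def)
qed

lemma commutator_eq_zeta: "g \<in> carrier G \<Longrightarrow> h \<in> carrier G \<Longrightarrow> commutator G g h = zeta (om (vec g) (vec h))"
  using iota_commutator[of g h] zeta_iota[OF commutator_isolator] by metis

lemma om_add_left: "x \<in> int_vecs k \<Longrightarrow> x' \<in> int_vecs k \<Longrightarrow> y \<in> int_vecs k \<Longrightarrow> om (x + x') y = om x y + om x' y"
proof -
  assume *: "x \<in> int_vecs k" "x' \<in> int_vecs k" "y \<in> int_vecs k"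
  have "om (x + x') y = \<iota> (commutator G (lift x \<otimes> lift x') (lift y))"
    using * lift by (simp add: iota_commutator vec_mult)
  then show ?thesis using * lift
    by (simp add: commutator_mult_left iota_mult commutator_isolator iota_commutator)
qed

lemma om_antisym: "x \<in> int_vecs k \<Longrightarrow> y \<in> int_vecs k \<Longrightarrow> om y x = - om x y"
proof -
  assume *: "x \<in> int_vecs k" "y \<in> int_vecs k"
  let ?c = "commutator G (lift x) (lift y)"
  have c: "?c \<in> isolator G" using commutator_isolator lift * by auto
  then have "\<iota> (inv ?c \<otimes> ?c) = \<iota> (inv ?c) + \<iota> ?c" using iota_mult by simp
  then have "\<iota> (inv ?c) = - \<iota> ?c" using iota_one isolator_carrier[OF c] by simp
  then show ?thesis using commutator_inv[of "lift x" "lift y"] lift * by (simp add: om_def)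
qed

lemma om_add_right: "x \<in> int_vecs k \<Longrightarrow> y \<in> int_vecs k \<Longrightarrow> y' \<in> int_vecs k \<Longrightarrow> om x (y + y') = om x y + om x y'"
  using om_antisym[of x "y + y'"] om_antisym[of x y] om_antisym[of x y'] om_add_left[of y y' x] by simp

lemma om_additive:
  "x \<in> int_vecs k \<Longrightarrow> additive_on k (om x)" "y \<in> int_vecs k \<Longrightarrow> additive_on k (\<lambda>x. om x y)"
  by (simp_all add: additive_on_def om_add_left om_add_right)

lemma om_self: "x \<in> int_vecs k \<Longrightarrow> om x x = 0"
  using om_antisym[of x x] by simp

lemma om_zero: "x \<in> int_vecs k \<Longrightarrow> om x 0 = 0" "x \<in> int_vecs k \<Longrightarrow> om 0 x = 0"
  using additive_on_0[OF om_additive(1)] additive_on_0[OF om_additive(2)] by auto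

lemma om_scale: "x \<in> int_vecs k \<Longrightarrow> y \<in> int_vecs k \<Longrightarrow> om (\<lambda>i. c * x i) y = c * om x y"
  "x \<in> int_vecs k \<Longrightarrow> y \<in> int_vecs k \<Longrightarrow> om x (\<lambda>i. c * y i) = c * om x y"
  using additive_on_scale[OF om_additive(1)] additive_on_scale[OF om_additive(2)] by auto

end

section \<open>Normal forms and the height coordinate\<close>

context heisenberg
begin

text \<open>The ordered product of the powers of the \<open>a i\<close>, that is, the normal form of
  an element without its central part.\<close>

primrec sig :: "nat \<Rightarrow> (nat \<Rightarrow> int) \<Rightarrow> 'a" where
  "sig 0 x = \<one>"
| "sig (Suc j) x = sig j x \<otimes> a j [^] x j"

text \<open>The central exponent that arises when the product of two normal forms is collected into
  one.\<close>

primrec beta :: "nat \<Rightarrow> (nat \<Rightarrow> int) \<Rightarrow> (nat \<Rightarrow> int) \<Rightarrow> int" where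
  "beta 0 x y = 0"
| "beta (Suc j) x y = beta j x y + x j * om (unit_vec j) (trunc j y)"

text \<open>The second coordinate that multiplication in H_omega gives to the normal form when every
  \<open>a i\<close> has second coordinate 0.\<close>

primrec quad :: "nat \<Rightarrow> (nat \<Rightarrow> int) \<Rightarrow> int" where
  "quad 0 x = 0"
| "quad (Suc j) x = quad j x + x j * om (trunc j x) (unit_vec j)"

lemma sig_closed: "j \<le> k \<Longrightarrow> sig j x \<in> carrier G"
  by (induction j) (auto simp: a_closed)

lemma vec_sig: "j \<le> k \<Longrightarrow> vec (sig j x) = trunc j x"
proof (induction j)
  case 0
  show ?case by (rule ext) (simp add: trunc_def)
next
  case (Suc j)
  then show ?case by (simp add: vec_mult sig_closed a_closed vec_pow vec_a trunc_Suc)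
qed

lemma sig_mult:
  "j \<le> k \<Longrightarrow> sig j x \<otimes> sig j y = sig j (x + y) \<otimes> zeta (beta j x y)"
proof (induction j)
  case 0
  then show ?case by (simp add: zeta_0)
next
  case (Suc j)
  let ?A = "sig j x" and ?B = "sig j y" and ?p = "a j [^] x j" and ?r = "a j [^] y j"
  let ?m = "x j * om (unit_vec j) (trunc j y)"
  define S where "S = sig j (x + y)"
  have c: "?A \<in> carrier G" "?B \<in> carrier G" "?p \<in> carrier G" "?r \<in> carrier G" "S \<in> carrier G"
    "a j \<in> carrier G" using Suc.prems sig_closed[of j] a_closed unfolding S_def by auto
  have jk: "j < k" using Suc.prems by simp
  \<comment> \<open>Moving the last power of the first factor past the shorter normal form of the
    second is the only source of a new central term.\<close>
  have "commutator G ?p ?B = zeta ?m"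
    using commutator_eq_zeta[OF c(3,2)] vec_pow[OF c(6)] vec_a[OF jk] vec_sig[of j y] jk
      om_scale(1)[of "unit_vec j" "trunc j y" "x j"] by (simp add: trunc_in_le)
  then have "?p \<otimes> ?B = zeta ?m \<otimes> (?B \<otimes> ?p)" using commutator_swap[OF c(3,2)] by simp
  also have "\<dots> = ?B \<otimes> ?p \<otimes> zeta ?m" using c zeta_comm by simp
  finally have pB: "?p \<otimes> ?B = ?B \<otimes> ?p \<otimes> zeta ?m" .
  have "?A \<otimes> ?p \<otimes> (?B \<otimes> ?r) = ?A \<otimes> (?p \<otimes> ?B) \<otimes> ?r" using c by (simp add: m_assoc)
  also have "\<dots> = (?A \<otimes> ?B) \<otimes> (?p \<otimes> (zeta ?m \<otimes> ?r))" using c by (simp add: pB m_assoc)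
  also have "zeta ?m \<otimes> ?r = ?r \<otimes> zeta ?m" using c zeta_comm by simp
  also have "?A \<otimes> ?B = S \<otimes> zeta (beta j x y)"
    unfolding S_def by (rule Suc.IH[OF Suc_leD[OF Suc.prems]])
  also have "S \<otimes> zeta (beta j x y) \<otimes> (?p \<otimes> (?r \<otimes> zeta ?m))
      = S \<otimes> (zeta (beta j x y) \<otimes> (?p \<otimes> ?r)) \<otimes> zeta ?m" using c by (simp add: m_assoc)
  also have "zeta (beta j x y) \<otimes> (?p \<otimes> ?r) = (?p \<otimes> ?r) \<otimes> zeta (beta j x y)" using c zeta_comm by simp
  also have "?p \<otimes> ?r = a j [^] (x + y) j" using c int_pow_mult by simp
  finally show ?case
    unfolding sig.simps beta.simps S_def[symmetric] using c by (simp add: m_assoc zeta_mult)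
qed

definition tcoord :: "'a \<Rightarrow> int" where
  "tcoord g = \<iota> (inv (sig k (vec g)) \<otimes> g)"

lemma sig_tcoord: "g \<in> carrier G \<Longrightarrow> g = sig k (vec g) \<otimes> zeta (tcoord g)"
proof -
  assume g: "g \<in> carrier G"
  have s: "sig k (vec g) \<in> carrier G" "vec (sig k (vec g)) = vec g"
    using g sig_closed vec_sig by (auto simp: trunc_id)
  then obtain t where t: "g = sig k (vec g) \<otimes> zeta t" using vec_eq_iff[OF g s(1)] by auto
  have "inv (sig k (vec g)) \<otimes> (sig k (vec g) \<otimes> zeta t) = zeta t" using s by (simp add: m_assoc[symmetric])
  then have "inv (sig k (vec g)) \<otimes> g = zeta t" using t by simp
  then have "tcoord g = t" by (simp add: tcoord_def iota_zeta)
  then show ?thesis using t by simp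
qed

lemma tcoord_unique:
  assumes "x \<in> int_vecs k" "g = sig k x \<otimes> zeta t"
  shows "vec g = x" "tcoord g = t"
proof -
  have s: "sig k x \<in> carrier G" "vec (sig k x) = x" using assms(1) sig_closed vec_sig by (auto simp: trunc_id)
  show v: "vec g = x" using assms(2) s by (simp add: vec_mult)
  have "inv (sig k x) \<otimes> (sig k x \<otimes> zeta t) = zeta t" using s by (simp add: m_assoc[symmetric])
  then show "tcoord g = t" using v assms(2) by (simp add: tcoord_def iota_zeta)
qed

text \<open>The second coordinate of the embedding into H_omega, written down before the embedding
  is known to exist; the factor 2 reflects that the generator of the isolator goes to (0,
  2).\<close>

definition height :: "'a \<Rightarrow> int" where
  "height g = quad k (vec g) + 2 * tcoord g"

text \<open>Twice the collection cocycle \<open>beta\<close> differs from the form by the coboundary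
  of \<open>quad\<close>. This is why doubling the central coordinate leads to a group law given by
  the form itself.\<close>

lemma quad_beta:
  assumes "x \<in> int_vecs k" "y \<in> int_vecs k" "j \<le> k"
  shows "quad j (x + y) + 2 * beta j x y = quad j x + quad j y + om (trunc j x) (trunc j y)"
  using assms(3)
proof (induction j)
  case 0
  have "trunc 0 z = 0" for z by (rule ext) (simp add: trunc_def)
  then have "om (trunc 0 x) (trunc 0 y) = 0" using om_zero(1)[OF int_vecs_closed(1)] by (simp only:)
  then show ?case by simp
next
  case (Suc j)
  let ?e = "unit_vec j" and ?x = "trunc j x" and ?y = "trunc j y"
  have e: "?e \<in> int_vecs k" and t: "?x \<in> int_vecs k" "?y \<in> int_vecs k"
    using Suc.prems by (auto simp: trunc_in_le)
  have tr: "trunc j (x + y) = ?x + ?y" by (rule ext) (simp add: trunc_def)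
  have ce: "(\<lambda>i. c * ?e i) \<in> int_vecs k" for c using e by auto
  have 1: "om (?x + ?y) ?e = om ?x ?e + om ?y ?e" using om_add_left t e by blast
  have 2: "om (?x + (\<lambda>i. x j * ?e i)) (?y + (\<lambda>i. y j * ?e i))
      = om ?x ?y + y j * om ?x ?e + x j * om ?e ?y"
    using t e ce by (simp add: om_add_left om_add_right om_scale om_self)
  have 3: "om ?e ?y = - om ?y ?e" using om_antisym t e by blast
  have "quad (Suc j) (x + y) = quad j (x + y) + (x j + y j) * (om ?x ?e + om ?y ?e)"
    by (simp only: quad.simps tr 1 plus_fun_apply)
  moreover have "om (trunc (Suc j) x) (trunc (Suc j) y) = om ?x ?y + y j * om ?x ?e + x j * om ?e ?y"
    unfolding trunc_Suc by (rule 2)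
  moreover have "quad j (x + y) + 2 * beta j x y = quad j x + quad j y + om ?x ?y"
    by (rule Suc.IH[OF Suc_leD[OF Suc.prems]])
  ultimately show ?case
    unfolding quad.simps(2)[of j x] quad.simps(2)[of j y] beta.simps(2) 3
    by (simp add: algebra_simps del: quad.simps plus_fun_apply)
qed

lemma height_mult:
  assumes "g \<in> carrier G" "h \<in> carrier G"
  shows "height (g \<otimes> h) = height g + height h + om (vec g) (vec h)"
proof -
  let ?x = "vec g" and ?y = "vec h"
  have x: "?x \<in> int_vecs k" "?y \<in> int_vecs k" using assms by auto
  have c: "sig k z \<in> carrier G" for z using sig_closed by simp
  have "g \<otimes> h = (sig k ?x \<otimes> zeta (tcoord g)) \<otimes> (sig k ?y \<otimes> zeta (tcoord h))"
    by (rule arg_cong2[OF sig_tcoord[OF assms(1)] sig_tcoord[OF assms(2)]])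
  also have "\<dots> = sig k ?x \<otimes> (zeta (tcoord g) \<otimes> sig k ?y) \<otimes> zeta (tcoord h)" using c by (simp add: m_assoc)
  also have "zeta (tcoord g) \<otimes> sig k ?y = sig k ?y \<otimes> zeta (tcoord g)" using c zeta_comm by simp
  also have "sig k ?x \<otimes> (sig k ?y \<otimes> zeta (tcoord g)) \<otimes> zeta (tcoord h)
      = (sig k ?x \<otimes> sig k ?y) \<otimes> zeta (tcoord g + tcoord h)" using c by (simp add: m_assoc zeta_mult)
  also have "sig k ?x \<otimes> sig k ?y = sig k (?x + ?y) \<otimes> zeta (beta k ?x ?y)" by (rule sig_mult) simp
  also have "sig k (?x + ?y) \<otimes> zeta (beta k ?x ?y) \<otimes> zeta (tcoord g + tcoord h)
      = sig k (?x + ?y) \<otimes> zeta (beta k ?x ?y + (tcoord g + tcoord h))"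
    unfolding zeta_mult[symmetric, of "beta k ?x ?y"] by (rule m_assoc) (use c in auto)
  finally have "vec (g \<otimes> h) = ?x + ?y" "tcoord (g \<otimes> h) = beta k ?x ?y + (tcoord g + tcoord h)"
    by (rule tcoord_unique[OF int_vecs_closed(2)[OF x]])+
  then show ?thesis
    using quad_beta[OF x order_refl] unfolding height_def trunc_id[OF x(1)] trunc_id[OF x(2)]
    by (simp del: plus_fun_apply)
qed

lemma height_one [simp]: "height \<one> = 0"
proof -
  have "height (\<one> \<otimes> \<one>) = height \<one> + height \<one> + om (vec \<one>) (vec \<one>)" by (rule height_mult) auto
  then show ?thesis using om_zero(1)[OF int_vecs_closed(1)] by (simp only: r_one one_closed vec_one)
qed

lemma quad_0: "j \<le> k \<Longrightarrow> quad j 0 = 0"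
  by (induction j) auto

lemma sig_0: "j \<le> k \<Longrightarrow> sig j 0 = \<one>"
  by (induction j) (auto simp: a_closed)

lemma height_zeta [simp]: "height (zeta t) = 2 * t"
proof -
  have "zeta t = sig k 0 \<otimes> zeta t" by (simp add: sig_0)
  then show ?thesis using tcoord_unique[of 0 "zeta t" t] by (simp add: height_def quad_0)
qed

lemma height_a: assumes "i < k" shows "height (a i) = 0"
proof -
  have *: "sig j (unit_vec i) = (if i < j then a i else \<one>) \<and> quad j (unit_vec i) = 0" if "j \<le> k" for j
    using that
  proof (induction j)
    case 0
    show ?case by simp
  next
    case (Suc j)
    have t: "trunc i (unit_vec i) = (0::nat \<Rightarrow> int)" by (rule ext) (simp add: trunc_def unit_vec_def)
    have u: "unit_vec i j = (if j = i then 1 else 0)" by (simp add: unit_vec_def)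
    have o: "om (trunc i (unit_vec i)) (unit_vec i) = 0" unfolding t by (rule om_zero(2)) (use assms in auto)
    show ?case
    proof (cases "j = i")
      case True
      then show ?thesis using Suc u o a_closed[OF assms] by simp
    next
      case False
      then show ?thesis using Suc u a_closed[OF assms] by (simp add: less_Suc_eq)
    qed
  qed
  have "a i = sig k (unit_vec i) \<otimes> zeta 0" using *[OF order_refl] assms a_closed[OF assms] by (simp add: zeta_0)
  then have "tcoord (a i) = 0" by (rule tcoord_unique(2)[rotated]) (use assms in auto)
  then show ?thesis using assms *[OF order_refl] vec_a by (simp add: height_def)
qed

lemma height_mult_zeta: "g \<in> carrier G \<Longrightarrow> height (g \<otimes> zeta t) = height g + 2 * t"
  by (simp add: height_mult om_zero)

lemma vec_mult_zeta: "g \<in> carrier G \<Longrightarrow> vec (g \<otimes> zeta t) = vec g"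
  by (simp add: vec_mult)

text \<open>Equalities in G are proved below by comparing these two coordinates.\<close>

lemma coords_inj:
  assumes "g \<in> carrier G" "h \<in> carrier G" "vec g = vec h" "height g = height h"
  shows "g = h"
proof -
  obtain t where t: "g = h \<otimes> zeta t" using vec_eq_iff assms by auto
  then have "t = 0" using height_mult_zeta[OF assms(2), of t] assms(4) by simp
  then show ?thesis using t assms(2) by (simp add: zeta_0)
qed

lemma height_inv: "g \<in> carrier G \<Longrightarrow> height (inv g) = - height g"
proof -
  assume g: "g \<in> carrier G"
  have "height (g \<otimes> inv g) = height g + height (inv g) + om (vec g) (- vec g)"
    using g by (simp only: height_mult inv_closed vec_inv)
  moreover have "om (vec g) (- vec g) = 0"
    using additive_on_minus[OF om_additive(1), of "vec g" "vec g"] g om_self by simp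
  ultimately show ?thesis using g by simp
qed

end

section \<open>The group H_omega and the embedding in coordinates\<close>

context heisenberg
begin

abbreviation H :: "('a set \<times> int) monoid" where "H \<equiv> H_omega G \<iota>"

lemma mem_cos: "g \<in> carrier G \<Longrightarrow> g' \<in> cos g \<Longrightarrow> g' \<in> carrier G \<and> vec g' = vec g"
proof -
  assume g: "g \<in> carrier G" "g' \<in> cos g"
  then obtain z where z: "z \<in> isolator G" "g' = z \<otimes> g" by (auto simp: r_coset_def)
  then have "g' = zeta (\<iota> z) \<otimes> g" by (simp add: zeta_iota)
  then show ?thesis using g(1) by (simp add: vec_mult)
qed

lemma phi_surj: "P \<in> carrier Q \<Longrightarrow> \<exists>x\<in>int_vecs k. P = phi x"
  using phi_bij by (auto simp: bij_betw_def)

lemma phi_closed: "x \<in> int_vecs k \<Longrightarrow> phi x \<in> carrier Q"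
  using phi_bij by (auto simp: bij_betw_def)

lemma phi_lift: "x \<in> int_vecs k \<Longrightarrow> phi x = cos (lift x)"
  using phi_vec lift by metis

lemma phi_0: "phi 0 = \<one>\<^bsub>Q\<^esub>"
  by (rule additive_hom_one[OF Q_group phi_hom])

lemma omega_phi:
  assumes "x \<in> int_vecs k" "y \<in> int_vecs k"
  shows "omega G \<iota> (phi x) (phi y) = om x y"
  unfolding omega_def phi_lift[OF assms(1)] phi_lift[OF assms(2)]
proof (rule the_equality)
  note l = lift[OF assms(1)] lift[OF assms(2)]
  show "\<forall>g\<in>cos (lift x). \<forall>h\<in>cos (lift y). \<iota> (commutator G g h) = om x y"
  proof (intro ballI)
    fix g h assume "g \<in> cos (lift x)" "h \<in> cos (lift y)"
    then have "g \<in> carrier G \<and> vec g = x" "h \<in> carrier G \<and> vec h = y"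
      using mem_cos[OF l(1)] mem_cos[OF l(3)] l(2,4) by auto
    then show "\<iota> (commutator G g h) = om x y" using iota_commutator by auto
  qed
  fix m assume "\<forall>g\<in>cos (lift x). \<forall>h\<in>cos (lift y). \<iota> (commutator G g h) = m"
  then have "\<iota> (commutator G (lift x) (lift y)) = m"
    using rcos_self[OF l(1) isolator_subgroup] rcos_self[OF l(3) isolator_subgroup] by blast
  then show "m = om x y" by (simp add: om_def)
qed

lemma H_carrier: "carrier H = carrier Q \<times> UNIV"
  by (simp add: H_omega_def)

lemma H_one: "\<one>\<^bsub>H\<^esub> = (phi 0, 0)"
  by (simp add: H_omega_def phi_0)

lemma H_mult: "x \<in> int_vecs k \<Longrightarrow> y \<in> int_vecs k \<Longrightarrow>
  (phi x, c) \<otimes>\<^bsub>H\<^esub> (phi y, c') = (phi (x + y), c + c' + om x y)"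
  by (simp add: H_omega_def omega_phi phi_add del: plus_fun_apply)

lemma H_mem: "p \<in> carrier H \<Longrightarrow> \<exists>x\<in>int_vecs k. \<exists>c. p = (phi x, c)"
  using phi_surj by (auto simp: H_carrier)

lemma phi_in_H: "x \<in> int_vecs k \<Longrightarrow> (phi x, c) \<in> carrier H"
  using phi_closed by (simp add: H_carrier)

lemma H_group: "group H"
proof (rule groupI)
  show "\<one>\<^bsub>H\<^esub> \<in> carrier H" unfolding H_one by (rule phi_in_H) auto
next
  fix p p' assume "p \<in> carrier H" "p' \<in> carrier H"
  then obtain x c y c' where *: "x \<in> int_vecs k" "y \<in> int_vecs k" "p = (phi x, c)" "p' = (phi y, c')"
    using H_mem by metis
  show "p \<otimes>\<^bsub>H\<^esub> p' \<in> carrier H"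
    unfolding *(3,4) H_mult[OF *(1,2)] by (rule phi_in_H[OF int_vecs_closed(2)[OF *(1,2)]])
next
  fix p p' p'' assume "p \<in> carrier H" "p' \<in> carrier H" "p'' \<in> carrier H"
  then obtain x c y c' z c'' where *: "x \<in> int_vecs k" "y \<in> int_vecs k" "z \<in> int_vecs k"
    and p: "p = (phi x, c)" "p' = (phi y, c')" "p'' = (phi z, c'')"
    using H_mem by metis
  show "p \<otimes>\<^bsub>H\<^esub> p' \<otimes>\<^bsub>H\<^esub> p'' = p \<otimes>\<^bsub>H\<^esub> (p' \<otimes>\<^bsub>H\<^esub> p'')"
    unfolding p H_mult[OF *(1,2)] H_mult[OF *(2,3)]
      H_mult[OF int_vecs_closed(2)[OF *(1,2)] *(3)] H_mult[OF *(1) int_vecs_closed(2)[OF *(2,3)]]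
      om_add_left[OF *] om_add_right[OF *] by (simp add: add.assoc del: plus_fun_apply)
next
  fix p assume "p \<in> carrier H"
  then obtain x c where *: "x \<in> int_vecs k" "p = (phi x, c)" using H_mem by metis
  show "\<one>\<^bsub>H\<^esub> \<otimes>\<^bsub>H\<^esub> p = p"
    unfolding *(2) H_one H_mult[OF int_vecs_closed(1) *(1)] om_zero(2)[OF *(1)] by (simp del: zero_fun_apply plus_fun_apply)
  have m: "- x \<in> int_vecs k" using * by auto
  have "om (- x) x = 0"
    using additive_on_minus[OF om_additive(2)[OF *(1)] *(1)] om_self[OF *(1)] by simp
  then have "(phi (- x), - c) \<otimes>\<^bsub>H\<^esub> p = \<one>\<^bsub>H\<^esub>"
    unfolding *(2) H_one H_mult[OF m *(1)] by simp
  then show "\<exists>p'\<in>carrier H. p' \<otimes>\<^bsub>H\<^esub> p = \<one>\<^bsub>H\<^esub>" using phi_in_H[OF m] by blast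
qed

lemma zeta_pow: "zeta 1 [^] (t::int) = zeta t"
proof -
  have nat: "zeta 1 [^] n = zeta (int n)" for n :: nat
    by (induction n) (auto simp: zeta_0 zeta_mult add.commute)
  show ?thesis
  proof (cases t rule: int_cases2)
    case (nonneg n)
    then show ?thesis by (simp add: int_pow_int nat)
  next
    case (nonpos n)
    have "zeta (- int n) = inv (zeta (int n))"
      by (rule inv_equality[symmetric]) (auto simp: zeta_mult zeta_0)
    then show ?thesis using nonpos by (simp add: int_pow_neg_int nat)
  qed
qed

text \<open>The normal form expresses every element through the \<open>a i\<close> and
  \<open>zeta 1\<close>; this gives the uniqueness behind the definite description of the
  embedding.\<close>

lemma hom_determined:
  assumes "group K" "e \<in> hom G K" "e' \<in> hom G K"
    and "\<And>i. i < k \<Longrightarrow> e (a i) = e' (a i)" "e (zeta 1) = e' (zeta 1)" "g \<in> carrier G"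
  shows "e g = e' g"
proof -
  interpret e: group_hom G K e by (simp add: group_hom_def group_hom_axioms_def assms is_group)
  interpret e': group_hom G K e' by (simp add: group_hom_def group_hom_axioms_def assms is_group)
  have s: "e (sig j x) = e' (sig j x)" if "j \<le> k" for j x
    using that
  proof (induction j)
    case (Suc j)
    then show ?case
      using assms(4)[of j] sig_closed[of j] a_closed[of j] by (simp add: e.hom_int_pow e'.hom_int_pow)
  qed simp
  have z: "e (zeta t) = e' (zeta t)" for t
    using assms(5) e.hom_int_pow[of "zeta 1" t] e'.hom_int_pow[of "zeta 1" t] by (simp add: zeta_pow)
  have sc: "sig k (vec g) \<in> carrier G" using sig_closed by simp
  have "e (sig k (vec g) \<otimes> zeta (tcoord g)) = e' (sig k (vec g) \<otimes> zeta (tcoord g))"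
    using s[of k "vec g"] z sc by simp
  then show ?thesis using sig_tcoord[OF assms(6)] by simp
qed

lemma H_embed_eq:
  "H_embed G \<iota> k a = restrict (\<lambda>g. (phi (vec g), height g)) (carrier G)"
  unfolding H_embed_def
proof (rule the_equality)
  let ?e = "restrict (\<lambda>g. (phi (vec g), height g)) (carrier G)"
  have e_hom: "?e \<in> hom G H"
  proof (rule homI)
    show "?e g \<in> carrier H" if "g \<in> carrier G" for g using that phi_in_H by simp
    show "?e (g \<otimes> h) = ?e g \<otimes>\<^bsub>H\<^esub> ?e h" if "g \<in> carrier G" "h \<in> carrier G" for g h
      using that by (simp add: H_mult vec_mult height_mult del: plus_fun_apply)
  qed
  have e_a: "?e (a i) = (cos (a i), 0)" if "i < k" for i
    using that a_closed phi_vec height_a by simp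
  have e_z: "?e (zeta 1) = (\<one>\<^bsub>Q\<^esub>, 2)"
    using phi_0 by (simp del: zero_fun_apply)
  show "?e \<in> hom G H \<inter> extensional (carrier G) \<and> (\<forall>i<k. ?e (a i) = (cos (a i), 0)) \<and>
    ?e (inv_into (isolator G) \<iota> 1) = (\<one>\<^bsub>Q\<^esub>, 2)"
    using e_hom e_a e_z unfolding zeta_def by blast
  fix e assume e: "e \<in> hom G H \<inter> extensional (carrier G) \<and> (\<forall>i<k. e (a i) = (cos (a i), 0)) \<and>
    e (inv_into (isolator G) \<iota> 1) = (\<one>\<^bsub>Q\<^esub>, 2)"
  show "e = ?e"
  proof (rule extensionalityI[of _ "carrier G"])
    show "e \<in> extensional (carrier G)" using e by blast
    show "?e \<in> extensional (carrier G)" by simp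
    fix g assume g: "g \<in> carrier G"
    show "e g = ?e g"
    proof (rule hom_determined[OF H_group _ e_hom _ _ g])
      show "e \<in> hom G H" using e by blast
      show "e (a i) = ?e (a i)" if "i < k" for i using e e_a that by simp
      show "e (zeta 1) = ?e (zeta 1)" using e e_z unfolding zeta_def by simp
    qed
  qed
qed

end

section \<open>The automorphism in coordinates and the map \<psi>'\<close>

locale heisenberg_aut = heisenberg G \<iota> k a for G :: "('a, 'b) monoid_scheme" (structure) and \<iota> k a +
  fixes \<psi> :: "'a \<Rightarrow> 'a"
  assumes psi: "\<psi> \<in> iso G G"
begin

lemma psi_hom: "\<psi> \<in> hom G G"
  using psi by (simp add: iso_def)

sublocale psi: group_hom G G \<psi>
  by (simp add: group_hom_def group_hom_axioms_def psi_hom is_group)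

text \<open>Stated for every automorphism, as it is also applied to the inverse of
  \<open>\<psi>\<close>.\<close>

lemma iso_isolator:
  assumes "\<chi> \<in> iso G G" "z \<in> isolator G"
  shows "\<chi> z \<in> isolator G"
proof -
  have "\<chi> \<in> hom G G" using assms(1) by (simp add: iso_def)
  then interpret chi: group_hom G G \<chi>
    by (simp add: group_hom_def group_hom_axioms_def is_group)
  have "\<chi> ` derived_set G (carrier G) \<subseteq> derived_set G (carrier G)"
  proof
    fix y assume "y \<in> \<chi> ` derived_set G (carrier G)"
    then obtain g h where "g \<in> carrier G" "h \<in> carrier G" "y = \<chi> (g \<otimes> h \<otimes> inv g \<otimes> inv h)" by auto
    then have "y = \<chi> g \<otimes> \<chi> h \<otimes> inv (\<chi> g) \<otimes> inv (\<chi> h)" "\<chi> g \<in> carrier G" "\<chi> h \<in> carrier G" by auto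
    then show "y \<in> derived_set G (carrier G)" by blast
  qed
  from mono_generate[OF this] have der: "\<chi> ` derived G (carrier G) \<subseteq> derived G (carrier G)"
    unfolding derived_def using chi.generate_img[OF derived_set_in_carrier[OF order_refl]] by simp
  obtain n :: nat where n: "n \<ge> 1" "z [^] n \<in> derived G (carrier G)" using assms(2) by (auto simp: isolator_def)
  have zc: "z \<in> carrier G" using assms(2) by (rule isolator_carrier)
  have "\<chi> z [^] n \<in> derived G (carrier G)" using der n(2) chi.hom_nat_pow[OF zc, of n] by auto
  then show ?thesis using isolatorI[OF _ n(1)] zc by simp
qed

definition eps :: int where "eps = \<iota> (\<psi> (zeta 1))"

lemma psi_zeta: "\<psi> (zeta t) = zeta (eps * t)"
proof -
  have e: "\<psi> (zeta 1) = zeta eps"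
    using zeta_iota[OF iso_isolator[OF psi zeta_in[of 1]]] by (simp add: eps_def)
  have "\<psi> (zeta t) = zeta eps [^] t" using psi.hom_int_pow[of "zeta 1" t] by (simp add: zeta_pow e)
  also have "\<dots> = zeta (eps * t)"
    using int_pow_pow[OF zeta_closed[of 1], of eps t] by (simp only: zeta_pow)
  finally show ?thesis .
qed

lemma psi_bij: "bij_betw \<psi> (carrier G) (carrier G)"
  using psi by (simp add: iso_def)

lemma psi_isolator_iff: "g \<in> carrier G \<Longrightarrow> \<psi> g \<in> isolator G \<longleftrightarrow> g \<in> isolator G"
proof
  assume g: "g \<in> carrier G" "\<psi> g \<in> isolator G"
  have "inv_into (carrier G) \<psi> \<in> iso G G" using iso_set_sym[OF psi] .
  from iso_isolator[OF this g(2)] show "g \<in> isolator G"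
    using bij_betw_inv_into_left[OF psi_bij g(1)] by simp
qed (rule iso_isolator[OF psi])

text \<open>A preimage of \<open>zeta 1\<close> lies in the isolator, so \<open>eps\<close> has an
  integral inverse.\<close>

lemma eps_cases: "eps = 1 \<or> eps = - 1"
proof -
  obtain g where g: "g \<in> carrier G" "\<psi> g = zeta 1" using psi_bij zeta_closed by (metis bij_betw_iff_bijections)
  then have "g \<in> isolator G" using psi_isolator_iff[OF g(1)] zeta_in by simp
  then have "\<psi> (zeta (\<iota> g)) = zeta 1" using g zeta_iota by simp
  then have "zeta (eps * \<iota> g) = zeta 1" by (simp add: psi_zeta)
  then have "eps * \<iota> g = 1" using iota_zeta by metis
  then show ?thesis using zmult_eq_1_iff by blast
qed

definition A :: "(nat \<Rightarrow> int) \<Rightarrow> (nat \<Rightarrow> int)" where "A x = vec (\<psi> (lift x))"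

lemma A_in: "x \<in> int_vecs k \<Longrightarrow> A x \<in> int_vecs k"
  by (simp add: A_def lift)

lemma lift_vec: "g \<in> carrier G \<Longrightarrow> \<exists>t. g = lift (vec g) \<otimes> zeta t"
  using vec_eq_iff[of g "lift (vec g)"] lift[of "vec g"] by simp

lemma vec_psi: assumes g: "g \<in> carrier G" shows "vec (\<psi> g) = A (vec g)"
proof -
  obtain t where t: "g = lift (vec g) \<otimes> zeta t" using lift_vec[OF g] by blast
  have l: "lift (vec g) \<in> carrier G" using lift g by simp
  have "vec (\<psi> (lift (vec g) \<otimes> zeta t)) = A (vec g)"
    using l by (simp add: psi_zeta vec_mult_zeta A_def)
  then show ?thesis using t by simp
qed

lemma A_add: "x \<in> int_vecs k \<Longrightarrow> y \<in> int_vecs k \<Longrightarrow> A (x + y) = A x + A y"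
proof -
  assume xy: "x \<in> int_vecs k" "y \<in> int_vecs k"
  have "vec (\<psi> (lift x \<otimes> lift y)) = A (x + y)"
    using vec_psi[of "lift x \<otimes> lift y"] xy lift by (simp add: vec_mult del: plus_fun_apply)
  moreover have "vec (\<psi> (lift x \<otimes> lift y)) = A x + A y"
    using xy lift by (simp add: vec_mult vec_psi del: plus_fun_apply)
  ultimately show ?thesis by simp
qed

lemma om_A: assumes xy: "x \<in> int_vecs k" "y \<in> int_vecs k" shows "om (A x) (A y) = eps * om x y"
proof -
  note l = lift[OF xy(1)] lift[OF xy(2)]
  have "\<psi> (commutator G (lift x) (lift y)) = commutator G (\<psi> (lift x)) (\<psi> (lift y))"
    using l by (simp add: commutator_def)
  then have "zeta (eps * om x y) = zeta (om (A x) (A y))"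
    using l by (simp add: commutator_eq_zeta psi_zeta vec_psi)
  then show ?thesis using iota_zeta by metis
qed

text \<open>This will turn out to be \<psi>' in the coordinates \<open>phi\<close>: the deviation of
  heights from being multiplied by \<open>eps\<close>.\<close>

definition f :: "(nat \<Rightarrow> int) \<Rightarrow> int" where
  "f x = height (\<psi> (lift x)) - eps * height (lift x)"

text \<open>Passing from the chosen lift to \<open>g\<close> adds 2t to the height before and 2 eps
  t after applying \<open>\<psi>\<close>, which cancels in \<open>f\<close>.\<close>

lemma height_psi: assumes g: "g \<in> carrier G" shows "height (\<psi> g) = eps * height g + f (vec g)"
proof -
  obtain t where t: "g = lift (vec g) \<otimes> zeta t" using lift_vec[OF g] by blast
  have l: "lift (vec g) \<in> carrier G" using lift g by simp
  have 1: "height (\<psi> (lift (vec g) \<otimes> zeta t)) = height (\<psi> (lift (vec g))) + 2 * (eps * t)"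
    using l by (simp add: psi_zeta height_mult_zeta)
  have 2: "height (lift (vec g) \<otimes> zeta t) = height (lift (vec g)) + 2 * t"
    using l by (simp add: height_mult_zeta)
  from 1 2 show ?thesis unfolding t[symmetric] by (simp add: f_def algebra_simps)
qed

text \<open>The bilinear terms in the heights of products cancel because \<open>\<psi>\<close>
  multiplies the form by \<open>eps\<close>.\<close>

lemma f_additive: "additive_on k f"
  unfolding additive_on_def
proof (intro ballI)
  fix x y assume xy: "x \<in> int_vecs k" "y \<in> int_vecs k"
  note l = lift[OF xy(1)] lift[OF xy(2)]
  have "height (\<psi> (lift x \<otimes> lift y)) = eps * (height (lift x) + height (lift y) + om x y) + f (x + y)"
    using height_psi[of "lift x \<otimes> lift y"] l by (simp add: height_mult vec_mult del: plus_fun_apply)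
  moreover have "height (\<psi> (lift x \<otimes> lift y))
    = eps * height (lift x) + f x + (eps * height (lift y) + f y) + eps * om x y"
    using l xy by (simp add: height_mult height_psi vec_psi om_A)
  ultimately show "f (x + y) = f x + f y" by (simp add: algebra_simps del: plus_fun_apply)
qed

lemma A_inj: assumes "x \<in> int_vecs k" "A x = 0" shows "x = 0"
proof -
  note l = lift[OF assms(1)]
  have "vec (\<psi> (lift x)) = vec \<one>" using assms(2) by (simp add: A_def)
  then obtain t where "\<psi> (lift x) = \<one> \<otimes> zeta t" using vec_eq_iff[of "\<psi> (lift x)" \<one>] l(1) by auto
  then have "lift x \<in> isolator G" using psi_isolator_iff[OF l(1)] zeta_in by simp
  then have "vec (lift x) = 0" using zeta_iota vec_zeta by metis
  then show ?thesis using l(2) by simp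
qed

lemma A_surj: assumes "y \<in> int_vecs k" shows "\<exists>x\<in>int_vecs k. A x = y"
proof -
  obtain g where g: "g \<in> carrier G" "\<psi> g = lift y"
    using psi_bij lift(1)[OF assms] by (metis bij_betw_iff_bijections)
  then have "A (vec g) = y" using vec_psi[OF g(1)] lift(2)[OF assms] by simp
  then show ?thesis using g(1) vec_in by blast
qed

text \<open>The map (x, c) |-> (A x, eps c + f x) is an automorphism of H_omega that extends
  \<open>\<psi>\<close>. The point is its uniqueness: the image of G omits the elements (0, m) with
  \<open>m\<close> odd, and these are controlled through their squares, which lie in the
  image.\<close>

lemma psi_prime_eq:
  assumes x: "x \<in> int_vecs k"
  shows "psi_prime G \<iota> k a \<psi> (phi x) = f x"
proof -
  define vq where "vq P = inv_into (int_vecs k) phi P" for P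
  have vq: "vq (phi x) = x" if "x \<in> int_vecs k" for x
    unfolding vq_def using that phi_bij by (meson bij_betw_inv_into_left)
  define \<Psi> where "\<Psi> = restrict (\<lambda>p. (phi (A (vq (fst p))), eps * snd p + f (vq (fst p)))) (carrier H)"
  have \<Psi>: "\<Psi> (phi x, c) = (phi (A x), eps * c + f x)" if "x \<in> int_vecs k" for x c
    using that phi_in_H vq by (simp add: \<Psi>_def)
  have \<Psi>_hom: "\<Psi> \<in> hom H H"
  proof (rule homI)
    fix p assume "p \<in> carrier H"
    then obtain x c where *: "x \<in> int_vecs k" "p = (phi x, c)" using H_mem by metis
    show "\<Psi> p \<in> carrier H" unfolding *(2) \<Psi>[OF *(1)] by (rule phi_in_H[OF A_in[OF *(1)]])
  next
    fix p p' assume "p \<in> carrier H" "p' \<in> carrier H"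
    then obtain x c y c' where *: "x \<in> int_vecs k" "y \<in> int_vecs k" "p = (phi x, c)" "p' = (phi y, c')"
      using H_mem by metis
    show "\<Psi> (p \<otimes>\<^bsub>H\<^esub> p') = \<Psi> p \<otimes>\<^bsub>H\<^esub> \<Psi> p'"
      unfolding *(3,4) H_mult[OF *(1,2)] \<Psi>[OF *(1)] \<Psi>[OF *(2)] \<Psi>[OF int_vecs_closed(2)[OF *(1,2)]]
        H_mult[OF A_in[OF *(1)] A_in[OF *(2)]] A_add[OF *(1,2)] additive_onD[OF f_additive *(1,2)] om_A[OF *(1,2)]
      by (simp add: algebra_simps del: plus_fun_apply)
  qed
  have \<Psi>_bij: "bij_betw \<Psi> (carrier H) (carrier H)"
    unfolding bij_betw_def
  proof
    interpret H: group H by (rule H_group)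
    interpret Psi: group_hom H H \<Psi> by (simp add: group_hom_def group_hom_axioms_def \<Psi>_hom H_group)
    show "inj_on \<Psi> (carrier H)"
    proof (subst Psi.inj_on_one_iff, intro allI impI)
      fix p assume p: "p \<in> carrier H" "\<Psi> p = \<one>\<^bsub>H\<^esub>"
      then obtain x c where *: "x \<in> int_vecs k" "p = (phi x, c)" using H_mem by metis
      have "phi (A x) = phi 0" "eps * c + f x = 0" using p(2) unfolding *(2) \<Psi>[OF *(1)] H_one by auto
      then have "A x = 0" using phi_inj[OF A_in[OF *(1)] int_vecs_closed(1)] by blast
      then have x0: "x = 0" using A_inj *(1) by blast
      then have "eps * c = 0" using \<open>eps * c + f x = 0\<close> additive_on_0[OF f_additive] by (simp del: zero_fun_apply)
      then show "p = \<one>\<^bsub>H\<^esub>" using *(2) x0 eps_cases unfolding H_one by auto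
    qed
    show "\<Psi> ` carrier H = carrier H"
    proof
      show "\<Psi> ` carrier H \<subseteq> carrier H" using \<Psi>_hom by (auto simp: hom_def)
      show "carrier H \<subseteq> \<Psi> ` carrier H"
      proof
        fix p assume "p \<in> carrier H"
        then obtain y c where *: "y \<in> int_vecs k" "p = (phi y, c)" using H_mem by metis
        obtain x where x: "x \<in> int_vecs k" "A x = y" using A_surj *(1) by blast
        \<comment> \<open>\<open>eps\<close> is its own inverse, which gives the preimage.\<close>
        have "eps * (eps * (c - f x)) = c - f x" using eps_cases by auto
        then have "eps * (eps * (c - f x)) + f x = c" by linarith
        then have "\<Psi> (phi x, eps * (c - f x)) = p" unfolding \<Psi>[OF x(1)] *(2) x(2) by (simp only:)
        then show "p \<in> \<Psi> ` carrier H" using phi_in_H[OF x(1)] by blast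
      qed
    qed
  qed
  have ext: "H_extend G \<iota> k a \<psi> = \<Psi>"
    unfolding H_extend_def
  proof (rule the_equality)
    have "\<Psi> (H_embed G \<iota> k a g) = H_embed G \<iota> k a (\<psi> g)" if "g \<in> carrier G" for g
      using that by (simp add: H_embed_eq \<Psi> vec_psi height_psi)
    then show "\<Psi> \<in> auto H \<and> (\<forall>g\<in>carrier G. \<Psi> (H_embed G \<iota> k a g) = H_embed G \<iota> k a (\<psi> g))"
      using \<Psi>_hom \<Psi>_bij by (simp add: auto_def Bij_def) (simp add: \<Psi>_def)
    fix \<Phi> assume \<Phi>: "\<Phi> \<in> auto H \<and> (\<forall>g\<in>carrier G. \<Phi> (H_embed G \<iota> k a g) = H_embed G \<iota> k a (\<psi> g))"
    then have \<Phi>_hom: "\<Phi> \<in> hom H H" and \<Phi>_ext: "\<Phi> \<in> extensional (carrier H)"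
      by (auto simp: auto_def Bij_def)
    have \<Phi>_G: "\<Phi> (phi (vec g), height g) = (phi (A (vec g)), eps * height g + f (vec g))" if "g \<in> carrier G" for g
      using \<Phi> that by (simp add: H_embed_eq vec_psi height_psi)
    \<comment> \<open>The square of (0, m) comes from \<open>zeta m\<close>, where the value of
      \<open>\<Phi>\<close> is prescribed; square roots of elements (0, 2c) in H_omega are unique,
      because \<int>^k is torsion free and the form is alternating.\<close>
    have \<Phi>_c: "\<Phi> (phi 0, m) = (phi 0, eps * m)" for m
    proof -
      have "\<Phi> (phi 0, m) \<in> carrier H" using \<Phi>_hom phi_in_H[OF int_vecs_closed(1)] by (auto simp: hom_def)
      then obtain y c where y: "y \<in> int_vecs k" "\<Phi> (phi 0, m) = (phi y, c)" using H_mem by metis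
      have "(phi 0, m) \<otimes>\<^bsub>H\<^esub> (phi 0, m) = (phi 0, 2 * m)"
        unfolding H_mult[OF int_vecs_closed(1) int_vecs_closed(1)] om_zero(1)[OF int_vecs_closed(1)] by simp
      moreover have "\<Phi> ((phi 0, m) \<otimes>\<^bsub>H\<^esub> (phi 0, m)) = \<Phi> (phi 0, m) \<otimes>\<^bsub>H\<^esub> \<Phi> (phi 0, m)"
        using \<Phi>_hom phi_in_H[OF int_vecs_closed(1)] by (simp add: hom_def del: zero_fun_apply)
      ultimately have "\<Phi> (phi 0, 2 * m) = (phi (y + y), c + c + om y y)"
        unfolding y(2) H_mult[OF y(1) y(1)] by simp
      moreover have "\<Phi> (phi 0, 2 * m) = (phi 0, eps * (2 * m))"
      proof -
        have "A 0 = 0" using A_add[of 0 0] by (simp del: zero_fun_apply plus_fun_apply)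
        then show ?thesis
          using \<Phi>_G[OF zeta_closed[of m]] additive_on_0[OF f_additive] by (simp del: zero_fun_apply)
      qed
      ultimately have eq: "phi (y + y) = phi 0" "2 * c = 2 * (eps * m)" using om_self[OF y(1)] by auto
      have "y + y = 0" using phi_inj[OF int_vecs_closed(2)[OF y(1) y(1)] int_vecs_closed(1) eq(1)] .
      then have "(y + y) i = 0" for i by simp
      then have "y i = 0" for i by (metis plus_fun_apply add_eq_0_iff equal_neg_zero)
      then have "y = 0" by (intro ext) simp
      then show ?thesis using y(2) eq(2) by simp
    qed
    show "\<Phi> = \<Psi>"
    proof (rule extensionalityI[OF \<Phi>_ext])
      show "\<Psi> \<in> extensional (carrier H)" by (simp add: \<Psi>_def)
      fix p assume "p \<in> carrier H"
      then obtain x c where *: "x \<in> int_vecs k" "p = (phi x, c)" using H_mem by metis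
      note l = lift[OF *(1)]
      \<comment> \<open>Every element of H_omega is an element of the image of G times some (0, m),
        where \<open>m\<close> absorbs a possible odd difference of heights.\<close>
      define m where "m = c - height (lift x)"
      have "p = (phi x, height (lift x)) \<otimes>\<^bsub>H\<^esub> (phi 0, m)"
        unfolding H_mult[OF *(1) int_vecs_closed(1)] om_zero(1)[OF *(1)] *(2) by (simp add: m_def)
      then have "\<Phi> p = \<Phi> (phi x, height (lift x)) \<otimes>\<^bsub>H\<^esub> \<Phi> (phi 0, m)"
        using \<Phi>_hom phi_in_H[OF int_vecs_closed(1)] phi_in_H[OF *(1)] by (simp add: hom_def del: zero_fun_apply)
      also have "\<dots> = (phi (A x), eps * height (lift x) + f x) \<otimes>\<^bsub>H\<^esub> (phi 0, eps * m)"
        using \<Phi>_G[OF l(1)] \<Phi>_c[of m] l(2) by simp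
      also have "\<dots> = (phi (A x), eps * c + f x)"
        unfolding H_mult[OF A_in[OF *(1)] int_vecs_closed(1)] om_zero(1)[OF A_in[OF *(1)]]
        by (simp add: m_def algebra_simps)
      finally show "\<Phi> p = \<Psi> p" unfolding *(2) \<Psi>[OF *(1)] .
    qed
  qed
  show ?thesis unfolding psi_prime_def ext \<Psi>[OF x] by simp
qed

end

section \<open>The ranks and the kernel condition in coordinates\<close>

context heisenberg_aut
begin

definition D :: "(nat \<Rightarrow> int) \<Rightarrow> (nat \<Rightarrow> int)" where "D x = A x - x"

definition rad :: "(nat \<Rightarrow> int) set" where
  "rad = {v \<in> int_vecs k. \<forall>y\<in>int_vecs k. om v y = 0}"

lemma D_in: "x \<in> int_vecs k \<Longrightarrow> D x \<in> int_vecs k"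
  unfolding D_def by (intro int_vecs_closed A_in)

lemma D_add: "additive_on k D"
  unfolding additive_on_def D_def by (intro ballI) (simp only: A_add add_diff_add)

lemma rad_in: "x \<in> rad \<Longrightarrow> x \<in> int_vecs k"
  by (simp add: rad_def)

lemma phi_minus: "x \<in> int_vecs k \<Longrightarrow> phi (- x) = inv\<^bsub>Q\<^esub> phi x"
  by (rule additive_hom_minus[OF Q_group phi_hom])

lemma phi_subgroup:
  assumes "lattice_param m \<theta> L" "L \<subseteq> int_vecs k"
  shows "subgroup (phi ` L) Q"
proof -
  interpret Q: group Q by (rule Q_group)
  have L: "x + y \<in> L" if "x \<in> L" "y \<in> L" for x y
    using lattice_param_inv[OF assms(1)] that by metis
  have L0: "0 \<in> L" using lattice_param_in[OF assms(1) int_vecs_closed(1)] additive_on_0[OF lattice_param_add[OF assms(1)]]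
    by simp
  have Lm: "- x \<in> L" if "x \<in> L" for x
  proof -
    obtain y where y: "y \<in> int_vecs m" "x = \<theta> y" using lattice_param_surj[OF assms(1) \<open>x \<in> L\<close>] by blast
    then have "- x = \<theta> (- y)" using additive_on_minus[OF lattice_param_add[OF assms(1)] y(1)] by simp
    then show ?thesis using lattice_param_in[OF assms(1) int_vecs_closed(4)[OF y(1)]] by simp
  qed
  show ?thesis
  proof (rule Q.subgroupI)
    show "phi ` L \<subseteq> carrier Q" using phi_closed assms(2) by auto
    show "phi ` L \<noteq> {}" using L0 by auto
    show "inv\<^bsub>Q\<^esub> P \<in> phi ` L" if PL: "P \<in> phi ` L" for P
    proof -
      obtain x where x: "x \<in> L" "P = phi x" using PL by blast
      then have "inv\<^bsub>Q\<^esub> P = phi (- x)" using phi_minus assms(2) by auto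
      then show ?thesis using Lm x(1) by blast
    qed
    show "P \<otimes>\<^bsub>Q\<^esub> P' \<in> phi ` L" if PP: "P \<in> phi ` L" "P' \<in> phi ` L" for P P'
    proof -
      obtain x y where "x \<in> L" "P = phi x" "y \<in> L" "P' = phi y" using PP by blast
      then show ?thesis using L[of x y] phi_add[of x y] by (metis imageI)
    qed
  qed
qed

text \<open>All four dimensions and ranks in the exponent and the defect are dimensions of lattices
  in \<int>^k transported by \<open>phi\<close>.\<close>

lemma int_dim_phi:
  assumes "lattice_param m \<theta> L" "L \<subseteq> int_vecs k"
  shows "int_dim (Q\<lparr>carrier := phi ` L\<rparr>) = m"
proof (rule int_dim_eqI[where h = "\<lambda>x. phi (\<theta> x)"])
  interpret Q: comm_group Q by (rule Q_comm_group)
  have sub: "subgroup (phi ` L) Q" by (rule phi_subgroup[OF assms])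
  have g: "group (Q\<lparr>carrier := phi ` L\<rparr>)" using Q.subgroup_imp_group[OF sub] .
  show "comm_group (Q\<lparr>carrier := phi ` L\<rparr>)"
  proof (rule group.group_comm_groupI[OF g])
    fix P P' assume "P \<in> carrier (Q\<lparr>carrier := phi ` L\<rparr>)" "P' \<in> carrier (Q\<lparr>carrier := phi ` L\<rparr>)"
    then have "P \<in> carrier Q" "P' \<in> carrier Q" using subgroup.subset[OF sub] by auto
    then show "P \<otimes>\<^bsub>Q\<lparr>carrier := phi ` L\<rparr>\<^esub> P' = P' \<otimes>\<^bsub>Q\<lparr>carrier := phi ` L\<rparr>\<^esub> P" using Q.m_comm by simp
  qed
  have inj: "inj_on phi L" using phi_inj assms(2) by (intro inj_onI) auto
  show "bij_betw (\<lambda>x. phi (\<theta> x)) (int_vecs m) (carrier (Q\<lparr>carrier := phi ` L\<rparr>))"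
    using bij_betw_trans[of \<theta> "int_vecs m" L phi "phi ` L"] assms(1) inj
    by (simp add: lattice_param_def bij_betw_def comp_def inj_on_imp_bij_betw)
  show "additive_hom m (Q\<lparr>carrier := phi ` L\<rparr>) (\<lambda>x. phi (\<theta> x))"
    using lattice_param_in[OF assms(1)] additive_onD[OF lattice_param_add[OF assms(1)]] phi_add
    by (simp add: additive_hom_def del: plus_fun_apply)
qed

lemma d_c_eq: "d_c G = k"
  unfolding d_c_def by (rule int_dim_eqI[OF Q_comm_group phi_bij phi_hom])

lemma psi_isolator_image: "\<psi> ` isolator G = isolator G"
proof
  show "\<psi> ` isolator G \<subseteq> isolator G" using iso_isolator[OF psi] by blast
  show "isolator G \<subseteq> \<psi> ` isolator G"
  proof
    fix z assume z: "z \<in> isolator G"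
    then obtain g where g: "g \<in> carrier G" "\<psi> g = z"
      using psi_bij isolator_carrier[OF z] by (metis bij_betw_iff_bijections)
    then show "z \<in> \<psi> ` isolator G" using psi_isolator_iff[OF g(1)] z by blast
  qed
qed

text \<open>Needs that \<open>\<psi>\<close> maps the isolator onto itself; only then is the image
  of a coset a full coset.\<close>

lemma induced_cos: "g \<in> carrier G \<Longrightarrow> induced_map \<psi> (cos g) = cos (\<psi> g)"
proof -
  assume g: "g \<in> carrier G"
  have "\<psi> ` cos g = (\<lambda>z. z \<otimes> \<psi> g) ` (\<psi> ` isolator G)"
    using g isolator_carrier by (auto simp: r_coset_def image_iff)
  then show ?thesis unfolding psi_isolator_image by (auto simp: induced_map_def r_coset_def)
qed

lemma induced_phi: "x \<in> int_vecs k \<Longrightarrow> induced_map \<psi> (phi x) = phi (A x)"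
  using induced_cos[of "lift x"] phi_vec[of "\<psi> (lift x)"] lift[of x] phi_lift[of x] by (simp add: A_def)

lemma minus_id_phi: "x \<in> int_vecs k \<Longrightarrow> minus_id Q (induced_map \<psi>) (phi x) = phi (D x)"
proof -
  assume x: "x \<in> int_vecs k"
  have "phi (A x) \<otimes>\<^bsub>Q\<^esub> inv\<^bsub>Q\<^esub> phi x = phi (A x + - x)" unfolding phi_add phi_minus[OF x] ..
  then show ?thesis unfolding minus_id_def induced_phi[OF x] D_def by simp
qed

lemma r_c_eq:
  assumes "lattice_param r \<theta> (D ` int_vecs k)"
  shows "r_c G \<psi> = r"
proof -
  have "carrier Q = phi ` int_vecs k" using phi_bij by (simp add: bij_betw_def)
  then have "minus_id Q (induced_map \<psi>) ` carrier Q = phi ` (D ` int_vecs k)"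
    by (simp add: image_image minus_id_phi)
  then show ?thesis
    using int_dim_phi[OF assms] D_in by (auto simp: r_c_def rank_minus_id_def)
qed

lemma center_iff: "g \<in> carrier G \<Longrightarrow> g \<in> group_center G \<longleftrightarrow> vec g \<in> rad"
proof
  assume g: "g \<in> carrier G" "g \<in> group_center G"
  have "om (vec g) y = 0" if "y \<in> int_vecs k" for y
    using commutator_central[OF g(1) lift(1)[OF that] center_comm[OF g(2) lift(1)[OF that]]]
      iota_commutator[OF g(1) lift(1)[OF that]] lift(2)[OF that] iota_one by simp
  then show "vec g \<in> rad" using g(1) by (simp add: rad_def)
next
  assume g: "g \<in> carrier G" "vec g \<in> rad"
  have "g \<otimes> h = h \<otimes> g" if h: "h \<in> carrier G" for h
    using commutator_swap[OF g(1) h] commutator_eq_zeta[OF g(1) h] g h by (simp add: rad_def zeta_0)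
  then show "g \<in> group_center G" using g(1) by (simp add: group_center_def)
qed

text \<open>The cosets of the isolator inside the centre are literally cosets in G, so this quotient
  is a substructure of the other one and no second set of coordinates is required.\<close>

lemma quot_zc_eq: "quot_zc G = Q\<lparr>carrier := phi ` rad\<rparr>"
proof -
  have "(\<Union>g\<in>group_center G. {cos g}) = phi ` rad"
  proof
    show "(\<Union>g\<in>group_center G. {cos g}) \<subseteq> phi ` rad"
    proof
      fix P assume "P \<in> (\<Union>g\<in>group_center G. {cos g})"
      then obtain g where g: "g \<in> group_center G" "P = cos g" by blast
      then have "P = phi (vec g)" "vec g \<in> rad" using center_carrier center_iff phi_vec by auto
      then show "P \<in> phi ` rad" by blast
    qed
    show "phi ` rad \<subseteq> (\<Union>g\<in>group_center G. {cos g})"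
    proof
      fix P assume "P \<in> phi ` rad"
      then obtain x where x: "x \<in> rad" "P = phi x" by blast
      then have "lift x \<in> group_center G" "P = cos (lift x)"
        using center_iff lift rad_in phi_lift by auto
      then show "P \<in> (\<Union>g\<in>group_center G. {cos g})" by blast
    qed
  qed
  then show ?thesis
    by (simp add: quot_zc_def quot_c_def FactGroup_def RCOSETS_def r_coset_def set_mult_def fun_eq_iff)
qed

lemma d_zc_eq: "lattice_param m \<theta> rad \<Longrightarrow> d_zc G = m"
  unfolding d_zc_def quot_zc_eq by (rule int_dim_phi) (use rad_in in auto)

text \<open>The inverse inside \<open>minus_id\<close> is formed in the substructure and has to be
  identified with the inverse in \<open>Q\<close>, for which the image of \<open>rad\<close> must be
  a subgroup.\<close>

lemma minus_id_zc:
  assumes "lattice_param m \<theta> rad" "x \<in> rad"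
  shows "minus_id (quot_zc G) (induced_map \<psi>) (phi x) = phi (D x)"
proof -
  have sub: "subgroup (phi ` rad) Q" by (rule phi_subgroup[OF assms(1)]) (use rad_in in auto)
  have "inv\<^bsub>Q\<lparr>carrier := phi ` rad\<rparr>\<^esub> (phi x) = inv\<^bsub>Q\<^esub> (phi x)"
    by (rule group.m_inv_consistent[OF Q_group sub]) (use assms(2) in auto)
  then show ?thesis using minus_id_phi[OF rad_in[OF assms(2)]] by (simp add: minus_id_def quot_zc_eq)
qed

lemma r_zc_eq:
  assumes "lattice_param m \<theta> rad" "lattice_param r \<theta>' (D ` rad)"
  shows "r_zc G \<psi> = r"
proof -
  have "carrier (quot_zc G) = phi ` rad" by (simp add: quot_zc_eq)
  then have "minus_id (quot_zc G) (induced_map \<psi>) ` carrier (quot_zc G) = phi ` (D ` rad)"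
    using minus_id_zc[OF assms(1)] by (simp add: image_image)
  moreover have "int_dim (Q\<lparr>carrier := phi ` (D ` rad)\<rparr>) = r"
    by (rule int_dim_phi[OF assms(2)]) (use D_in rad_in in auto)
  ultimately show ?thesis by (simp add: r_zc_def rank_minus_id_def quot_zc_eq)
qed

text \<open>Turns the second alternative of the first case of \<open>d_psi\<close> into a condition
  on \<open>f\<close> over the kernel of \<open>D\<close> in the radical.\<close>

lemma psi_prime_kernel:
  assumes "lattice_param m \<theta> rad"
  shows "psi_prime G \<iota> k a \<psi> ` kernel (quot_zc G) (quot_zc G) (minus_id (quot_zc G) (induced_map \<psi>))
    = f ` {x \<in> rad. D x = 0}"
proof -
  have c: "carrier (quot_zc G) = phi ` rad" and o: "\<one>\<^bsub>quot_zc G\<^esub> = phi 0"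
    by (simp_all add: quot_zc_eq phi_0)
  have iff: "minus_id (quot_zc G) (induced_map \<psi>) (phi x) = \<one>\<^bsub>quot_zc G\<^esub> \<longleftrightarrow> D x = 0" if "x \<in> rad" for x
    unfolding minus_id_zc[OF assms that] o
    using phi_inj[OF D_in[OF rad_in[OF that]] int_vecs_closed(1)] by metis
  have "kernel (quot_zc G) (quot_zc G) (minus_id (quot_zc G) (induced_map \<psi>)) = phi ` {x \<in> rad. D x = 0}"
    unfolding kernel_def c using iff by blast
  then show ?thesis using psi_prime_eq rad_in by (simp add: image_image)
qed

lemma psi_inverts_iff: "(\<forall>x\<in>isolator G. \<psi> x = inv x) \<longleftrightarrow> eps = - 1"
proof -
  have i: "inv (zeta t) = zeta (- t)" for t
    by (rule inv_equality) (auto simp: zeta_mult zeta_0)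
  show ?thesis
  proof
    assume "\<forall>x\<in>isolator G. \<psi> x = inv x"
    then have "zeta eps = zeta (- 1)" using psi_zeta[of 1] i[of 1] zeta_in[of 1] by simp
    then show "eps = - 1" using iota_zeta by metis
  next
    assume e: "eps = - 1"
    show "\<forall>x\<in>isolator G. \<psi> x = inv x"
    proof
      fix x assume x: "x \<in> isolator G"
      have "\<psi> (zeta (\<iota> x)) = inv (zeta (\<iota> x))" by (simp add: psi_zeta e i)
      then show "\<psi> x = inv x" using zeta_iota[OF x] by simp
    qed
  qed
qed

section \<open>Twisted conjugation as a group action\<close>

definition twist :: "'a \<Rightarrow> 'a \<Rightarrow> 'a" where
  "twist g x = g \<otimes> x \<otimes> inv (\<psi> g)"

lemma twist_closed [simp]: "g \<in> carrier G \<Longrightarrow> x \<in> carrier G \<Longrightarrow> twist g x \<in> carrier G"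
  by (simp add: twist_def)

lemma twist_twist:
  "g \<in> carrier G \<Longrightarrow> h \<in> carrier G \<Longrightarrow> x \<in> carrier G \<Longrightarrow> twist g (twist h x) = twist (g \<otimes> h) x"
  by (simp add: twist_def m_assoc inv_mult_group)

lemma twist_one: "x \<in> carrier G \<Longrightarrow> twist \<one> x = x"
  by (simp add: twist_def)

lemma twisted_class_twist: "twisted_class G \<psi> x = {y. \<exists>g\<in>carrier G. twist g x = y}" if "x \<in> carrier G"
  using that twist_closed[of _ x] unfolding twisted_class_def twist_def by auto

lemma twisted_class_eq_iff:
  assumes "x \<in> carrier G" "y \<in> carrier G"
  shows "twisted_class G \<psi> x = twisted_class G \<psi> y \<longleftrightarrow> (\<exists>g\<in>carrier G. twist g x = y)"
proof
  assume "twisted_class G \<psi> x = twisted_class G \<psi> y"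
  moreover have "y \<in> twisted_class G \<psi> y"
    using twist_one[OF assms(2)] twisted_class_twist[OF assms(2)] one_closed by blast
  ultimately show "\<exists>g\<in>carrier G. twist g x = y" using twisted_class_twist[OF assms(1)] by blast
next
  assume "\<exists>g\<in>carrier G. twist g x = y"
  then obtain g where g: "g \<in> carrier G" "twist g x = y" by blast
  have xy: "twist (inv g) y = x"
    using twist_twist[of "inv g" g x] g assms twist_one[OF assms(1)] by simp
  show "twisted_class G \<psi> x = twisted_class G \<psi> y"
    unfolding twisted_class_twist[OF assms(1)] twisted_class_twist[OF assms(2)]
  proof (intro Collect_cong iffI)
    fix z assume "\<exists>h\<in>carrier G. twist h x = z"
    then obtain h where h: "h \<in> carrier G" "twist h x = z" by blast
    then have "twist (h \<otimes> inv g) y = z" using twist_twist[of h "inv g" y] xy g(1) assms by simp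
    then show "\<exists>h\<in>carrier G. twist h y = z" using h(1) g(1) by blast
  next
    fix z assume "\<exists>h\<in>carrier G. twist h y = z"
    then obtain h where h: "h \<in> carrier G" "twist h y = z" by blast
    then have "twist (h \<otimes> g) x = z" using twist_twist[of h g x] g assms by simp
    then show "\<exists>h\<in>carrier G. twist h x = z" using h(1) g(1) by blast
  qed
qed

lemma vec_twist:
  assumes "g \<in> carrier G" "x \<in> carrier G"
  shows "vec (twist g x) = vec x - D (vec g)"
  using assms unfolding twist_def D_def
  by (simp add: vec_mult vec_inv vec_psi algebra_simps)

lemma height_twist:
  assumes g: "g \<in> carrier G" and x: "x \<in> carrier G"
  shows "height (twist g x) = height x + (1 - eps) * height g - f (vec g)
    + om (vec g) (vec x) - om (vec g) (A (vec g)) - om (vec x) (A (vec g))"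
proof -
  have v: "vec g \<in> int_vecs k" "vec x \<in> int_vecs k" "A (vec g) \<in> int_vecs k"
    using g x A_in by auto
  have "om (vec g + vec x) (- A (vec g)) = - om (vec g + vec x) (A (vec g))"
    by (rule additive_on_minus[OF om_additive(1)]) (use v in \<open>auto simp del: plus_fun_apply\<close>)
  also have "\<dots> = - om (vec g) (A (vec g)) - om (vec x) (A (vec g))"
    using om_add_left[OF v] by linarith
  finally show ?thesis
    using g x by (simp add: twist_def height_mult height_inv vec_mult vec_inv vec_psi height_psi algebra_simps
      del: plus_fun_apply)
qed

text \<open>These are the twists that preserve \<open>vec x\<close>. As A fixes
  \<open>vec g\<close>, the form vanishes on the pair of \<open>vec g\<close> and its image, and by
  antisymmetry the remaining two terms agree, whence the factor 2.\<close>

lemma height_twist_fixed: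
  assumes g: "g \<in> carrier G" and x: "x \<in> carrier G" and D: "D (vec g) = 0"
  shows "height (twist g x) = height x + (1 - eps) * height g - f (vec g) + 2 * om (vec g) (vec x)"
proof -
  have A: "A (vec g) = vec g" using D by (simp add: D_def)
  show ?thesis
    using height_twist[OF g x] om_self[of "vec g"] om_antisym[of "vec g" "vec x"] g x by (simp add: A)
qed

end

section \<open>Word norms\<close>

context group
begin

definition word :: "'a list \<Rightarrow> 'a" where
  "word ws = foldr (\<otimes>) ws \<one>"

lemma word_simps [simp]: "word [] = \<one>" "word (w # ws) = w \<otimes> word ws"
  by (simp_all add: word_def)

lemma word_closed: "set ws \<subseteq> carrier G \<Longrightarrow> word ws \<in> carrier G"
  by (induction ws) auto

lemma word_append: "set us \<subseteq> carrier G \<Longrightarrow> set ws \<subseteq> carrier G \<Longrightarrow> word (us @ ws) = word us \<otimes> word ws"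
  by (induction us) (auto simp: word_closed m_assoc)

end

locale fin_gen_group = group G for G :: "('a, 'b) monoid_scheme" (structure) +
  fixes S :: "'a set"
  assumes gen: "finite_generating_set G S"
begin

definition letters :: "'a set" where "letters = S \<union> m_inv G ` S"

lemma letters: "finite letters" "letters \<subseteq> carrier G" "w \<in> letters \<Longrightarrow> inv w \<in> letters"
  using gen by (auto simp: letters_def finite_generating_set_def)

lemma word_norm_eq: "word_norm G S g = (LEAST n. \<exists>ws. length ws = n \<and> set ws \<subseteq> letters \<and> word ws = g)"
  by (simp add: word_norm_def letters_def word_def)

lemma ex_word:
  assumes "g \<in> carrier G" shows "\<exists>ws. set ws \<subseteq> letters \<and> word ws = g"
proof -
  have "g \<in> generate G S" using assms gen by (simp add: finite_generating_set_def)
  then show ?thesis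
  proof (induction rule: generate.induct)
    case one
    show ?case by (intro exI[of _ "[]"]) simp
  next
    case (incl h)
    then have "h \<in> carrier G" using gen by (auto simp: finite_generating_set_def)
    then show ?case using incl by (intro exI[of _ "[h]"]) (simp add: letters_def)
  next
    case (inv h)
    then have "h \<in> carrier G" using gen by (auto simp: finite_generating_set_def)
    then show ?case using inv by (intro exI[of _ "[inv h]"]) (simp add: letters_def)
  next
    case (eng h1 h2)
    then obtain us ws where "set us \<subseteq> letters" "word us = h1" "set ws \<subseteq> letters" "word ws = h2" by blast
    then show ?case using word_append[of us ws] letters(2) by (intro exI[of _ "us @ ws"]) auto
  qed
qed

lemma word_norm_word:
  assumes "g \<in> carrier G"
  obtains ws where "length ws = word_norm G S g" "set ws \<subseteq> letters" "word ws = g"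
proof -
  have "\<exists>n ws. length ws = n \<and> set ws \<subseteq> letters \<and> word ws = g" using ex_word[OF assms] by blast
  then have "\<exists>ws. length ws = word_norm G S g \<and> set ws \<subseteq> letters \<and> word ws = g"
    unfolding word_norm_eq by (rule LeastI_ex)
  then show ?thesis using that by blast
qed

lemma word_norm_le: "set ws \<subseteq> letters \<Longrightarrow> word_norm G S (word ws) \<le> length ws"
  unfolding word_norm_eq by (rule Least_le) blast

lemma word_norm_one [simp]: "word_norm G S \<one> = 0"
  using word_norm_le[of "[]"] by simp

lemma word_norm_mult:
  assumes "g \<in> carrier G" "h \<in> carrier G"
  shows "word_norm G S (g \<otimes> h) \<le> word_norm G S g + word_norm G S h"
proof -
  obtain us where us: "length us = word_norm G S g" "set us \<subseteq> letters" "word us = g" using word_norm_word[OF assms(1)] .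
  obtain ws where ws: "length ws = word_norm G S h" "set ws \<subseteq> letters" "word ws = h" using word_norm_word[OF assms(2)] .
  show ?thesis using word_norm_le[of "us @ ws"] word_append[of us ws] us ws letters(2) by auto
qed

lemma word_norm_inv:
  assumes "g \<in> carrier G"
  shows "word_norm G S (inv g) \<le> word_norm G S g"
proof -
  obtain ws where ws: "length ws = word_norm G S g" "set ws \<subseteq> letters" "word ws = g" using word_norm_word[OF assms] .
  have "word (rev (map (m_inv G) us)) = inv (word us) \<and> set (rev (map (m_inv G) us)) \<subseteq> letters" if "set us \<subseteq> letters" for us
    using that
  proof (induction us)
    case (Cons u us)
    have c: "u \<in> carrier G" "set us \<subseteq> carrier G" "set (rev (map (m_inv G) us)) \<subseteq> carrier G"
      using Cons.prems Cons.IH letters(2) by auto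
    show ?case
      using Cons letters(3) c word_closed[OF c(2)] word_append[OF c(3), of "[inv u]"] by (auto simp: inv_mult_group)
  qed simp
  from this[OF ws(2)] show ?thesis using word_norm_le[of "rev (map (m_inv G) ws)"] ws by simp
qed

lemma word_norm_pow:
  assumes "g \<in> carrier G"
  shows "int (word_norm G S (g [^] (n::int))) \<le> \<bar>n\<bar> * int (word_norm G S g)"
proof -
  have nat: "word_norm G S (g [^] (m::nat)) \<le> m * word_norm G S g" for m
  proof (induction m)
    case (Suc m)
    then show ?case using word_norm_mult[of "g [^] m" g] assms by simp
  qed simp
  show ?thesis
  proof (cases n rule: int_cases2)
    case (nonneg m)
    then show ?thesis using nat[of m] by (simp only: int_pow_int of_nat_mult[symmetric] abs_of_nat of_nat_le_iff)
  next
    case (nonpos m)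
    then have "word_norm G S (g [^] n) \<le> m * word_norm G S g"
      using order_trans[OF word_norm_inv[of "g [^] m"] nat[of m]] assms by (simp add: int_pow_neg_int)
    then show ?thesis using nonpos by (simp only: abs_minus_cancel of_nat_mult[symmetric] abs_of_nat of_nat_le_iff)
  qed
qed

definition nball :: "nat \<Rightarrow> 'a set" where
  "nball n = {g \<in> carrier G. word_norm G S g \<le> n}"

text \<open>Required for every comparison of the cardinalities that define the growth function, as
  \<open>card\<close> of an infinite set is 0.\<close>

lemma finite_nball: "finite (nball n)"
proof -
  have "nball n \<subseteq> word ` {ws. set ws \<subseteq> letters \<and> length ws \<le> n}"
  proof
    fix g assume "g \<in> nball n"
    then have g: "g \<in> carrier G" "word_norm G S g \<le> n" by (auto simp: nball_def)
    obtain ws where "length ws = word_norm G S g" "set ws \<subseteq> letters" "word ws = g" using word_norm_word[OF g(1)] .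
    then show "g \<in> word ` {ws. set ws \<subseteq> letters \<and> length ws \<le> n}" using g(2) by auto
  qed
  then show ?thesis using finite_lists_length_le[OF letters(1)] finite_surj by blast
qed

end

section \<open>Sums of greatest common divisors over boxes\<close>

definition box :: "nat \<Rightarrow> nat \<Rightarrow> (nat \<Rightarrow> int) set" where
  "box p B = {x \<in> int_vecs p. \<forall>i<p. \<bar>x i\<bar> \<le> int B}"

lemma box_0: "box 0 B = {0}"
  by (auto simp: box_def)

lemma box_abs: "x \<in> box p B \<Longrightarrow> \<bar>x i\<bar> \<le> int B"
  by (cases "i < p") (auto simp: box_def int_vecs_def)

text \<open>Splits off the last coordinate; sums over boxes are then handled by induction on the
  dimension.\<close>

lemma box_bij: "bij_betw (\<lambda>(x, c). x(p := c)) (box p B \<times> {- int B..int B}) (box (Suc p) B)"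
  unfolding bij_betw_def
proof
  show "inj_on (\<lambda>(x, c). x(p := c)) (box p B \<times> {- int B..int B})"
  proof (rule inj_onI, clarify)
    fix x c y c' assume *: "x \<in> box p B" "y \<in> box p B" "x(p := c) = y(p := c')"
    have "x = y"
    proof (rule ext)
      fix i show "x i = y i"
        using *(1,2) fun_cong[OF *(3), of i] by (cases "i = p") (auto simp: box_def int_vecs_def)
    qed
    then show "x = y \<and> c = c'" using fun_cong[OF *(3), of p] by simp
  qed
  show "(\<lambda>(x, c). x(p := c)) ` (box p B \<times> {- int B..int B}) = box (Suc p) B"
  proof
    show "(\<lambda>(x, c). x(p := c)) ` (box p B \<times> {- int B..int B}) \<subseteq> box (Suc p) B"
      by (auto simp: box_def int_vecs_def less_Suc_eq)
    show "box (Suc p) B \<subseteq> (\<lambda>(x, c). x(p := c)) ` (box p B \<times> {- int B..int B})"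
    proof
      fix x assume x: "x \<in> box (Suc p) B"
      then have "x = (x(p := 0))(p := x p)" "x(p := 0) \<in> box p B" "x p \<in> {- int B..int B}"
        by (auto simp: box_def int_vecs_def abs_le_iff dest: spec[of _ p])
      then show "x \<in> (\<lambda>(x, c). x(p := c)) ` (box p B \<times> {- int B..int B})"
        by (intro image_eqI[of _ _ "(x(p := 0), x p)"]) auto
    qed
  qed
qed

lemma finite_box: "finite (box p B)"
proof (induction p)
  case (Suc p)
  then show ?case using bij_betw_finite[OF box_bij[of p B]] by simp
qed (simp add: box_0)

lemma sum_box_Suc:
  fixes F :: "(nat \<Rightarrow> int) \<Rightarrow> 'c::comm_monoid_add"
  shows "(\<Sum>x\<in>box (Suc p) B. F x) = (\<Sum>x\<in>box p B. \<Sum>c\<in>{- int B..int B}. F (x(p := c)))"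
  by (simp add: sum.reindex_bij_betw[OF box_bij, symmetric] sum.cartesian_product split_beta)

lemma card_symmetric_interval: "card {- int B..int B} = 2 * B + 1"
  by (simp add: nat_add_distrib nat_mult_distrib)

lemma card_box: "card (box p B) = (2 * B + 1) ^ p"
proof (induction p)
  case (Suc p)
  then show ?case using bij_betw_same_card[OF box_bij[of p B]] 
    by (simp only: card_cartesian_product card_symmetric_interval) (simp add: mult.commute)
qed (simp add: box_0)

text \<open>Each coordinate that the summand ignores contributes a factor 2B + 1. This separates the
  p - dd free directions from the \<open>dd\<close> directions in which the gcd varies.\<close>

lemma sum_box_trunc:
  fixes F :: "(nat \<Rightarrow> int) \<Rightarrow> real"
  assumes "d \<le> p"
  shows "(\<Sum>x\<in>box p B. F (trunc d x)) = real ((2 * B + 1) ^ (p - d)) * (\<Sum>y\<in>box d B. F y)"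
  using assms
proof (induction p rule: dec_induct)
  case base
  have "(\<Sum>x\<in>box d B. F (trunc d x)) = (\<Sum>x\<in>box d B. F x)"
    by (rule sum.cong) (auto simp: box_def trunc_id)
  then show ?case by simp
next
  case (step n)
  have t: "trunc d (x(n := c)) = trunc d x" for x c using step(1) by (auto simp: trunc_def fun_eq_iff)
  have "(\<Sum>x\<in>box (Suc n) B. F (trunc d x)) = real (2 * B + 1) * (\<Sum>x\<in>box n B. F (trunc d x))"
    unfolding sum_box_Suc t sum_constant card_symmetric_interval by (simp only: sum_distrib_left)
  then show ?case using step by (simp add: Suc_diff_le algebra_simps)
qed

text \<open>The index in \<int> of the subgroup generated by the coordinates, with 0 standing for
  infinite index; for d = 0 it is always 0.\<close>

definition vgcd :: "nat \<Rightarrow> (nat \<Rightarrow> int) \<Rightarrow> int" where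
  "vgcd d u = Gcd (u ` {..<d})"

lemma vgcd_Suc: "vgcd (Suc d) u = gcd (u d) (vgcd d u)"
  by (simp add: vgcd_def lessThan_Suc)

lemma vgcd_0 [simp]: "vgcd 0 u = 0"
  by (simp add: vgcd_def)

lemma vgcd_dvd: "j < d \<Longrightarrow> vgcd d u dvd u j"
  by (simp add: vgcd_def)

lemma vgcd_nonneg: "vgcd d u \<ge> 0"
  by (induction d) (simp_all add: vgcd_Suc)

lemma vgcd_eq_0: "vgcd d u = 0 \<longleftrightarrow> (\<forall>j<d. u j = 0)"
  by (induction d) (auto simp: vgcd_Suc less_Suc_eq)

lemma vgcd_bezout: "\<exists>c\<in>int_vecs d. vgcd d u = (\<Sum>j<d. c j * u j)"
proof (induction d)
  case (Suc d)
  then obtain c where c: "c \<in> int_vecs d" "vgcd d u = (\<Sum>j<d. c j * u j)" by blast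
  obtain s t where st: "s * u d + t * vgcd d u = gcd (u d) (vgcd d u)" using bezout_int by blast
  define c' where "c' = (\<lambda>j. if j < d then t * c j else if j = d then s else 0)"
  have "(\<Sum>j<Suc d. c' j * u j) = s * u d + t * (\<Sum>j<d. c j * u j)"
    by (simp add: c'_def sum_distrib_left mult.assoc)
  then have "vgcd (Suc d) u = (\<Sum>j<Suc d. c' j * u j)" using st c(2) by (simp add: vgcd_Suc)
  moreover have "c' \<in> int_vecs (Suc d)" by (simp add: c'_def int_vecs_def)
  ultimately show ?case by blast
qed simp

lemma vgcd_le:
  assumes "u \<in> box d B" "u \<noteq> 0"
  shows "1 \<le> vgcd d u" "vgcd d u \<le> int B"
proof -
  obtain j where j: "j < d" "u j \<noteq> 0" using assms int_vecs_eq_0I[of u d] by (auto simp: box_def)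
  have "vgcd d u \<noteq> 0" using j by (auto simp: vgcd_eq_0)
  then show "1 \<le> vgcd d u" using vgcd_nonneg[of d u] by linarith
  have "vgcd d u \<le> \<bar>u j\<bar>" using zdvd_imp_le[of "vgcd d u" "\<bar>u j\<bar>"] vgcd_dvd[OF j(1), of u] j(2) by simp
  then show "vgcd d u \<le> int B" using box_abs[OF assms(1), of j] by linarith
qed

lemma card_box_multiples:
  assumes "g \<ge> 1" "g \<le> B"
  shows "real (card {u \<in> box d B. \<forall>j<d. int g dvd u j}) \<le> (3 * real B / real g) ^ d"
proof -
  have "{u \<in> box d B. \<forall>j<d. int g dvd u j} \<subseteq> (\<lambda>w j. int g * w j) ` box d (B div g)"
  proof
    fix u assume u: "u \<in> {u \<in> box d B. \<forall>j<d. int g dvd u j}"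
    define w where "w j = u j div int g" for j
    have uw: "u = (\<lambda>j. int g * w j)"
    proof
      fix j show "u j = int g * w j"
        using u by (cases "j < d") (auto simp: w_def box_def int_vecs_def)
    qed
    have "\<bar>w j\<bar> \<le> int (B div g)" if "j < d" for j
    proof -
      have "int g * \<bar>w j\<bar> \<le> int B" using box_abs[of u d B j] u uw by (auto simp: abs_mult)
      then have "int g * \<bar>w j\<bar> div int g \<le> int B div int g" using assms(1) by (intro zdiv_mono1) auto
      then show ?thesis using assms(1) by (simp add: zdiv_int)
    qed
    moreover have "w \<in> int_vecs d" using u by (auto simp: w_def box_def int_vecs_def)
    ultimately show "u \<in> (\<lambda>w j. int g * w j) ` box d (B div g)" using uw by (auto simp: box_def)
  qed
  then have "card {u \<in> box d B. \<forall>j<d. int g dvd u j} \<le> (2 * (B div g) + 1) ^ d"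
    using surj_card_le[OF finite_box, of _ "\<lambda>w j. int g * w j" d "B div g"] card_box[of d "B div g"] by simp
  then have "real (card {u \<in> box d B. \<forall>j<d. int g dvd u j}) \<le> real ((2 * (B div g) + 1) ^ d)"
    by (simp only: of_nat_le_iff)
  also have "\<dots> \<le> (3 * real B / real g) ^ d"
  proof -
    \<comment> \<open>As g \<le> B the quotient is at least 1 and absorbs the summand 1; hence the
      constant 3.\<close>
    have "1 \<le> B div g" using assms by (simp add: Suc_le_eq div_greater_zero_iff)
    then have "2 * (B div g) + 1 \<le> 3 * (B div g)" by linarith
    then have "real (2 * (B div g) + 1) \<le> real (3 * (B div g))" by (simp only: of_nat_le_iff)
    also have "\<dots> \<le> 3 * real B / real g"
    proof -
      have "real g * real (B div g) \<le> real B" by (metis of_nat_le_iff of_nat_mult times_div_less_eq_dividend)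
      then show ?thesis using assms(1) by (simp add: field_simps)
    qed
    finally show ?thesis unfolding of_nat_power by (rule power_mono) simp
  qed
  finally show ?thesis .
qed

text \<open>The gcd is bounded by the sum of all common divisors up to \<open>B\<close>; after
  exchanging the sums one counts, for every \<open>g\<close>, the vectors divisible by
  \<open>g\<close>. The terms decay like g^(1 - d), which is what distinguishes d = 1, 2 and d \<ge>
  3.\<close>

lemma sum_vgcd_le:
  "(\<Sum>u\<in>box d B - {0}. real_of_int (vgcd d u)) \<le> (\<Sum>g=1..B. real g * (3 * real B / real g) ^ d)"
proof -
  have "(\<Sum>u\<in>box d B - {0}. real_of_int (vgcd d u))
    \<le> (\<Sum>u\<in>box d B - {0}. \<Sum>g\<in>{1..B}. if \<forall>j<d. int g dvd u j then real g else 0)"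
  proof (rule sum_mono)
    fix u assume u: "u \<in> box d B - {0}"
    define g where "g = nat (vgcd d u)"
    have g: "int g = vgcd d u" "g \<in> {1..B}" using vgcd_le[of u d B] u by (auto simp: g_def)
    then have "\<forall>j<d. int g dvd u j" using vgcd_dvd by simp
    then have "real_of_int (vgcd d u) = (if \<forall>j<d. int g dvd u j then real g else 0)" using g(1) by (metis of_int_of_nat_eq)
    also have "\<dots> \<le> (\<Sum>g\<in>{1..B}. if \<forall>j<d. int g dvd u j then real g else 0)"
      by (rule member_le_sum[OF g(2)]) auto
    finally show "real_of_int (vgcd d u) \<le> (\<Sum>g\<in>{1..B}. if \<forall>j<d. int g dvd u j then real g else 0)" .
  qed
  also have "\<dots> = (\<Sum>g\<in>{1..B}. \<Sum>u\<in>box d B - {0}. if \<forall>j<d. int g dvd u j then real g else 0)"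
    by (rule sum.swap)
  also have "\<dots> \<le> (\<Sum>g=1..B. real g * (3 * real B / real g) ^ d)"
  proof (rule sum_mono)
    fix g assume g: "g \<in> {1..B}"
    have "(\<Sum>u\<in>box d B - {0}. if \<forall>j<d. int g dvd u j then real g else 0)
      \<le> (\<Sum>u\<in>box d B. if \<forall>j<d. int g dvd u j then real g else 0)"
      by (rule sum_mono2) (auto simp: finite_box)
    also have "\<dots> = real g * real (card {u \<in> box d B. \<forall>j<d. int g dvd u j})"
      by (simp add: sum.If_cases finite_box Int_def)
    also have "\<dots> \<le> real g * (3 * real B / real g) ^ d"
      using card_box_multiples[of g B d] g by (intro mult_left_mono) auto
    finally show "(\<Sum>u\<in>box d B - {0}. if \<forall>j<d. int g dvd u j then real g else 0)
      \<le> real g * (3 * real B / real g) ^ d" .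
  qed
  finally show ?thesis .
qed

text \<open>The inequality ln x \<le> x - 1 at x = n / (n + 1) bounds each new term by an increment
  of the logarithm; the lower bound below uses the inverted quotient.\<close>

lemma harmonic_le: "n \<ge> 1 \<Longrightarrow> (\<Sum>g=1..n. 1 / real g) \<le> 1 + ln (real n)"
proof (induction n rule: dec_induct)
  case (step n)
  have n: "real n > 0" using step by simp
  have "ln (real n / real (Suc n)) \<le> real n / real (Suc n) - 1"
    by (rule ln_le_minus_one) (use n in auto)
  also have "\<dots> = - (1 / real (Suc n))" using n by (simp add: field_simps)
  finally have "1 / real (Suc n) \<le> ln (real (Suc n)) - ln (real n)" using n by (simp add: ln_div)
  then show ?case using step by simp
qed simp

lemma harmonic_ge: "ln (real (n + 1)) \<le> (\<Sum>j<n. 1 / real (j + 1))"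
proof (induction n)
  case (Suc n)
  have "ln (real (n + 2) / real (n + 1)) \<le> real (n + 2) / real (n + 1) - 1"
    by (rule ln_le_minus_one) auto
  also have "\<dots> = 1 / real (n + 1)" by (simp add: field_simps)
  finally have "ln (real (n + 2)) - ln (real (n + 1)) \<le> 1 / real (n + 1)" by (simp add: ln_div)
  then show ?case using Suc by (simp add: add.commute)
qed simp

text \<open>Telescoping: 1 / (e + 1)^2 is at most 1 / e - 1 / (e + 1).\<close>

lemma inverse_squares_le: "(\<Sum>e=Suc b..n. 1 / (real e)\<^sup>2) \<le> 1 / real b" if "b \<ge> 1"
proof (cases "b \<le> n")
  case True
  then have "(\<Sum>e=Suc b..n. 1 / (real e)\<^sup>2) \<le> 1 / real b - 1 / real n"
  proof (induction n rule: dec_induct)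
    case (step n)
    have n: "real n > 0" using step that by simp
    have "1 / (real (Suc n))\<^sup>2 \<le> 1 / (real n * real (Suc n))"
      using n by (intro divide_left_mono) (auto simp: power2_eq_square)
    also have "\<dots> = 1 / real n - 1 / real (Suc n)" using n by (simp add: field_simps)
    finally show ?case using step by simp
  qed simp
  moreover have "1 / real n \<ge> 0" by simp
  ultimately show ?thesis by linarith
qed simp

lemma sum_vgcd_1: "(\<Sum>u\<in>box 1 B - {0}. real_of_int (vgcd 1 u)) \<le> 3 * (real B)\<^sup>2"
proof -
  have "(\<Sum>g=1..B. real g * (3 * real B / real g) ^ 1) = (\<Sum>g=1..B. 3 * real B)"
    by (rule sum.cong) auto
  then show ?thesis using sum_vgcd_le[of 1 B] by (simp add: power2_eq_square)
qed

lemma sum_vgcd_2: "B \<ge> 1 \<Longrightarrow> (\<Sum>u\<in>box 2 B - {0}. real_of_int (vgcd 2 u)) \<le> 9 * (real B)\<^sup>2 * (1 + ln (real B))"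
proof -
  assume B: "B \<ge> 1"
  have "(\<Sum>g=1..B. real g * (3 * real B / real g) ^ 2) = 9 * (real B)\<^sup>2 * (\<Sum>g=1..B. 1 / real g)"
    unfolding sum_distrib_left by (rule sum.cong) (auto simp: power2_eq_square)
  also have "\<dots> \<le> 9 * (real B)\<^sup>2 * (1 + ln (real B))"
    using harmonic_le[OF B] by (intro mult_left_mono) auto
  finally show ?thesis using sum_vgcd_le[of 2 B] by linarith
qed

text \<open>The exponent 3 gives a convergent series; the factor 2 bounds the sum of the inverse
  squares.\<close>

lemma sum_vgcd_ge_3:
  assumes "d \<ge> 3"
  shows "(\<Sum>u\<in>box d B - {0}. real_of_int (vgcd d u)) \<le> 2 * (3 * real B) ^ d"
proof (cases "B \<ge> 1")
  case True
  have "(\<Sum>g=1..B. real g * (3 * real B / real g) ^ d) \<le> (\<Sum>g=1..B. (3 * real B) ^ d * (1 / (real g)\<^sup>2))"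
  proof (rule sum_mono)
    fix g assume g: "g \<in> {1..B}"
    have "real g * (3 * real B / real g) ^ d = (3 * real B) ^ d * (real g / real g ^ d)" by (simp add: power_divide)
    also have "real g / real g ^ d \<le> real g / real g ^ 3"
      using g assms by (intro divide_left_mono power_increasing) auto
    also have "real g / real g ^ 3 = 1 / (real g)\<^sup>2" using g by (simp add: power2_eq_square power3_eq_cube)
    finally show "real g * (3 * real B / real g) ^ d \<le> (3 * real B) ^ d * (1 / (real g)\<^sup>2)"
      by (simp add: mult_left_mono)
  qed
  also have "\<dots> = (3 * real B) ^ d * (1 + (\<Sum>g=Suc 1..B. 1 / (real g)\<^sup>2))"
    using True by (simp add: sum.atLeast_Suc_atMost sum_distrib_left distrib_left)
  also have "\<dots> \<le> (3 * real B) ^ d * 2"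
    using inverse_squares_le[of 1 B] by (intro mult_left_mono) auto
  finally show ?thesis using sum_vgcd_le[of d B] by linarith
next
  case False
  have "x = 0" if x: "x \<in> box d B" for x
  proof (rule ext)
    fix i show "x i = 0 i" using box_abs[OF x, of i] False by simp
  qed
  then have "box d B - {0} = {}" by blast
  then show ?thesis by (simp only: sum.empty) simp
qed

text \<open>The substitution u = 2y - \<mu> is injective into a larger box, so the sum is dominated
  by an unshifted one. At most one \<open>y\<close> gives the zero vector, so the cut-off value
  \<open>W\<close> is paid once.\<close>

lemma sum_shifted_le:
  fixes W :: real
  assumes W: "W \<ge> 0" and \<mu>: "\<And>j. j < d \<Longrightarrow> \<bar>\<mu> j\<bar> \<le> int m"
  shows "(\<Sum>y\<in>box d B. if vgcd d (\<lambda>j. 2 * y j - \<mu> j) = 0 then W else real_of_int (vgcd d (\<lambda>j. 2 * y j - \<mu> j)))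
    \<le> W + (\<Sum>u\<in>box d (2 * B + m) - {0}. real_of_int (vgcd d u))"
proof -
  define h where "h y = trunc d (\<lambda>j. 2 * y j - \<mu> j)" for y
  have vh: "vgcd d (\<lambda>j. 2 * y j - \<mu> j) = vgcd d (h y)" for y
    unfolding vgcd_def h_def trunc_def by (intro arg_cong[of _ _ Gcd] image_cong) auto
  have hb: "h y \<in> box d (2 * B + m)" if "y \<in> box d B" for y
  proof -
    have "\<bar>2 * y j - \<mu> j\<bar> \<le> int (2 * B + m)" if "j < d" for j
      using box_abs[OF \<open>y \<in> _\<close>, of j] \<mu>[OF that] by simp
    then show ?thesis by (simp add: box_def h_def trunc_def int_vecs_def)
  qed
  have h0: "vgcd d (h y) = 0 \<longleftrightarrow> h y = 0" if "y \<in> box d B" for y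
    using int_vecs_eq_0I[of "h y" d] hb[OF that] by (auto simp: vgcd_eq_0 box_def)
  have inj: "inj_on h (box d B)"
  proof (rule inj_onI)
    fix x y assume xy: "x \<in> box d B" "y \<in> box d B" "h x = h y"
    have "x j = y j" if "j < d" for j using fun_cong[OF xy(3), of j] that by (simp add: h_def trunc_def)
    then show "x = y" using xy(1,2) by (auto simp: box_def intro: int_vecs_eqI)
  qed
  let ?F = "\<lambda>u. if u = 0 then W else real_of_int (vgcd d u)"
  have "(\<Sum>y\<in>box d B. if vgcd d (\<lambda>j. 2 * y j - \<mu> j) = 0 then W else real_of_int (vgcd d (\<lambda>j. 2 * y j - \<mu> j)))
      = (\<Sum>y\<in>box d B. ?F (h y))"
    by (rule sum.cong) (auto simp: vh h0)
  also have "\<dots> = (\<Sum>u\<in>h ` box d B. ?F u)" using inj by (simp add: sum.reindex)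
  also have "\<dots> \<le> (\<Sum>u\<in>box d (2 * B + m). ?F u)"
    by (rule sum_mono2[OF finite_box]) (use hb W vgcd_nonneg in auto)
  also have "\<dots> = W + (\<Sum>u\<in>box d (2 * B + m) - {0}. ?F u)"
    by (subst sum.remove[of _ 0, OF finite_box]) (auto simp: box_def)
  also have "(\<Sum>u\<in>box d (2 * B + m) - {0}. ?F u) = (\<Sum>u\<in>box d (2 * B + m) - {0}. real_of_int (vgcd d u))"
    by (rule sum.cong) auto
  finally show ?thesis .
qed

lemma sum_abs_ge:
  fixes M b :: int
  assumes "M \<ge> 2" "n \<ge> 2 * nat \<bar>b\<bar> + 2"
  shows "(real n)\<^sup>2 / 4 \<le> (\<Sum>x\<in>{- int n..int n}. real_of_int \<bar>M * x - b\<bar>)"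
proof -
  \<comment> \<open>Only the upper half of the interval is used: there x \<ge> \<bar>b\<bar> and M x
    \<ge> 2x, so each term is at least x, hence at least n / 2.\<close>
  have "(real n)\<^sup>2 / 4 \<le> (real n / 2) * (real n / 2)" by (simp add: power2_eq_square)
  also have "\<dots> \<le> real (card {int (n div 2) + 1..int n}) * (real n / 2)"
    by (intro mult_right_mono) auto
  also have "\<dots> = (\<Sum>x\<in>{int (n div 2) + 1..int n}. real n / 2)" by simp
  also have "\<dots> \<le> (\<Sum>x\<in>{int (n div 2) + 1..int n}. real_of_int \<bar>M * x - b\<bar>)"
  proof (rule sum_mono)
    fix x assume "x \<in> {int (n div 2) + 1..int n}"
    then have x: "2 * x \<ge> int n" "x \<ge> \<bar>b\<bar>" using assms(2) by auto
    define z where "z = \<bar>M * x - b\<bar>"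
    have "2 * x \<le> M * x" using assms(1) x by (intro mult_right_mono) auto
    then have "x \<le> z" using x unfolding z_def by linarith
    then show "real n / 2 \<le> real_of_int \<bar>M * x - b\<bar>" using x(1) unfolding z_def[symmetric] by linarith
  qed
  also have "\<dots> \<le> (\<Sum>x\<in>{- int n..int n}. real_of_int \<bar>M * x - b\<bar>)"
    by (rule sum_mono2) auto
  finally show ?thesis .
qed


section \<open>Lower bounds for gcd sums in residue classes\<close>

definition residues_upto :: "nat \<Rightarrow> nat \<Rightarrow> nat \<Rightarrow> nat set" where
  "residues_upto M r n = {u \<in> {1..n}. u mod M = r mod M}"

lemma card_residues_upto:
  assumes "M \<ge> 1"
  shows "n div M \<le> card (residues_upto M r n)"
proof -
  \<comment> \<open>One element from each complete block of length \<open>M\<close>. The range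
    starts at 1, so the class of 0 is represented by the end of the block.\<close>
  define h where "h j = (if r mod M = 0 then M * (j + 1) else M * j + r mod M)" for j
  have r: "r mod M < M" using assms by simp
  have "h ` {..<n div M} \<subseteq> residues_upto M r n"
  proof
    fix u assume "u \<in> h ` {..<n div M}"
    then obtain j where j: "j < n div M" "u = h j" by blast
    then have "M * (j + 1) \<le> M * (n div M)" by (intro mult_le_mono2) simp
    then have "M * (j + 1) \<le> n" using times_div_less_eq_dividend[of M n] by linarith
    then have "M * j + M \<le> n" by simp
    then show "u \<in> residues_upto M r n"
      using j(2) r by (auto simp: residues_upto_def h_def)
  qed
  moreover have "inj_on h {..<n div M}" using assms by (auto simp: inj_on_def h_def)
  moreover have "finite (residues_upto M r n)" by (simp add: residues_upto_def)
  ultimately show ?thesis using card_mono[of "residues_upto M r n" "h ` {..<n div M}"] by (simp add: card_image)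
qed

text \<open>A bound \<open>K\<close> instead of coprimality, since \<open>r\<close>,
  \<open>s\<close> and \<open>M\<close> may have a common factor and then the two classes contain no
  coprime pair.\<close>

definition bounded_gcd_pairs :: "nat \<Rightarrow> nat \<Rightarrow> nat \<Rightarrow> nat \<Rightarrow> nat \<Rightarrow> (nat \<times> nat) set" where
  "bounded_gcd_pairs M r s K n =
     {(u, v). u \<in> residues_upto M r n \<and> v \<in> residues_upto M s n \<and> gcd u v \<le> K}"

lemma finite_bounded_gcd_pairs: "finite (bounded_gcd_pairs M r s K n)"
  by (rule finite_subset[of _ "{1..n} \<times> {1..n}"]) (auto simp: bounded_gcd_pairs_def residues_upto_def)

text \<open>A sieve bound: at most \<open>(n/e)\<^sup>2\<close> pairs have greatest common divisor \<open>e\<close>, and these sum to less than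
  \<open>n\<^sup>2/K\<close> over \<open>e > K\<close>.\<close>

lemma card_bounded_gcd_pairs:
  assumes M: "M \<ge> 1" and n: "n \<ge> 2 * M"
  shows "(real n)\<^sup>2 / (8 * (real M)\<^sup>2) \<le> real (card (bounded_gcd_pairs M r s (8 * M\<^sup>2) n))"
proof -
  \<comment> \<open>About (n / (2M))^2 = n^2 / (4 M^2) pairs lie in the two classes; with this
    \<open>K\<close> the sieved part is at most half of that.\<close>
  define K where "K = 8 * M\<^sup>2"
  define R where "R = residues_upto M r n \<times> residues_upto M s n"
  have K: "K \<ge> 1" using M by (simp add: K_def)
  define E where "E e = (\<lambda>(u, v). (e * u, e * v)) ` ({1..n div e} \<times> {1..n div e})" for e :: nat
  have cE: "card (E e) \<le> (n div e)\<^sup>2" for e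
    unfolding E_def using card_image_le[of "{1..n div e} \<times> {1..n div e}"]
    by (simp add: card_cartesian_product power2_eq_square)
  have "R \<subseteq> bounded_gcd_pairs M r s K n \<union> (\<Union>e\<in>{Suc K..n}. E e)"
  proof
    fix z assume "z \<in> R"
    then obtain u v where z: "z = (u, v)" "u \<in> residues_upto M r n" "v \<in> residues_upto M s n" by (auto simp: R_def)
    then have uv: "1 \<le> u" "u \<le> n" "1 \<le> v" "v \<le> n" by (auto simp: residues_upto_def)
    show "z \<in> bounded_gcd_pairs M r s K n \<union> (\<Union>e\<in>{Suc K..n}. E e)"
    proof (cases "gcd u v \<le> K")
      case True
      then show ?thesis using z by (simp add: bounded_gcd_pairs_def)
    next
      case False
      define e where "e = gcd u v"
      have "gcd u v \<le> u" "gcd u v \<le> v" using uv by (auto intro!: gcd_le1_nat gcd_le2_nat)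
      note g = this
      have e: "e \<in> {Suc K..n}" using False uv g by (simp add: e_def)
      have "u = e * (u div e)" "v = e * (v div e)" by (simp_all add: e_def)
      moreover have "u div e \<in> {1..n div e}" "v div e \<in> {1..n div e}"
        using uv e g by (auto simp: div_le_mono Suc_le_eq div_greater_zero_iff e_def)
      ultimately have "z \<in> E e" unfolding E_def z(1)
        by (intro image_eqI[of _ _ "(u div e, v div e)"]) auto
      then show ?thesis using e by blast
    qed
  qed
  then have "card R \<le> card (bounded_gcd_pairs M r s K n \<union> (\<Union>e\<in>{Suc K..n}. E e))"
    by (intro card_mono) (auto simp: E_def finite_bounded_gcd_pairs)
  also have "\<dots> \<le> card (bounded_gcd_pairs M r s K n) + card (\<Union>e\<in>{Suc K..n}. E e)"
    by (rule card_Un_le)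
  also have "card (\<Union>e\<in>{Suc K..n}. E e) \<le> (\<Sum>e\<in>{Suc K..n}. card (E e))"
    by (rule card_UN_le) simp
  also have "(\<Sum>e\<in>{Suc K..n}. card (E e)) \<le> (\<Sum>e\<in>{Suc K..n}. (n div e)\<^sup>2)"
    by (rule sum_mono) (rule cE)
  finally have "real (card R) \<le> real (card (bounded_gcd_pairs M r s K n) + (\<Sum>e\<in>{Suc K..n}. (n div e)\<^sup>2))"
    by (simp only: of_nat_le_iff)
  also have "\<dots> = real (card (bounded_gcd_pairs M r s K n)) + (\<Sum>e\<in>{Suc K..n}. (real (n div e))\<^sup>2)" by simp
  finally have 1: "real (card R) \<le> real (card (bounded_gcd_pairs M r s K n)) + (\<Sum>e\<in>{Suc K..n}. (real (n div e))\<^sup>2)" .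
  have "(\<Sum>e\<in>{Suc K..n}. (real (n div e))\<^sup>2) \<le> (\<Sum>e\<in>{Suc K..n}. (real n)\<^sup>2 * (1 / (real e)\<^sup>2))"
  proof (rule sum_mono)
    fix e assume "e \<in> {Suc K..n}"
    then have e: "real e > 0" by simp
    have "real e * real (n div e) \<le> real n" by (metis of_nat_le_iff of_nat_mult times_div_less_eq_dividend)
    then have "real (n div e) \<le> real n / real e" using e by (simp add: field_simps)
    then have "(real (n div e))\<^sup>2 \<le> (real n / real e)\<^sup>2" by (rule power_mono) simp
    then show "(real (n div e))\<^sup>2 \<le> (real n)\<^sup>2 * (1 / (real e)\<^sup>2)" by (simp add: power_divide)
  qed
  also have "\<dots> \<le> (real n)\<^sup>2 * (1 / real K)"
    unfolding sum_distrib_left[symmetric] by (intro mult_left_mono inverse_squares_le K) auto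
  finally have 2: "(\<Sum>e\<in>{Suc K..n}. (real (n div e))\<^sup>2) \<le> (real n)\<^sup>2 / (8 * (real M)\<^sup>2)" by (simp add: K_def)
  \<comment> \<open>Rounding down costs at most a factor 2 because n \<ge> 2M.\<close>
  have "real n / (2 * real M) \<le> real (n div M)"
  proof -
    have "n mod M < M" using M by simp
    then have "n < M * (n div M) + M" using mult_div_mod_eq[of M n] by linarith
    then have "real n < real (M * (n div M) + M)" by (simp only: of_nat_less_iff)
    moreover have "real (2 * M) \<le> real n" using n by (simp only: of_nat_le_iff)
    ultimately have "real n \<le> 2 * real M * real (n div M)" by simp
    then show ?thesis using M by (simp add: field_simps)
  qed
  then have "(real n / (2 * real M)) * (real n / (2 * real M)) \<le> real (n div M) * real (n div M)"
    by (intro mult_mono) auto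
  also have "\<dots> \<le> real (card (residues_upto M r n)) * real (card (residues_upto M s n))"
    by (intro mult_mono) (auto simp: card_residues_upto[OF M])
  also have "\<dots> = real (card R)" by (simp add: R_def card_cartesian_product)
  finally have 3: "(real n)\<^sup>2 / (4 * (real M)\<^sup>2) \<le> real (card R)" by (simp add: power2_eq_square)
  have "(real n)\<^sup>2 / (4 * (real M)\<^sup>2) = 2 * ((real n)\<^sup>2 / (8 * (real M)\<^sup>2))" by simp
  then show ?thesis using 1 2 3 unfolding K_def by linarith
qed

lemma divide_left_mono_pos: "(a::real) \<le> b \<Longrightarrow> 0 < a \<Longrightarrow> 1 / b \<le> 1 / a"
  by (simp add: frac_le)

text \<open>Pairs of bounded gcd up to n / d are multiplied by d = 1 + M j. Such \<open>d\<close>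
  are 1 modulo \<open>M\<close>, so the residue classes are kept, while the gcd becomes at least
  \<open>d\<close>. There are about (n / d)^2 such pairs, which contribute n^2 / d, and summing over
  \<open>j\<close> produces the logarithm; the bound on the gcd limits how often a pair is
  produced.\<close>

lemma sum_gcd_pairs_ge:
  assumes M: "M \<ge> 1" and n: "n \<ge> 4 * M ^ 4"
  shows "(real n)\<^sup>2 * ln (real n) / (512 * real M ^ 5)
    \<le> (\<Sum>(u, v)\<in>residues_upto M r n \<times> residues_upto M s n. real (gcd u v))"
proof -
  define K where "K = 8 * M\<^sup>2"
  \<comment> \<open>For j < J one has 2M d \<le> n with d = 1 + M j, so that the count of pairs of
    bounded gcd applies to \<open>n div d\<close>.\<close>
  define J where "J = n div (2 * M\<^sup>2)"
  define dj where "dj j = 1 + M * j" for j :: nat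
  define Z where "Z = (SIGMA j:{..<J}. bounded_gcd_pairs M r s K (n div dj j))"
  define h where "h = (\<lambda>(j, u, v). (dj j * u, dj j * v))"
  define R where "R = residues_upto M r n \<times> residues_upto M s n"
  have finR: "finite R" by (simp add: R_def residues_upto_def)
  note finP = finite_bounded_gcd_pairs
  have finZ: "finite Z" by (simp add: Z_def finP)
  have dj0: "dj j \<ge> 1" for j by (simp add: dj_def)
  have hR: "h ` Z \<subseteq> R"
  proof
    fix w assume "w \<in> h ` Z"
    then obtain j u v where z: "(j, u, v) \<in> Z" "w = (dj j * u, dj j * v)" by (auto simp: h_def)
    then have uv: "u \<in> residues_upto M r (n div dj j)" "v \<in> residues_upto M s (n div dj j)"
      by (auto simp: Z_def bounded_gcd_pairs_def)
    have "dj j * x \<in> residues_upto M t n" if "x \<in> residues_upto M t (n div dj j)" for x t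
    proof -
      have "dj j * x \<le> dj j * (n div dj j)" using that by (intro mult_le_mono2) (simp add: residues_upto_def)
      then have "dj j * x \<le> n" using times_div_less_eq_dividend[of "dj j" n] by linarith
      moreover have "(dj j * x) mod M = x mod M" by (simp add: dj_def add_mult_distrib mult.assoc)
      ultimately show ?thesis using that dj0[of j] by (simp add: residues_upto_def)
    qed
    then show "w \<in> R" using uv z(2) by (simp add: R_def)
  qed
  \<comment> \<open>The gcd of \<open>w\<close> is \<open>dj j\<close> times the gcd of the original
    pair. The latter lies in 1..K and determines \<open>dj j\<close>, then \<open>j\<close> and the
    pair, so \<open>w\<close> has at most \<open>K\<close> preimages, each of weight at most the gcd
    of \<open>w\<close>.\<close>
  have fiber: "(\<Sum>z\<in>{z\<in>Z. h z = w}. real (dj (fst z))) \<le> real K * real (gcd (fst w) (snd w))" if w: "w \<in> R" for w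
  proof -
    have w0: "gcd (fst w) (snd w) > 0" using w by (auto simp: R_def residues_upto_def)
    have gcd_w: "gcd (fst w) (snd w) = dj (fst z) * gcd (fst (snd z)) (snd (snd z))
        \<and> gcd (fst (snd z)) (snd (snd z)) \<in> {1..K}" if "z \<in> {z\<in>Z. h z = w}" for z
      using that by (auto simp: h_def Z_def bounded_gcd_pairs_def residues_upto_def gcd_mult_distrib_nat Suc_le_eq)
    have inj: "inj_on (\<lambda>z. gcd (fst (snd z)) (snd (snd z))) {z\<in>Z. h z = w}"
    proof (rule inj_onI)
      fix z z' assume zz: "z \<in> {z\<in>Z. h z = w}" "z' \<in> {z\<in>Z. h z = w}"
        "gcd (fst (snd z)) (snd (snd z)) = gcd (fst (snd z')) (snd (snd z'))"
      then have "dj (fst z) * gcd (fst (snd z)) (snd (snd z)) = dj (fst z') * gcd (fst (snd z)) (snd (snd z))"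
        using gcd_w[OF zz(1)] gcd_w[OF zz(2)] by metis
      moreover have "gcd (fst (snd z)) (snd (snd z)) \<noteq> 0" using gcd_w[OF zz(1)] by auto
      ultimately have d: "dj (fst z) = dj (fst z')" by (metis mult_cancel2)
      then have j: "fst z = fst z'" using M by (simp add: dj_def)
      have "h z = h z'" using zz(1,2) by simp
      then have "snd z = snd z'" using d dj0[of "fst z'"] by (cases z, cases z') (auto simp: h_def)
      then show "z = z'" using j by (simp add: prod_eq_iff)
    qed
    have "(\<lambda>z. gcd (fst (snd z)) (snd (snd z))) ` {z\<in>Z. h z = w} \<subseteq> {1..K}"
      by (rule image_subsetI) (rule conjunct2[OF gcd_w])
    then have "card {z\<in>Z. h z = w} \<le> card {1..K}" by (rule card_inj_on_le[OF inj]) simp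
    then have cK: "real (card {z\<in>Z. h z = w}) \<le> real K" by simp
    have "(\<Sum>z\<in>{z\<in>Z. h z = w}. real (dj (fst z))) \<le> (\<Sum>z\<in>{z\<in>Z. h z = w}. real (gcd (fst w) (snd w)))"
    proof (rule sum_mono)
      fix z assume "z \<in> {z\<in>Z. h z = w}"
      from conjunct1[OF gcd_w[OF this]] have "dj (fst z) dvd gcd (fst w) (snd w)" by (simp only: dvd_triv_left)
      then show "real (dj (fst z)) \<le> real (gcd (fst w) (snd w))" using w0 by (simp add: dvd_imp_le)
    qed
    also have "\<dots> \<le> real K * real (gcd (fst w) (snd w))" using cK by (simp add: mult_right_mono)
    finally show ?thesis .
  qed
  have up: "(\<Sum>z\<in>Z. real (dj (fst z))) \<le> real K * (\<Sum>w\<in>R. real (gcd (fst w) (snd w)))"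
  proof -
    have "(\<Sum>z\<in>Z. real (dj (fst z))) = (\<Sum>w\<in>R. \<Sum>z\<in>{z\<in>Z. h z = w}. real (dj (fst z)))"
      using sum.group[OF finZ finR hR, of "\<lambda>z. real (dj (fst z))"] by simp
    also have "\<dots> \<le> (\<Sum>w\<in>R. real K * real (gcd (fst w) (snd w)))" by (rule sum_mono) (rule fiber)
    finally show ?thesis by (simp add: sum_distrib_left)
  qed
  have M0: "real M > 0" using M by simp
  have low: "(\<Sum>j<J. (real n)\<^sup>2 / (32 * real M ^ 3) * (1 / real (j + 1))) \<le> (\<Sum>z\<in>Z. real (dj (fst z)))"
  proof -
    have "(\<Sum>z\<in>Z. real (dj (fst z))) = (\<Sum>j<J. \<Sum>p\<in>bounded_gcd_pairs M r s K (n div dj j). real (dj j))"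
      unfolding Z_def by (subst sum.Sigma) (auto simp: finP split_beta)
    also have "\<dots> = (\<Sum>j<J. real (dj j) * real (card (bounded_gcd_pairs M r s K (n div dj j))))"
      by (simp add: mult.commute)
    also have "\<dots> \<ge> (\<Sum>j<J. (real n)\<^sup>2 / (32 * real M ^ 3) * (1 / real (j + 1)))"
    proof (rule sum_mono)
      fix j assume "j \<in> {..<J}"
      then have j: "j + 1 \<le> n div (2 * M\<^sup>2)" by (simp add: J_def)
      have djM: "dj j \<le> M * (j + 1)" using M by (simp add: dj_def)
      have "2 * M\<^sup>2 * (j + 1) \<le> 2 * M\<^sup>2 * (n div (2 * M\<^sup>2))" using j by (rule mult_le_mono2)
      also have "\<dots> \<le> n" by (rule times_div_less_eq_dividend)
      finally have big: "2 * M * (M * (j + 1)) \<le> n" by (simp only: power2_eq_square mult.assoc)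
      then have "2 * M * dj j \<le> n" using djM mult_le_mono2[OF djM, of "2 * M"] by linarith
      then have m: "2 * M \<le> n div dj j" using dj0[of j] by (simp add: less_eq_div_iff_mult_less_eq)
      have d0: "real (dj j) > 0" using dj0[of j] by linarith
      have "n mod dj j < dj j" using dj0[of j] by simp
      then have "n < dj j * (n div dj j) + dj j" using mult_div_mod_eq[of "dj j" n] by linarith
      also have "\<dots> \<le> dj j * (n div dj j) + dj j * (n div dj j)"
        using m M by (intro add_left_mono) (simp add: Suc_le_eq)
      finally have "real n \<le> real (2 * (dj j * (n div dj j)))" by (simp only: of_nat_le_iff mult_2 less_imp_le)
      then have q: "real n / (2 * real (dj j)) \<le> real (n div dj j)" using d0 by (simp add: field_simps)
      have "(real n)\<^sup>2 / (32 * real M ^ 3) * (1 / real (j + 1))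
          = (real n)\<^sup>2 / (32 * (real M)\<^sup>2) * (1 / (real M * real (j + 1)))"
        by (simp add: power2_eq_square power3_eq_cube)
      also have "\<dots> \<le> (real n)\<^sup>2 / (32 * (real M)\<^sup>2) * (1 / real (dj j))"
      proof (rule mult_left_mono)
        have "real (dj j) \<le> real (M * (j + 1))" using djM by (simp only: of_nat_le_iff)
        then have "real (dj j) \<le> real M * real (j + 1)" by (simp only: of_nat_mult)
        then show "1 / (real M * real (j + 1)) \<le> 1 / real (dj j)"
          using d0 by (rule divide_left_mono_pos)
      qed simp
      also have "\<dots> = real (dj j) * ((real n / (2 * real (dj j)))\<^sup>2 / (8 * (real M)\<^sup>2))"
        using d0 by (simp add: power2_eq_square)
      also have "\<dots> \<le> real (dj j) * ((real (n div dj j))\<^sup>2 / (8 * (real M)\<^sup>2))"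
        using q by (intro mult_left_mono divide_right_mono power_mono) auto
      also have "\<dots> \<le> real (dj j) * real (card (bounded_gcd_pairs M r s K (n div dj j)))"
        unfolding K_def by (intro mult_left_mono card_bounded_gcd_pairs M m) simp
      finally show "(real n)\<^sup>2 / (32 * real M ^ 3) * (1 / real (j + 1))
        \<le> real (dj j) * real (card (bounded_gcd_pairs M r s K (n div dj j)))" .
    qed
    finally show ?thesis .
  qed
  have "real n \<ge> real (4 * M ^ 4)" using n by (simp only: of_nat_le_iff)
  then have n0: "real n \<ge> 4 * real M ^ 4" by simp
  have M4: "real M ^ 4 > 0" using M0 by simp
  then have n1: "real n > 0" using n0 by linarith
  \<comment> \<open>The hypothesis n \<ge> 4 M^4 forces J + 1 to exceed the square root of
    \<open>n\<close>, which costs half of the logarithm.\<close>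
  have lnJ: "ln (real n) / 2 \<le> (\<Sum>j<J. 1 / real (j + 1))"
  proof -
    have "n mod (2 * M\<^sup>2) < 2 * M\<^sup>2" using M by simp
    then have "n < 2 * M\<^sup>2 * (J + 1)" unfolding J_def
      using mult_div_mod_eq[of "2 * M\<^sup>2" n] by (simp only: distrib_left mult_1_right)
    then have "real n < real (2 * M\<^sup>2 * (J + 1))" by (simp only: of_nat_less_iff)
    then have J1: "real n < 2 * (real M)\<^sup>2 * real (J + 1)" by (simp add: distrib_left)
    have "sqrt (real n) * (2 * (real M)\<^sup>2) \<le> sqrt (real n) * sqrt (real n)"
    proof (rule mult_left_mono)
      have "(2 * (real M)\<^sup>2)\<^sup>2 = 4 * real M ^ 4" by (simp add: power2_eq_square power4_eq_xxxx)
      then show "2 * (real M)\<^sup>2 \<le> sqrt (real n)" using n0 by (intro real_le_rsqrt) simp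
    qed simp
    then have "(2 * (real M)\<^sup>2) * sqrt (real n) < (2 * (real M)\<^sup>2) * real (J + 1)" using J1 n1 by (simp add: mult.commute)
    then have "sqrt (real n) < real (J + 1)" using M0 by (simp add: mult_less_cancel_left)
    then have "ln (sqrt (real n)) \<le> ln (real (J + 1))" using n1 by (intro ln_mono) auto
    then show ?thesis using harmonic_ge[of J] n1 by (simp add: ln_sqrt)
  qed
  \<comment> \<open>The constants 32 M^3 from the weights, 2 from the square root and K = 8 M^2 from
    the multiplicity combine to 512 M^5.\<close>
  have "(real n)\<^sup>2 / (32 * real M ^ 3) * (ln (real n) / 2) \<le> (\<Sum>j<J. (real n)\<^sup>2 / (32 * real M ^ 3) * (1 / real (j + 1)))"
    unfolding sum_distrib_left[symmetric] using lnJ by (intro mult_left_mono) auto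
  also note low
  also note up
  finally have "(real n)\<^sup>2 / (32 * real M ^ 3) * (ln (real n) / 2) \<le> 8 * (real M)\<^sup>2 * (\<Sum>w\<in>R. real (gcd (fst w) (snd w)))"
    by (simp add: K_def)
  then have "(real n)\<^sup>2 * ln (real n) / (512 * real M ^ 5) \<le> (\<Sum>w\<in>R. real (gcd (fst w) (snd w)))"
    using M0 by (simp add: field_simps power2_eq_square power3_eq_cube eval_nat_numeral)
  then show ?thesis by (simp add: R_def split_beta)
qed


lemma sum_vgcd_1_lower:
  fixes N :: int and \<mu> :: "nat \<Rightarrow> int"
  assumes "N \<ge> 1" "n \<ge> 2 * nat \<bar>\<mu> 0\<bar> + 2"
  shows "(real n)\<^sup>2 / 4 \<le> (\<Sum>x\<in>box 1 n. real_of_int (vgcd 1 (\<lambda>j. 2 * (N * x j) - \<mu> j)))"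
proof -
  have v: "vgcd (Suc 0) u = \<bar>u 0\<bar>" for u using vgcd_Suc[of 0 u] by simp
  have "(\<Sum>x\<in>box (Suc 0) n. real_of_int (vgcd 1 (\<lambda>j. 2 * (N * x j) - \<mu> j)))
      = (\<Sum>c\<in>{- int n..int n}. real_of_int \<bar>2 * (N * c) - \<mu> 0\<bar>)"
    unfolding sum_box_Suc box_0 by (simp add: v)
  then show ?thesis using sum_abs_ge[of "2 * N" "\<mu> 0" n] assms by (simp add: mult.assoc)
qed

text \<open>Only those \<open>x\<close> are kept for which both coordinates of 2Nx - \<mu> lie in
  1..n. These values run through the residue classes of -\<mu> modulo 2N, so the bound for pairs in
  residue classes applies.\<close>

lemma sum_vgcd_2_lower:
  fixes N :: int and \<mu> :: "nat \<Rightarrow> int"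
  assumes N: "N \<ge> 1" and n: "n \<ge> nat \<bar>\<mu> 0\<bar>" "n \<ge> nat \<bar>\<mu> 1\<bar>" "n \<ge> 4 * (nat (2 * N)) ^ 4"
  shows "(real n)\<^sup>2 * ln (real n) / (512 * real (nat (2 * N)) ^ 5)
    \<le> (\<Sum>x\<in>box 2 n. real_of_int (vgcd 2 (\<lambda>j. 2 * (N * x j) - \<mu> j)))"
proof -
  define M where "M = nat (2 * N)"
  have M: "M \<ge> 1" "int M = 2 * N" using N by (auto simp: M_def)
  define r where "r j = nat ((- \<mu> j) mod int M)" for j
  \<comment> \<open>Solves 2Nx - \<mu> = u for one coordinate; the assumption that \<open>n\<close>
    dominates \<mu> keeps the solution in the box.\<close>
  define pre where "pre j u = (int u + \<mu> j) div int M" for j and u :: nat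
  have pre: "2 * (N * pre j u) - \<mu> j = int u \<and> \<bar>pre j u\<bar> \<le> int n"
    if u: "u \<in> residues_upto M (r j) n" and nj: "n \<ge> nat \<bar>\<mu> j\<bar>" for j u
  proof -
    have "int (u mod M) = int (r j mod M)" using u by (simp add: residues_upto_def)
    then have "int u mod int M = (- \<mu> j) mod int M" using M(1) by (simp add: r_def zmod_int)
    then have "int M dvd int u - (- \<mu> j)" by (simp only: mod_eq_dvd_iff)
    then have "int M dvd int u + \<mu> j" by simp
    then have e: "int M * pre j u = int u + \<mu> j" by (simp add: pre_def)
    have "int u \<le> int n" "\<bar>\<mu> j\<bar> \<le> int n" using u nj by (auto simp: residues_upto_def)
    then have "\<bar>int u + \<mu> j\<bar> \<le> 2 * int n" by linarith
    then have "2 * N * \<bar>pre j u\<bar> \<le> 2 * int n" using e M N by (simp add: abs_mult[symmetric] mult.assoc abs_mult)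
    moreover have "2 * \<bar>pre j u\<bar> \<le> 2 * N * \<bar>pre j u\<bar>" using N by (intro mult_right_mono) auto
    ultimately show ?thesis using e M by (simp add: mult.assoc)
  qed
  define h where "h = (\<lambda>(u, v) (j::nat). if j = 0 then pre 0 u else if j = 1 then pre 1 v else 0)"
  define R where "R = residues_upto M (r 0) n \<times> residues_upto M (r 1) n"
  have h01: "2 * (N * h z 0) - \<mu> 0 = int (fst z)" "2 * (N * h z 1) - \<mu> 1 = int (snd z)"
    and hbox: "h z \<in> box 2 n" if "z \<in> R" for z
  proof -
    obtain u v where z: "z = (u, v)" "u \<in> residues_upto M (r 0) n" "v \<in> residues_upto M (r 1) n"
      using \<open>z \<in> R\<close> by (auto simp: R_def)
    note P = pre[OF z(2) n(1)] pre[OF z(3) n(2)]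
    show "2 * (N * h z 0) - \<mu> 0 = int (fst z)" "2 * (N * h z 1) - \<mu> 1 = int (snd z)"
      using P z(1) by (auto simp: h_def)
    show "h z \<in> box 2 n" using P z(1) by (auto simp: h_def box_def int_vecs_def)
  qed
  have inj: "inj_on h R"
  proof (rule inj_onI)
    fix z z' assume "z \<in> R" "z' \<in> R" "h z = h z'"
    then have "int (fst z) = int (fst z')" "int (snd z) = int (snd z')" using h01[of z] h01[of z'] by auto
    then show "z = z'" by (simp add: prod_eq_iff)
  qed
  have v2: "vgcd 2 u = gcd (u 1) (u 0)" for u
    using vgcd_Suc[of 1 u] vgcd_Suc[of 0 u] by (simp add: numeral_2_eq_2)
  have "(real n)\<^sup>2 * ln (real n) / (512 * real M ^ 5) \<le> (\<Sum>(u, v)\<in>R. real (gcd u v))"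
    using sum_gcd_pairs_ge[OF M(1) n(3)[folded M_def]] by (simp add: R_def)
  also have "\<dots> = (\<Sum>z\<in>R. real_of_int (vgcd 2 (\<lambda>j. 2 * (N * h z j) - \<mu> j)))"
  proof (rule sum.cong[OF refl])
    fix z assume z: "z \<in> R"
    have "vgcd 2 (\<lambda>j. 2 * (N * h z j) - \<mu> j) = gcd (int (snd z)) (int (fst z))"
      unfolding v2 h01[OF z] ..
    also have "\<dots> = int (gcd (fst z) (snd z))" by (simp add: gcd.commute)
    finally show "(case z of (u, v) \<Rightarrow> real (gcd u v)) = real_of_int (vgcd 2 (\<lambda>j. 2 * (N * h z j) - \<mu> j))"
      by (simp add: split_beta)
  qed
  also have "\<dots> = (\<Sum>x\<in>h ` R. real_of_int (vgcd 2 (\<lambda>j. 2 * (N * x j) - \<mu> j)))"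
    using inj by (simp add: sum.reindex)
  also have "\<dots> \<le> (\<Sum>x\<in>box 2 n. real_of_int (vgcd 2 (\<lambda>j. 2 * (N * x j) - \<mu> j)))"
    by (rule sum_mono2[OF finite_box]) (use hbox vgcd_nonneg in auto)
  finally show ?thesis by (simp add: M_def)
qed

section \<open>Counting twisted conjugacy classes\<close>

lemma additive_on_int_bounded:
  fixes f :: "(nat \<Rightarrow> int) \<Rightarrow> int"
  assumes "additive_on k f" "x \<in> int_vecs k" "\<And>i. \<bar>x i\<bar> \<le> B"
  shows "\<bar>f x\<bar> \<le> (\<Sum>i<k. \<bar>f (unit_vec i)\<bar>) * B"
proof -
  have "\<bar>f x\<bar> \<le> (\<Sum>i<k. \<bar>x i * f (unit_vec i)\<bar>)"
    unfolding additive_on_expand[OF assms(1,2)] by (rule sum_abs)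
  also have "\<dots> \<le> (\<Sum>i<k. B * \<bar>f (unit_vec i)\<bar>)"
    by (rule sum_mono) (simp add: abs_mult mult_right_mono assms(3))
  also have "\<dots> = (\<Sum>i<k. \<bar>f (unit_vec i)\<bar>) * B" by (simp add: sum_distrib_left mult.commute)
  finally show ?thesis .
qed

context heisenberg
begin

lemma om_bounded:
  assumes "x \<in> int_vecs k" "y \<in> int_vecs k" "\<And>i. \<bar>x i\<bar> \<le> B" "\<And>i. \<bar>y i\<bar> \<le> B'"
  shows "\<bar>om x y\<bar> \<le> (\<Sum>i<k. \<Sum>j<k. \<bar>om (unit_vec i) (unit_vec j)\<bar>) * (B * B')"
proof -
  have B: "B \<ge> 0" using assms(3)[of 0] by linarith
  have "\<bar>om x y\<bar> \<le> (\<Sum>i<k. \<bar>om (unit_vec i) y\<bar>) * B"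
    by (rule additive_on_int_bounded[OF om_additive(2)[OF assms(2)] assms(1,3)])
  also have "\<dots> \<le> (\<Sum>i<k. (\<Sum>j<k. \<bar>om (unit_vec i) (unit_vec j)\<bar>) * B') * B"
    by (intro mult_right_mono B sum_mono additive_on_int_bounded om_additive(1) assms(2,4)) auto
  also have "\<dots> = (\<Sum>i<k. \<Sum>j<k. \<bar>om (unit_vec i) (unit_vec j)\<bar>) * (B * B')"
    by (simp only: sum_distrib_right[symmetric] mult.assoc mult.commute[of B B'])
  finally show ?thesis .
qed

end

locale heis_count = heisenberg_aut G \<iota> k a \<psi> + fin_gen_group G S
  for G :: "('a, 'b) monoid_scheme" (structure) and \<iota> k a \<psi> S
begin

text \<open>A letter changes \<open>vec\<close> by a bounded amount and the height by a bounded
  amount plus the form on the letter and the remaining word, which is linear in the length; hence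
  linear and quadratic bounds.\<close>

lemma ball_bounds:
  obtains C :: nat where "\<And>n g i. g \<in> nball n \<Longrightarrow> \<bar>vec g i\<bar> \<le> int (C * n)"
    "\<And>n g. g \<in> nball n \<Longrightarrow> \<bar>height g\<bar> \<le> int (C * n\<^sup>2)"
proof -
  define B where "B = (\<Sum>w\<in>letters. \<bar>height w\<bar> + (\<Sum>i<k. \<bar>vec w i\<bar>))"
  define Ob where "Ob = (\<Sum>i<k. \<Sum>j<k. \<bar>om (unit_vec i) (unit_vec j)\<bar>)"
  have Ob0: "Ob \<ge> 0" unfolding Ob_def by (intro sum_nonneg) auto
  have B0: "B \<ge> 0" unfolding B_def by (intro sum_nonneg add_nonneg_nonneg) auto
  have Bw: "\<bar>height w\<bar> + (\<Sum>i<k. \<bar>vec w i\<bar>) \<le> B" if "w \<in> letters" for w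
    unfolding B_def by (rule member_le_sum[OF that]) (auto simp: letters(1) intro!: add_nonneg_nonneg sum_nonneg)
  have Bh: "\<bar>height w\<bar> \<le> B" if "w \<in> letters" for w
  proof -
    have "0 \<le> (\<Sum>i<k. \<bar>vec w i\<bar>)" by (rule sum_nonneg) simp
    then show ?thesis using Bw[OF that] by linarith
  qed
  have Bv: "\<bar>vec w i\<bar> \<le> B" if w: "w \<in> letters" for w i
  proof (cases "i < k")
    case True
    have "\<bar>vec w i\<bar> \<le> (\<Sum>i<k. \<bar>vec w i\<bar>)" by (rule member_le_sum) (use True in auto)
    then show ?thesis using Bw[OF w] by linarith
  next
    case False
    then show ?thesis using B0 int_vecsD[OF vec_in, of w i] w letters(2) by auto
  qed
  have word_bounds: "(\<forall>i. \<bar>vec (word ws) i\<bar> \<le> B * int (length ws)) \<and>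
      \<bar>height (word ws)\<bar> \<le> (B + Ob * B * B) * (int (length ws))\<^sup>2"
    if "set ws \<subseteq> letters" for ws
    using that
  proof (induction ws)
    case Nil
    show ?case by simp
  next
    case (Cons w ws)
    let ?l = "int (length ws)"
    have w: "w \<in> letters" "w \<in> carrier G" and ws: "set ws \<subseteq> letters" "word ws \<in> carrier G"
      using Cons.prems letters(2) word_closed[of ws] by auto
    have IH: "\<bar>vec (word ws) i\<bar> \<le> B * ?l" "\<bar>height (word ws)\<bar> \<le> (B + Ob * B * B) * ?l\<^sup>2" for i
      using Cons.IH[OF ws(1)] by auto
    have 1: "\<bar>vec (word (w # ws)) i\<bar> \<le> B * int (length (w # ws))" for i
      using IH(1)[of i] Bv[OF w(1), of i] w ws by (simp add: vec_mult algebra_simps)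
    have "\<bar>om (vec w) (vec (word ws))\<bar> \<le> Ob * (B * (B * ?l))"
      unfolding Ob_def using om_bounded[of "vec w" "vec (word ws)" B "B * ?l"] Bv[OF w(1)] IH(1) w ws by simp
    then have "\<bar>height (word (w # ws))\<bar> \<le> B + (B + Ob * B * B) * ?l\<^sup>2 + Ob * (B * (B * ?l))"
      using Bh[OF w(1)] IH(2) w ws by (simp add: height_mult)
    also have "\<dots> \<le> (B + Ob * B * B) * (?l + 1)\<^sup>2"
    proof -
      have "(B + Ob * B * B) * (?l + 1)\<^sup>2 - (B + (B + Ob * B * B) * ?l\<^sup>2 + Ob * (B * (B * ?l)))
          = Ob * B * B + 2 * B * ?l + Ob * B * B * ?l"
        by (simp add: power2_eq_square algebra_simps)
      also have "\<dots> \<ge> 0" using Ob0 B0 by (intro add_nonneg_nonneg mult_nonneg_nonneg) auto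
      finally show ?thesis by linarith
    qed
    finally show ?case using 1 by (simp add: add.commute)
  qed
  define C where "C = nat (B + Ob * B * B)"
  have OB: "Ob * B * B \<ge> 0" using Ob0 B0 by simp
  have C: "int C = B + Ob * B * B" "B \<le> int C" using OB B0 by (auto simp: C_def)
  have nb: "\<exists>ws. set ws \<subseteq> letters \<and> word ws = g \<and> int (length ws) \<le> int n" if "g \<in> nball n" for g n
  proof -
    have "g \<in> carrier G" "word_norm G S g \<le> n" using that by (auto simp: nball_def)
    then show ?thesis using word_norm_word[of g] by (metis of_nat_le_iff)
  qed
  show ?thesis
  proof
    fix n g i assume "g \<in> nball n"
    then obtain ws where ws: "set ws \<subseteq> letters" "word ws = g" "int (length ws) \<le> int n" using nb by blast
    have "\<bar>vec g i\<bar> \<le> B * int (length ws)" using word_bounds[OF ws(1)] ws(2) by blast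
    also have "\<dots> \<le> int C * int n" using ws(3) C B0 by (intro mult_mono) auto
    finally show "\<bar>vec g i\<bar> \<le> int (C * n)" by simp
  next
    fix n g assume "g \<in> nball n"
    then obtain ws where ws: "set ws \<subseteq> letters" "word ws = g" "int (length ws) \<le> int n" using nb by blast
    have "\<bar>height g\<bar> \<le> int C * (int (length ws))\<^sup>2" using word_bounds[OF ws(1)] ws(2) C(1) by metis
    also have "\<dots> \<le> int C * (int n)\<^sup>2" using ws(3) by (intro mult_left_mono power_mono) auto
    finally show "\<bar>height g\<bar> \<le> int (C * n\<^sup>2)" by simp
  qed
qed

lemma twisted_growth_eq: "twisted_growth G S \<psi> n = card (twisted_class G \<psi> ` nball n)"
  by (simp add: twisted_growth_def nball_def)

lemma twisted_growth_mono: "m \<le> n \<Longrightarrow> twisted_growth G S \<psi> m \<le> twisted_growth G S \<psi> n"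
  unfolding twisted_growth_eq by (intro card_mono image_mono finite_imageI finite_nball) (auto simp: nball_def)

text \<open>The height of a lift can be altered by even numbers, so that 0 or 1 is attained. This
  keeps the term with 1 - eps bounded when twisting by lifts.\<close>

lemma lift_small:
  assumes "w \<in> int_vecs k"
  shows "\<exists>h\<in>carrier G. vec h = w \<and> 0 \<le> height h \<and> height h \<le> 1"
proof -
  let ?h = "lift w \<otimes> zeta (- (height (lift w) div 2))"
  have "?h \<in> carrier G" "vec ?h = w" using lift[OF assms] vec_mult_zeta by auto
  moreover have "height ?h = height (lift w) mod 2"
    using height_mult_zeta[OF lift(1)[OF assms]] by (simp add: minus_mult_div_eq_mod)
  ultimately show ?thesis by (intro bexI[of _ ?h]) auto
qed

lemma class_period:
  assumes per: "\<And>x. x \<in> carrier G \<Longrightarrow> vec x = v \<Longrightarrow> \<exists>h\<in>carrier G. twist h x = x \<otimes> zeta q"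
    and x: "x \<in> carrier G" "vec x = v"
  shows "twisted_class G \<psi> (x \<otimes> zeta (m * q)) = twisted_class G \<psi> x"
proof -
  have step: "twisted_class G \<psi> (y \<otimes> zeta q) = twisted_class G \<psi> y" if "y \<in> carrier G" "vec y = v" for y
    using twisted_class_eq_iff[of y "y \<otimes> zeta q"] per[OF that] that by simp
  have nat: "twisted_class G \<psi> (y \<otimes> zeta (int n * q)) = twisted_class G \<psi> y" if y: "y \<in> carrier G" "vec y = v" for y n
  proof (induction n)
    case 0
    then show ?case using y by (simp add: zeta_0)
  next
    case (Suc n)
    have "y \<otimes> zeta (int (Suc n) * q) = (y \<otimes> zeta (int n * q)) \<otimes> zeta q"
      using y by (simp add: m_assoc zeta_mult algebra_simps)
    then show ?case using step[of "y \<otimes> zeta (int n * q)"] Suc y by (simp add: vec_mult_zeta)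
  qed
  show ?thesis
  proof (cases m rule: int_cases2)
    case (nonneg n)
    then show ?thesis using nat[OF x] by simp
  next
    case (nonpos n)
    have "x = (x \<otimes> zeta (m * q)) \<otimes> zeta (int n * q)"
      using x nonpos by (simp add: m_assoc zeta_mult zeta_0)
    then show ?thesis using nat[of "x \<otimes> zeta (m * q)" n] x by (simp add: vec_mult_zeta)
  qed
qed

end

text \<open>Up to finite groups, \<open>\<Lambda>\<close> identifies the cokernel of \<open>D\<close> with \<open>\<int>\<^sup>p\<close>: its cokernel is killed by \<open>N\<close> and
  its kernel modulo the image of \<open>D\<close> by \<open>M\<close>.\<close>

locale heis_coords = heis_count G \<iota> k a \<psi> S
  for G :: "('a, 'b) monoid_scheme" (structure) and \<iota> k a \<psi> S +
  fixes p :: nat and \<Lambda> g :: "(nat \<Rightarrow> int) \<Rightarrow> (nat \<Rightarrow> int)" and t :: "nat \<Rightarrow> (nat \<Rightarrow> int)" and N M :: int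
  assumes L_add: "additive_on k \<Lambda>" and L_in: "\<Lambda> v \<in> int_vecs p"
    and L_D: "v \<in> int_vecs k \<Longrightarrow> \<Lambda> (D v) = 0"
    and N_pos: "N > 0" and t: "i < p \<Longrightarrow> t i \<in> int_vecs k" "i < p \<Longrightarrow> \<Lambda> (t i) = (\<lambda>j. N * unit_vec i j)"
    and M_pos: "M > 0" and g_add: "additive_on k g" and g_in: "u \<in> int_vecs k \<Longrightarrow> g u \<in> int_vecs k"
    and g_D: "u \<in> int_vecs k \<Longrightarrow> \<Lambda> u = 0 \<Longrightarrow> D (g u) = (\<lambda>j. M * u j)"
begin

text \<open>Twisting moves \<open>vec\<close> by an element of the image of \<open>D\<close>, so
  \<open>\<Lambda>\<close> is an invariant of twisted classes.\<close>

lemma L_class: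
  assumes "x \<in> carrier G" "y \<in> carrier G" "twisted_class G \<psi> x = twisted_class G \<psi> y"
  shows "\<Lambda> (vec x) = \<Lambda> (vec y)"
proof -
  obtain h where h: "h \<in> carrier G" "twist h x = y" using twisted_class_eq_iff[OF assms(1,2)] assms(3) by blast
  then have "vec y = vec x - D (vec h)" using vec_twist[OF h(1) assms(1)] by simp
  then have "\<Lambda> (vec y) = \<Lambda> (vec x) - \<Lambda> (D (vec h))"
    using additive_on_diff[OF L_add vec_in[OF assms(1)] D_in[OF vec_in[OF h(1)]]] by simp
  then show ?thesis using L_D[OF vec_in[OF h(1)]] by simp
qed

text \<open>By the congruences the difference of the two vectors is M u, and
  \<open>\<Lambda> u = 0\<close> because \<int>^p is torsion free; hence the difference is
  \<open>D (g u)\<close>. Since \<open>g u\<close> is of size O(n), twisting by a lift of it alters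
  the height by O(n^2) only.\<close>

lemma small_twist:
  "\<exists>C::nat. \<forall>n\<ge>1. \<forall>x\<in>nball n. \<forall>x'\<in>nball n. \<Lambda> (vec x) = \<Lambda> (vec x') \<longrightarrow>
    (\<forall>i<k. vec x i mod M = vec x' i mod M) \<longrightarrow>
    (\<exists>h\<in>carrier G. \<exists>\<tau>. twist h x = x' \<otimes> zeta \<tau> \<and> \<bar>\<tau>\<bar> \<le> int (C * n\<^sup>2))"
proof -
  obtain C0 where C0: "\<And>n g i. g \<in> nball n \<Longrightarrow> \<bar>vec g i\<bar> \<le> int (C0 * n)"
    "\<And>n g. g \<in> nball n \<Longrightarrow> \<bar>height g\<bar> \<le> int (C0 * n\<^sup>2)" using ball_bounds by metis
  obtain Cg where Cg: "Cg \<ge> 1" "\<And>x B j. x \<in> int_vecs k \<Longrightarrow> (\<And>i. \<bar>x i\<bar> \<le> B) \<Longrightarrow> j < k \<Longrightarrow> \<bar>g x j\<bar> \<le> int Cg * B"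
    using additive_on_bounded[OF g_add, where m = k] by metis
  define CF where "CF = (\<Sum>i<k. \<bar>f (unit_vec i)\<bar>)"
  define Ob where "Ob = (\<Sum>i<k. \<Sum>j<k. \<bar>om (unit_vec i) (unit_vec j)\<bar>)"
  have Ob0: "Ob \<ge> 0" unfolding Ob_def by (intro sum_nonneg) auto
  have CF0: "CF \<ge> 0" unfolding CF_def by (intro sum_nonneg) auto
  \<comment> \<open>\<open>W\<close> bounds the coordinates of \<open>g u\<close> and of the given
    vectors per unit of \<open>n\<close>; \<open>E\<close> adds the bounds of all terms in the
    height of the twisted element.\<close>
  define W where "W = int (2 * Cg * C0 + C0)"
  define E where "E = int C0 + 2 + CF * W + 3 * (Ob * (3 * W * W)) + int C0"
  have W0: "W \<ge> 0" by (simp add: W_def)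
  have E0: "E \<ge> 0" unfolding E_def using Ob0 CF0 W0 by (intro add_nonneg_nonneg mult_nonneg_nonneg) auto
  have main: "\<exists>h\<in>carrier G. \<exists>\<tau>. twist h x = x' \<otimes> zeta \<tau> \<and> \<bar>\<tau>\<bar> \<le> int (nat E * n\<^sup>2)"
    if n1: "n \<ge> 1" and x: "x \<in> nball n" "x' \<in> nball n" and L: "\<Lambda> (vec x) = \<Lambda> (vec x')"
      and md: "\<And>i. i < k \<Longrightarrow> vec x i mod M = vec x' i mod M" for n :: nat and x x'
  proof -
    have c: "x \<in> carrier G" "x' \<in> carrier G" using x by (auto simp: nball_def)
    note v = vec_in[OF c(1)] vec_in[OF c(2)]
    define u where "u i = (vec x i - vec x' i) div M" for i
    have Mu: "M * u i = vec x i - vec x' i" for i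
    proof (cases "i < k")
      case True
      then have "M dvd vec x i - vec x' i" using md[OF True] by (simp add: mod_eq_dvd_iff)
      then show ?thesis by (simp add: u_def)
    next
      case False
      then show ?thesis using v by (simp add: u_def int_vecs_def)
    qed
    have u: "u \<in> int_vecs k" using v by (simp add: u_def int_vecs_def)
    have Mu': "(\<lambda>i. M * u i) = vec x - vec x'" using Mu by (intro ext) simp
    have "(\<lambda>i. M * \<Lambda> u i) = \<Lambda> (vec x - vec x')"
      using additive_on_scale_vec[OF L_add u, of M] unfolding Mu' by simp
    also have "\<dots> = 0" using additive_on_diff[OF L_add v] L by simp
    finally have sc: "(\<lambda>i. M * \<Lambda> u i) = 0" .
    have "\<Lambda> u = 0"
    proof (rule ext)
      fix i show "\<Lambda> u i = 0 i" using fun_cong[OF sc, of i] M_pos by simp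
    qed
    then have D: "D (g u) = vec x - vec x'" using g_D[OF u] Mu' by simp
    have n2: "int n \<le> (int n)\<^sup>2" "1 \<le> (int n)\<^sup>2"
      using n1 mult_mono[of 1 "int n" 1 "int n"] by (auto simp: power2_eq_square)
    have ub: "\<bar>u i\<bar> \<le> 2 * int (C0 * n)" for i
    proof -
      have "\<bar>u i\<bar> \<le> M * \<bar>u i\<bar>" using M_pos mult_right_mono[of 1 M "\<bar>u i\<bar>"] by simp
      also have "\<dots> = \<bar>M * u i\<bar>" using M_pos by (simp add: abs_mult)
      also have "\<dots> = \<bar>vec x i - vec x' i\<bar>" unfolding Mu ..
      finally show ?thesis using C0(1)[OF x(1), of i] C0(1)[OF x(2), of i] by linarith
    qed
    have gW: "\<bar>g u i\<bar> \<le> W * int n" for i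
    proof (cases "i < k")
      case True
      then have "\<bar>g u i\<bar> \<le> int Cg * (2 * int (C0 * n))" using Cg(2)[OF u ub True] by simp
      also have "\<dots> \<le> W * int n" by (simp add: W_def algebra_simps)
      finally show ?thesis .
    next
      case False
      then show ?thesis using int_vecsD[OF g_in[OF u], of i] W0 by simp
    qed
    have vW: "\<bar>vec x i\<bar> \<le> W * int n" for i
    proof -
      have "int C0 * int n \<le> W * int n" by (intro mult_right_mono) (auto simp: W_def)
      then show ?thesis using C0(1)[OF x(1), of i] by simp
    qed
    have AW: "\<bar>A (g u) i\<bar> \<le> 3 * W * int n" for i
    proof -
      have "A (g u) = g u + (vec x - vec x')" using D by (simp add: D_def algebra_simps)
      then have "A (g u) i = g u i + (vec x i - vec x' i)" by simp
      moreover have "\<bar>vec x' i\<bar> \<le> W * int n"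
      proof -
        have "int C0 * int n \<le> W * int n" by (intro mult_right_mono) (auto simp: W_def)
        then show ?thesis using C0(1)[OF x(2), of i] by simp
      qed
      ultimately show ?thesis using gW[of i] vW[of i] by linarith
    qed
    have W3: "W * int n \<le> 3 * W * int n" using W0 by simp
    have gk: "g u \<in> int_vecs k" by (rule g_in[OF u])
    have Ak: "A (g u) \<in> int_vecs k" by (rule A_in[OF gk])
    have e: "Ob * ((W * int n) * (3 * W * int n)) = (Ob * (3 * W * W)) * (int n)\<^sup>2"
      by (simp add: power2_eq_square)
    have o1: "\<bar>om (g u) (vec x)\<bar> \<le> (Ob * (3 * W * W)) * (int n)\<^sup>2"
      using om_bounded[OF gk v(1) gW order_trans[OF vW W3]] unfolding Ob_def[symmetric] e .
    have o2: "\<bar>om (g u) (A (g u))\<bar> \<le> (Ob * (3 * W * W)) * (int n)\<^sup>2"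
      using om_bounded[OF gk Ak gW AW] unfolding Ob_def[symmetric] e .
    have o3: "\<bar>om (vec x) (A (g u))\<bar> \<le> (Ob * (3 * W * W)) * (int n)\<^sup>2"
      using om_bounded[OF v(1) Ak vW AW] unfolding Ob_def[symmetric] e .
    obtain h where h: "h \<in> carrier G" "vec h = g u" "0 \<le> height h" "height h \<le> 1" using lift_small[OF gk] by blast
    have vt: "vec (twist h x) = vec x'" using vec_twist[OF h(1) c(1)] h(2) D by simp
    obtain \<tau> where \<tau>: "twist h x = x' \<otimes> zeta \<tau>" using vec_eq_iff[of "twist h x" x'] vt c h by auto
    have fW: "\<bar>f (g u)\<bar> \<le> CF * W * (int n)\<^sup>2"
    proof -
      have "\<bar>f (g u)\<bar> \<le> CF * (W * int n)" unfolding CF_def by (rule additive_on_int_bounded[OF f_additive gk gW])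
      also have "\<dots> \<le> CF * (W * (int n)\<^sup>2)" using CF0 W0 n2 by (intro mult_left_mono) auto
      finally show ?thesis by (simp add: mult.assoc)
    qed
    have eh: "\<bar>(1 - eps) * height h\<bar> \<le> 2 * (int n)\<^sup>2"
    proof -
      have "\<bar>(1 - eps) * height h\<bar> \<le> 2" using eps_cases h(3,4) by auto
      then show ?thesis using n2 by linarith
    qed
    have hx: "\<bar>height x\<bar> \<le> int C0 * (int n)\<^sup>2" "\<bar>height x'\<bar> \<le> int C0 * (int n)\<^sup>2"
      using C0(2)[OF x(1)] C0(2)[OF x(2)] by auto
    have "2 * \<tau> = height (twist h x) - height x'" using height_mult_zeta[OF c(2), of \<tau>] \<tau> by simp
    then have "\<bar>2 * \<tau>\<bar> \<le> \<bar>height x\<bar> + \<bar>(1 - eps) * height h\<bar> + \<bar>f (g u)\<bar> + \<bar>om (g u) (vec x)\<bar>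
        + \<bar>om (g u) (A (g u))\<bar> + \<bar>om (vec x) (A (g u))\<bar> + \<bar>height x'\<bar>"
      unfolding height_twist[OF h(1) c(1)] h(2) by linarith
    also have "\<dots> \<le> int C0 * (int n)\<^sup>2 + 2 * (int n)\<^sup>2 + CF * W * (int n)\<^sup>2 + (Ob * (3 * W * W)) * (int n)\<^sup>2
        + (Ob * (3 * W * W)) * (int n)\<^sup>2 + (Ob * (3 * W * W)) * (int n)\<^sup>2 + int C0 * (int n)\<^sup>2"
      using hx eh fW o1 o2 o3 by (intro add_mono)
    also have "\<dots> = E * (int n)\<^sup>2" by (simp add: E_def algebra_simps)
    finally have "\<bar>\<tau>\<bar> \<le> E * (int n)\<^sup>2" by linarith
    then have "\<bar>\<tau>\<bar> \<le> int (nat E * n\<^sup>2)" using E0 by simp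
    then show ?thesis using \<tau> h(1) by blast
  qed
  show ?thesis by (intro exI[of _ "nat E"] allI ballI impI) (rule main, auto)
qed


text \<open>A class meeting the ball is determined by the value of \<open>\<Lambda>\<close>, the residues of the coordinates modulo \<open>M\<close>
  and a position along the centre, which is only relevant modulo the period \<open>per\<close>.\<close>

lemma twisted_growth_upper:
  fixes per :: "(nat \<Rightarrow> int) \<Rightarrow> nat"
  assumes per: "\<forall>x\<in>carrier G. \<exists>h\<in>carrier G. twist h x = x \<otimes> zeta (int (per (\<Lambda> (vec x))))"
  shows "\<exists>C::nat. C \<ge> 1 \<and> (\<forall>n\<ge>1. real (twisted_growth G S \<psi> n)
    \<le> real C * (\<Sum>\<nu>\<in>box p (C * n). if per \<nu> = 0 then (real n)\<^sup>2 else real (per \<nu>)))"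
proof -
  obtain C0 where C0: "\<And>n g i. g \<in> nball n \<Longrightarrow> \<bar>vec g i\<bar> \<le> int (C0 * n)" using ball_bounds by metis
  obtain CL where CL: "CL \<ge> 1"
    "\<And>x B j. x \<in> int_vecs k \<Longrightarrow> (\<And>i. \<bar>x i\<bar> \<le> B) \<Longrightarrow> j < p \<Longrightarrow> \<bar>\<Lambda> x j\<bar> \<le> int CL * B"
    using additive_on_bounded[OF L_add, where m = p] by metis
  obtain CT :: nat where CT: "\<forall>n\<ge>1. \<forall>x\<in>nball n. \<forall>x'\<in>nball n. \<Lambda> (vec x) = \<Lambda> (vec x') \<longrightarrow>
    (\<forall>i<k. vec x i mod M = vec x' i mod M) \<longrightarrow>
    (\<exists>h\<in>carrier G. \<exists>\<tau>. twist h x = x' \<otimes> zeta \<tau> \<and> \<bar>\<tau>\<bar> \<le> int (CT * n\<^sup>2))"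
    using small_twist by blast
  define m where "m = nat M"
  \<comment> \<open>The first summand makes the box contain all values of \<open>\<Lambda>\<close>
    on the ball; the second counts residues and central positions.\<close>
  define C where "C = CL * C0 + m ^ k * (2 * CT + 1) + 1"
  have bound: "real (twisted_growth G S \<psi> n)
    \<le> real C * (\<Sum>\<nu>\<in>box p (C * n). if per \<nu> = 0 then (real n)\<^sup>2 else real (per \<nu>))" if n: "n \<ge> 1" for n
  proof -
    define key where "key x = (\<Lambda> (vec x), restrict (\<lambda>i. vec x i mod M) {..<k})" for x
    define Keys where "Keys = key ` nball n"
    define rep where "rep c = (SOME x. x \<in> nball n \<and> key x = c)" for c
    have rep: "rep c \<in> nball n" "key (rep c) = c" if "c \<in> Keys" for c
    proof -
      have "\<exists>x. x \<in> nball n \<and> key x = c" using that by (auto simp: Keys_def)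
      then have "rep c \<in> nball n \<and> key (rep c) = c" unfolding rep_def by (rule someI_ex)
      then show "rep c \<in> nball n" "key (rep c) = c" by auto
    qed
    \<comment> \<open>Period 0 means that no reduction is available; then the quadratic bound on
      \<tau> is the cut-off.\<close>
    define T where "T \<nu> = (if per \<nu> = 0 then {- int (CT * n\<^sup>2)..int (CT * n\<^sup>2)} else {0..<int (per \<nu>)})" for \<nu>
    have finT: "finite (T \<nu>)" for \<nu> by (simp add: T_def)
    have Keys_sub: "Keys \<subseteq> box p (C * n) \<times> ({..<k} \<rightarrow>\<^sub>E {0..<M})"
    proof
      fix c assume "c \<in> Keys"
      then obtain x where x: "x \<in> nball n" "c = key x" by (auto simp: Keys_def)
      have xc: "x \<in> carrier G" using x by (simp add: nball_def)
      have "\<bar>\<Lambda> (vec x) j\<bar> \<le> int (C * n)" if "j < p" for j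
      proof -
        have "\<bar>\<Lambda> (vec x) j\<bar> \<le> int CL * int (C0 * n)" using CL(2)[OF vec_in[OF xc] C0[OF x(1)] that] .
        also have "\<dots> \<le> int (C * n)" by (simp add: C_def algebra_simps)
        finally show ?thesis .
      qed
      then show "c \<in> box p (C * n) \<times> ({..<k} \<rightarrow>\<^sub>E {0..<M})"
        using L_in M_pos by (simp add: x(2) key_def box_def)
    qed
    have finP: "finite ({..<k} \<rightarrow>\<^sub>E {0..<M})" by (rule finite_PiE) auto
    have finK: "finite Keys" by (rule finite_subset[OF Keys_sub finite_cartesian_product[OF finite_box finP]])
    have sub: "twisted_class G \<psi> ` nball n \<subseteq> (\<Union>c\<in>Keys. (\<lambda>\<tau>. twisted_class G \<psi> (rep c \<otimes> zeta \<tau>)) ` T (fst c))"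
    proof
      fix P assume "P \<in> twisted_class G \<psi> ` nball n"
      then obtain x where x: "x \<in> nball n" "P = twisted_class G \<psi> x" by blast
      define x' where "x' = rep (key x)"
      have kx: "key x \<in> Keys" using x by (simp add: Keys_def)
      have x': "x' \<in> nball n" "key x' = key x" using rep[OF kx] by (auto simp: x'_def)
      have c: "x \<in> carrier G" "x' \<in> carrier G" using x x' by (auto simp: nball_def)
      have L: "\<Lambda> (vec x) = \<Lambda> (vec x')" using x'(2) by (simp add: key_def)
      have "\<forall>i<k. vec x i mod M = vec x' i mod M"
      proof (intro allI impI)
        fix i assume i: "i < k"
        have "restrict (\<lambda>i. vec x' i mod M) {..<k} = restrict (\<lambda>i. vec x i mod M) {..<k}"
          using x'(2) by (simp add: key_def)
        from fun_cong[OF this, of i] i show "vec x i mod M = vec x' i mod M" by simp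
      qed
      with CT n x(1) x'(1) L obtain h \<tau> where h: "h \<in> carrier G" "twist h x = x' \<otimes> zeta \<tau>"
        "\<bar>\<tau>\<bar> \<le> int (CT * n\<^sup>2)" by blast
      have P1: "P = twisted_class G \<psi> (x' \<otimes> zeta \<tau>)"
        using twisted_class_eq_iff[OF c(1), of "x' \<otimes> zeta \<tau>"] h c x(2) by auto
      let ?q = "per (\<Lambda> (vec x'))"
      have fk: "fst (key x) = \<Lambda> (vec x')" using L by (simp add: key_def)
      have "\<exists>\<tau>'\<in>T (fst (key x)). P = twisted_class G \<psi> (x' \<otimes> zeta \<tau>')"
      proof (cases "?q = 0")
        case True
        then have "\<tau> \<in> T (fst (key x))" using h(3) unfolding fk T_def by (simp add: abs_le_iff)
        then show ?thesis using P1 by blast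
      next
        case False
        have pv: "\<exists>h\<in>carrier G. twist h y = y \<otimes> zeta (int ?q)" if "y \<in> carrier G" "vec y = vec x'" for y
          using bspec[OF per that(1)] that(2) by simp
        \<comment> \<open>The period depends on \<open>x\<close> only through
          \<open>\<Lambda> (vec x)\<close>, which central factors do not change, so \<tau> may be
          replaced by its remainder.\<close>
        define y where "y = x' \<otimes> zeta (\<tau> mod int ?q)"
        have y: "y \<in> carrier G" "vec y = vec x'" using c(2) by (auto simp: y_def vec_mult_zeta)
        have "x' \<otimes> zeta \<tau> = y \<otimes> zeta (\<tau> div int ?q * int ?q)"
          using c(2) by (simp add: y_def m_assoc zeta_mult)
        then have "P = twisted_class G \<psi> y" using P1 class_period[OF pv y] by simp
        moreover have "\<tau> mod int ?q \<in> T (fst (key x))" unfolding fk T_def using False by simp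
        ultimately show ?thesis unfolding y_def by blast
      qed
      then have "P \<in> (\<lambda>\<tau>. twisted_class G \<psi> (rep (key x) \<otimes> zeta \<tau>)) ` T (fst (key x))"
        unfolding x'_def by blast
      then show "P \<in> (\<Union>c\<in>Keys. (\<lambda>\<tau>. twisted_class G \<psi> (rep c \<otimes> zeta \<tau>)) ` T (fst c))"
        by (rule UN_I[OF kx])
    qed
    have "twisted_growth G S \<psi> n \<le> card (\<Union>c\<in>Keys. (\<lambda>\<tau>. twisted_class G \<psi> (rep c \<otimes> zeta \<tau>)) ` T (fst c))"
      unfolding twisted_growth_eq by (rule card_mono[OF _ sub]) (use finK finT in auto)
    also have "\<dots> \<le> (\<Sum>c\<in>Keys. card ((\<lambda>\<tau>. twisted_class G \<psi> (rep c \<otimes> zeta \<tau>)) ` T (fst c)))"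
      by (rule card_UN_le[OF finK])
    also have "\<dots> \<le> (\<Sum>c\<in>Keys. card (T (fst c)))" by (rule sum_mono) (rule card_image_le[OF finT])
    also have "\<dots> \<le> (\<Sum>c\<in>box p (C * n) \<times> ({..<k} \<rightarrow>\<^sub>E {0..<M}). card (T (fst c)))"
      by (rule sum_mono2[OF _ Keys_sub]) (use finite_box finP in auto)
    also have "\<dots> = (\<Sum>\<nu>\<in>box p (C * n). \<Sum>_\<in>({..<k} \<rightarrow>\<^sub>E {0..<M}). card (T \<nu>))"
      by (simp only: sum.cartesian_product case_prod_unfold)
    also have "\<dots> = (\<Sum>\<nu>\<in>box p (C * n). m ^ k * card (T \<nu>))"
      by (simp add: card_PiE m_def)
    finally have "real (twisted_growth G S \<psi> n) \<le> real (\<Sum>\<nu>\<in>box p (C * n). m ^ k * card (T \<nu>))"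
      by (simp only: of_nat_le_iff)
    also have "\<dots> = (\<Sum>\<nu>\<in>box p (C * n). real (m ^ k * card (T \<nu>)))" by (rule of_nat_sum)
    also have "\<dots> \<le> (\<Sum>\<nu>\<in>box p (C * n). real C * (if per \<nu> = 0 then (real n)\<^sup>2 else real (per \<nu>)))"
    proof (rule sum_mono)
      fix \<nu>
      have "card (T \<nu>) \<le> (2 * CT + 1) * (if per \<nu> = 0 then n\<^sup>2 else per \<nu>)"
      proof (cases "per \<nu> = 0")
        case True
        have "1 \<le> n\<^sup>2" using n by simp
        then have "2 * (CT * n\<^sup>2) + 1 \<le> (2 * CT + 1) * n\<^sup>2" by (simp add: algebra_simps)
        moreover have "T \<nu> = {- int (CT * n\<^sup>2)..int (CT * n\<^sup>2)}" using True by (simp add: T_def)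
        then have "card (T \<nu>) = 2 * (CT * n\<^sup>2) + 1" by (simp only: card_symmetric_interval)
        ultimately show ?thesis using True by simp
      qed (simp add: T_def)
      then have "m ^ k * card (T \<nu>) \<le> m ^ k * ((2 * CT + 1) * (if per \<nu> = 0 then n\<^sup>2 else per \<nu>))"
        by (rule mult_le_mono2)
      also have "\<dots> \<le> C * (if per \<nu> = 0 then n\<^sup>2 else per \<nu>)"
        unfolding mult.assoc[symmetric] by (intro mult_le_mono1) (simp add: C_def)
      finally have "real (m ^ k * card (T \<nu>)) \<le> real (C * (if per \<nu> = 0 then n\<^sup>2 else per \<nu>))"
        by (simp only: of_nat_le_iff)
      then show "real (m ^ k * card (T \<nu>)) \<le> real C * (if per \<nu> = 0 then (real n)\<^sup>2 else real (per \<nu>))"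
        by (cases "per \<nu> = 0") (simp_all del: of_nat_mult add: of_nat_mult[of C])
    qed
    finally show ?thesis by (simp add: sum_distrib_left)
  qed
  moreover have "C \<ge> 1" by (simp add: C_def)
  ultimately show ?thesis by blast
qed

text \<open>A section of \<open>\<Lambda>\<close> up to the factor \<open>N\<close>; it supplies the
  representatives for lower bounds.\<close>

definition comb :: "(nat \<Rightarrow> int) \<Rightarrow> (nat \<Rightarrow> int)" where
  "comb x = (\<lambda>l. \<Sum>i<p. x i * t i l)"

lemma comb_in: "comb x \<in> int_vecs k"
  using t(1) by (auto simp: comb_def int_vecs_def)

lemma comb_additive: "additive_on p comb"
  by (simp add: additive_on_def comb_def fun_eq_iff distrib_right sum.distrib)

lemma comb_unit: assumes "i < p" shows "comb (unit_vec i) = t i"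
proof (rule ext)
  fix l
  have "comb (unit_vec i) l = (\<Sum>j<p. if j = i then t i l else 0)"
    unfolding comb_def by (rule sum.cong) (auto simp: unit_vec_def)
  then show "comb (unit_vec i) l = t i l" using assms by simp
qed

lemma L_comb: assumes "x \<in> int_vecs p" shows "\<Lambda> (comb x) = (\<lambda>j. N * x j)"
proof (rule int_vecs_eqI[OF L_in int_vecs_closed(5)[OF assms]])
  fix j assume j: "j < p"
  have "\<Lambda> (comb x) j = (\<Sum>i<p. x i * \<Lambda> (comb (unit_vec i)) j)"
    by (rule additive_on_expand_vec[OF additive_on_comp[OF L_add comb_additive comb_in] assms])
  also have "\<dots> = (\<Sum>i<p. if i = j then N * x j else 0)"
  proof (rule sum.cong)
    fix i assume "i \<in> {..<p}"
    then have "\<Lambda> (comb (unit_vec i)) j = N * unit_vec i j" using comb_unit t(2) by simp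
    then show "x i * \<Lambda> (comb (unit_vec i)) j = (if i = j then N * x j else 0)" by (simp add: unit_vec_def)
  qed simp
  finally show "\<Lambda> (comb x) j = N * x j" using j by simp
qed

text \<open>Different \<open>x\<close> are separated by the invariant \<open>\<Lambda>\<close>,
  which takes the value N x; what remains is to separate central translates over one
  \<open>x\<close>.\<close>

lemma twisted_growth_lower:
  assumes J: "\<And>x j. x \<in> box p n \<Longrightarrow> j < J x \<Longrightarrow> word_norm G S (sig k (comb x) \<otimes> zeta (int j)) \<le> m"
    and dist: "\<And>x j j'. x \<in> box p n \<Longrightarrow> j < J x \<Longrightarrow> j' < J x \<Longrightarrow>
      twisted_class G \<psi> (sig k (comb x) \<otimes> zeta (int j)) = twisted_class G \<psi> (sig k (comb x) \<otimes> zeta (int j')) \<Longrightarrow> j = j'"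
  shows "(\<Sum>x\<in>box p n. J x) \<le> twisted_growth G S \<psi> m"
proof -
  define e where "e = (\<lambda>(x, j). sig k (comb x) \<otimes> zeta (int j))"
  define Z where "Z = (SIGMA x:box p n. {..<J x})"
  have ec: "e z \<in> carrier G" for z using sig_closed by (simp add: e_def split_beta)
  have ev: "vec (e z) = comb (fst z)" for z
    using sig_closed vec_sig trunc_id[OF comb_in] by (simp add: e_def split_beta vec_mult_zeta)
  have "inj_on (\<lambda>z. twisted_class G \<psi> (e z)) Z"
  proof (rule inj_onI)
    fix z z' assume z: "z \<in> Z" "z' \<in> Z" "twisted_class G \<psi> (e z) = twisted_class G \<psi> (e z')"
    obtain x j x' j' where xj: "z = (x, j)" "z' = (x', j')" by (metis surj_pair)
    have x: "x \<in> box p n" "j < J x" "x' \<in> box p n" "j' < J x'" using z xj by (auto simp: Z_def)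
    then have xp: "x \<in> int_vecs p" "x' \<in> int_vecs p" by (auto simp: box_def)
    have "\<Lambda> (comb x) = \<Lambda> (comb x')" using L_class[OF ec ec z(3)] unfolding ev by (simp add: xj)
    then have eq: "(\<lambda>j. N * x j) = (\<lambda>j. N * x' j)" unfolding L_comb[OF xp(1)] L_comb[OF xp(2)] .
    have "x = x'"
    proof (rule ext)
      fix i show "x i = x' i" using fun_cong[OF eq, of i] N_pos by simp
    qed
    moreover have "j = j'" using dist[OF x(1,2), of j'] x z(3) xj \<open>x = x'\<close> by (simp add: e_def)
    ultimately show "z = z'" using xj by simp
  qed
  then have "card Z \<le> card (twisted_class G \<psi> ` nball m)"
  proof (rule card_inj_on_le)
    show "(\<lambda>z. twisted_class G \<psi> (e z)) ` Z \<subseteq> twisted_class G \<psi> ` nball m"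
    proof
      fix P assume "P \<in> (\<lambda>z. twisted_class G \<psi> (e z)) ` Z"
      then obtain x j where z: "x \<in> box p n" "j < J x" "P = twisted_class G \<psi> (e (x, j))" by (auto simp: Z_def)
      then have "e (x, j) \<in> nball m" using J[OF z(1,2)] ec[of "(x, j)"] by (simp add: nball_def e_def)
      then show "P \<in> twisted_class G \<psi> ` nball m" using z(3) by blast
    qed
  qed (simp add: finite_nball)
  then show ?thesis unfolding twisted_growth_eq by (simp add: Z_def finite_box)
qed

end

section \<open>Word norms of normal forms and of central elements\<close>

context heis_count
begin

lemma word_norm_sig:
  obtains C :: nat where "\<And>x B. (\<And>i. \<bar>x i\<bar> \<le> int B) \<Longrightarrow> word_norm G S (sig k x) \<le> C * B"
proof -
  have "int (word_norm G S (sig j x)) \<le> (\<Sum>i<j. int B * int (word_norm G S (a i)))"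
    if B: "\<And>i. \<bar>x i\<bar> \<le> int B" and "j \<le> k" for x B j
    using that(2)
  proof (induction j)
    case (Suc j)
    have "int (word_norm G S (a j [^] x j)) \<le> int B * int (word_norm G S (a j))"
      using order_trans[OF word_norm_pow[of "a j" "x j"] mult_right_mono[OF B[of j]]] Suc.prems a_closed by simp
    then show ?case
      using word_norm_mult[of "sig j x" "a j [^] x j"] Suc sig_closed[of j] a_closed[of j] by simp
  qed simp
  then have "int (word_norm G S (sig k x)) \<le> int ((\<Sum>i<k. word_norm G S (a i)) * B)"
    if "\<And>i. \<bar>x i\<bar> \<le> int B" for x B
    using that by (simp add: sum_distrib_left sum_distrib_right mult.commute)
  then have "word_norm G S (sig k x) \<le> (\<Sum>i<k. word_norm G S (a i)) * B"
    if "\<And>i. \<bar>x i\<bar> \<le> int B" for x B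
    using that by (simp only: of_nat_le_iff)
  then show ?thesis using that by blast
qed

lemma word_norm_zeta: "word_norm G S (zeta (int j)) \<le> j * word_norm G S (zeta 1)"
proof -
  have "int (word_norm G S (zeta (int j))) \<le> int (j * word_norm G S (zeta 1))"
    using word_norm_pow[of "zeta 1" "int j"] by (simp add: zeta_pow)
  then show ?thesis by (simp only: of_nat_le_iff)
qed

text \<open>If all commutators were trivial, the isolator would consist of torsion elements, whereas
  \<open>zeta 1\<close> has infinite order.\<close>

lemma nontrivial_commutator: "\<exists>g\<in>carrier G. \<exists>h\<in>carrier G. \<exists>q>0. commutator G g h = zeta q"
proof (rule ccontr)
  assume no: "\<not> ?thesis"
  have triv: "commutator G g h = \<one>" if gh: "g \<in> carrier G" "h \<in> carrier G" for g h
  proof -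
    define q where "q = om (vec g) (vec h)"
    have "commutator G g h = zeta q" "commutator G h g = zeta (- q)"
      using commutator_eq_zeta gh om_antisym[of "vec g" "vec h"] by (auto simp: q_def)
    then have "\<not> q > 0" "\<not> - q > 0" using no gh by blast+
    then have "q = 0" by linarith
    then show ?thesis using \<open>commutator G g h = zeta q\<close> by (simp add: zeta_0)
  qed
  have "derived_set G (carrier G) \<subseteq> {\<one>}"
    using triv unfolding commutator_def by blast
  then have der: "derived G (carrier G) \<subseteq> {\<one>}"
    unfolding derived_def using mono_generate[of _ "{\<one>}"] generate_one by blast
  obtain n :: nat where n: "n \<ge> 1" "zeta 1 [^] n \<in> derived G (carrier G)"
    using zeta_in[of 1] by (auto simp: isolator_def)
  then have "zeta (int n) = zeta 0" using der zeta_pow[of "int n"] by (auto simp: zeta_0 int_pow_int)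
  then have "int n = 0" using iota_zeta by metis
  then show False using n(1) by simp
qed

lemma word_norm_commutator:
  assumes "g \<in> carrier G" "h \<in> carrier G"
  shows "word_norm G S (commutator G g h) \<le> 2 * word_norm G S g + 2 * word_norm G S h"
proof -
  have "word_norm G S (commutator G g h) \<le> word_norm G S (g \<otimes> h \<otimes> inv g) + word_norm G S (inv h)"
    unfolding commutator_def by (rule word_norm_mult) (use assms in auto)
  also have "\<dots> \<le> word_norm G S (g \<otimes> h) + word_norm G S (inv g) + word_norm G S (inv h)"
    using word_norm_mult[of "g \<otimes> h" "inv g"] assms by simp
  also have "\<dots> \<le> word_norm G S g + word_norm G S h + word_norm G S g + word_norm G S h"
    using word_norm_mult[of g h] word_norm_inv assms by (meson add_mono)
  finally show ?thesis by simp
qed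

text \<open>The centre is quadratically distorted: \<open>[g\<^sup>s, h\<^sup>n]\<close> is a central element of size \<open>sn\<close>.\<close>

lemma word_norm_zeta_sqrt:
  obtains C :: nat where "\<And>n j. n \<ge> 1 \<Longrightarrow> j \<le> n\<^sup>2 \<Longrightarrow> word_norm G S (zeta (int j)) \<le> C * n"
proof -
  obtain g h q where gh: "g \<in> carrier G" "h \<in> carrier G" "(q::int) > 0" "commutator G g h = zeta q"
    using nontrivial_commutator by blast
  define q' where "q' = nat q"
  have q': "int q' = q" "q' \<ge> 1" using gh(3) by (auto simp: q'_def)
  have omq: "om (vec g) (vec h) = q" using commutator_eq_zeta[OF gh(1,2)] gh(4) iota_zeta by metis
  define wg wh wz where "wg = word_norm G S g" and "wh = word_norm G S h" and "wz = word_norm G S (zeta 1)"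
  have main: "word_norm G S (zeta (int j)) \<le> (2 * wg + 2 * wh + q' * wz) * n" if n: "n \<ge> 1" and j: "j \<le> n\<^sup>2" for n j
  proof -
    \<comment> \<open>Division of \<open>j\<close> by the commutator value belonging to the
      exponents 1 and \<open>n\<close>: the quotient is at most \<open>n\<close> since j \<le> n^2,
      and the remainder is linear in \<open>n\<close>.\<close>
    define s r where "s = j div (q' * n)" and "r = j mod (q' * n)"
    have qn: "q' * n \<ge> 1" using q'(2) n by simp
    have "j div (q' * n) \<le> n\<^sup>2 div n"
      using div_le_mono[OF j, of "q' * n"] div_le_mono2[of n "q' * n" "n\<^sup>2"] q'(2) n by simp
    then have s: "s \<le> n" using n by (simp add: s_def power2_eq_square)
    have r: "r \<le> q' * n" using qn mod_less_divisor[of "q' * n" j] by (simp add: r_def)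
    have c: "g [^] int s \<in> carrier G" "h [^] int n \<in> carrier G" using gh by auto
    have "om (vec (g [^] int s)) (vec (h [^] int n)) = int s * (int n * q)"
      using gh omq vec_in by (simp only: vec_pow om_scale int_vecs_closed(5))
    then have "commutator G (g [^] int s) (h [^] int n) = zeta (int (s * (q' * n)))"
      using commutator_eq_zeta[OF c] q'(1) by (simp add: mult.commute)
    moreover have "j = s * (q' * n) + r" by (simp only: s_def r_def div_mult_mod_eq)
    ultimately have "zeta (int j) = commutator G (g [^] int s) (h [^] int n) \<otimes> zeta (int r)"
      by (simp only: zeta_mult of_nat_add)
    then have "word_norm G S (zeta (int j))
        \<le> word_norm G S (commutator G (g [^] int s) (h [^] int n)) + word_norm G S (zeta (int r))"
      using word_norm_mult[of "commutator G (g [^] int s) (h [^] int n)" "zeta (int r)"] c by simp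
    also have "\<dots> \<le> (2 * word_norm G S (g [^] int s) + 2 * word_norm G S (h [^] int n)) + r * wz"
      unfolding wz_def by (intro add_mono word_norm_commutator word_norm_zeta c)
    also have "\<dots> \<le> (2 * (n * wg) + 2 * (n * wh)) + (q' * n) * wz"
    proof (intro add_mono mult_le_mono2 mult_le_mono1 r)
      have "int (word_norm G S (g [^] int s)) \<le> int (s * wg)"
        using word_norm_pow[OF gh(1), of "int s"] by (simp add: wg_def)
      then have "word_norm G S (g [^] int s) \<le> s * wg" by (simp only: of_nat_le_iff)
      then show "word_norm G S (g [^] int s) \<le> n * wg" using s mult_le_mono1 order_trans by blast
      have "int (word_norm G S (h [^] int n)) \<le> int (n * wh)"
        using word_norm_pow[OF gh(2), of "int n"] by (simp add: wh_def)
      then show "word_norm G S (h [^] int n) \<le> n * wh" by (simp only: of_nat_le_iff)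
    qed
    finally show ?thesis by (simp add: algebra_simps)
  qed
  show ?thesis by (rule that) (rule main)
qed

end

section \<open>The growth rate\<close>

text \<open>An estimate for large \<open>n\<close> with any real constant suffices: the values at
  the finitely many small arguments are absorbed into the factor, and monotonicity of the majorant
  lets one constant serve as factor and as dilation.\<close>

lemma growth_leI:
  fixes F H :: "nat \<Rightarrow> real" and C :: real
  assumes mono: "\<And>x y. 1 \<le> x \<Longrightarrow> x \<le> y \<Longrightarrow> H x \<le> H y" and m: "m \<ge> 1"
    and bound: "\<And>n. n \<ge> start \<Longrightarrow> n \<ge> 1 \<Longrightarrow> F n \<le> C * max 1 (H (m * n))"
  shows "growth_le F H"
proof -
  define c where "c = m + nat \<lceil>C\<rceil> + (\<Sum>n<start. nat \<lceil>F n\<rceil>) + 1"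
  have c1: "c \<ge> 1" "m \<le> c" by (simp_all add: c_def)
  have "nat \<lceil>C\<rceil> \<le> c" unfolding c_def by (intro trans_le_add1 trans_le_add2 order_refl)
  then have cC: "C \<le> real c" by (simp only: nat_ceiling_le_eq)
  have "max 1 (F n) \<le> real c * max 1 (H (c * n))" if n: "n \<ge> 1" for n
  proof -
    have mx: "max 1 (H (m * n)) \<le> max 1 (H (c * n))"
      using mono[of "m * n" "c * n"] c1 m n by (simp add: max.coboundedI2)
    have one: "1 \<le> real c * max 1 (H (c * n))"
      using mult_mono[of 1 "real c" 1 "max 1 (H (c * n))"] c1 by simp
    have "F n \<le> real c * max 1 (H (c * n))"
    proof (cases "n \<ge> start")
      case True
      have "F n \<le> C * max 1 (H (m * n))" using bound[OF True n] .
      also have "\<dots> \<le> real c * max 1 (H (c * n))" using cC mx by (intro mult_mono) auto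
      finally show ?thesis .
    next
      case False
      then have "nat \<lceil>F n\<rceil> \<le> (\<Sum>n<start. nat \<lceil>F n\<rceil>)" by (intro member_le_sum) auto
      then have "nat \<lceil>F n\<rceil> \<le> c" unfolding c_def by (intro trans_le_add1 trans_le_add2)
      then have "F n \<le> real c" by (simp only: nat_ceiling_le_eq)
      also have "\<dots> \<le> real c * max 1 (H (c * n))" using mult_left_mono[of 1 "max 1 (H (c * n))" "real c"] by simp
      finally show ?thesis .
    qed
    then show ?thesis using one by simp
  qed
  then show ?thesis unfolding growth_le_def using c1(1) by blast
qed

context heis_coords
begin

lemma word_norm_comb:
  obtains C :: nat where "\<And>n x. x \<in> box p n \<Longrightarrow> word_norm G S (sig k (comb x)) \<le> C * n"
proof -
  obtain Cc where Cc: "\<And>x B j. x \<in> int_vecs p \<Longrightarrow> (\<And>i. \<bar>x i\<bar> \<le> B) \<Longrightarrow> j < k \<Longrightarrow> \<bar>comb x j\<bar> \<le> int Cc * B"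
    using additive_on_bounded[OF comb_additive, where m = k] by metis
  obtain Cs where Cs: "\<And>x B. (\<And>i. \<bar>x i\<bar> \<le> int B) \<Longrightarrow> word_norm G S (sig k x) \<le> Cs * B"
    using word_norm_sig by metis
  have "word_norm G S (sig k (comb x)) \<le> (Cs * Cc) * n" if x: "x \<in> box p n" for n x
  proof -
    have "\<bar>comb x i\<bar> \<le> int (Cc * n)" for i
    proof (cases "i < k")
      case True
      then show ?thesis using Cc[OF _ box_abs[OF x] True] x by (simp add: box_def)
    next
      case False
      then show ?thesis using int_vecsD[OF comb_in] by simp
    qed
    from Cs[OF this] show ?thesis by (simp add: mult.assoc)
  qed
  then show ?thesis using that by blast
qed

lemma growth_lower_trivial:
  obtains m :: nat where "m \<ge> 1" "\<And>n. real n ^ p \<le> real (twisted_growth G S \<psi> (m * n))"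
proof -
  obtain C where C: "\<And>n x. x \<in> box p n \<Longrightarrow> word_norm G S (sig k (comb x)) \<le> C * n"
    using word_norm_comb by metis
  have "real n ^ p \<le> real (twisted_growth G S \<psi> ((C + 1) * n))" for n
  proof -
    have "(\<Sum>x\<in>box p n. 1) \<le> twisted_growth G S \<psi> ((C + 1) * n)"
    proof (rule twisted_growth_lower)
      fix x and j :: nat assume "x \<in> box p n" "j < 1"
      then show "word_norm G S (sig k (comb x) \<otimes> zeta (int j)) \<le> (C + 1) * n"
        using C[of x n] sig_closed[of k "comb x"] by (simp add: zeta_0)
    qed simp
    then have "(2 * n + 1) ^ p \<le> twisted_growth G S \<psi> ((C + 1) * n)" by (simp add: card_box)
    moreover have "n ^ p \<le> (2 * n + 1) ^ p" by (rule power_mono) auto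
    ultimately have "real (n ^ p) \<le> real (twisted_growth G S \<psi> ((C + 1) * n))" by (simp only: of_nat_le_iff)
    then show ?thesis by simp
  qed
  then show ?thesis using that[of "C + 1"] by simp
qed

text \<open>With one period for all of G each value of \<open>\<Lambda>\<close> carries a bounded
  number of classes, so only the (2Cn + 1)^p values of \<open>\<Lambda>\<close> matter.\<close>

lemma growth_bounded_period:
  assumes q: "q \<ge> 1" and per: "\<And>x. x \<in> carrier G \<Longrightarrow> \<exists>h\<in>carrier G. twist h x = x \<otimes> zeta (int q)"
  shows "growth_equiv (\<lambda>n. real (twisted_growth G S \<psi> n)) (\<lambda>n. real n ^ p * 1)"
  unfolding growth_equiv_def
proof
  have "\<forall>x\<in>carrier G. \<exists>h\<in>carrier G. twist h x = x \<otimes> zeta (int q)" using per by blast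
  from twisted_growth_upper[OF this]
  obtain C :: nat where C: "C \<ge> 1" "\<forall>n\<ge>1. real (twisted_growth G S \<psi> n)
    \<le> real C * (\<Sum>\<nu>\<in>box p (C * n). if q = 0 then (real n)\<^sup>2 else real q)" by blast
  show "growth_le (\<lambda>n. real (twisted_growth G S \<psi> n)) (\<lambda>n. real n ^ p * 1)"
  proof (rule growth_leI[where m = 1 and start = 1 and C = "real C * real q * (3 * real C) ^ p"])
    fix n :: nat assume n: "n \<ge> 1"
    have "real (twisted_growth G S \<psi> n) \<le> real C * (real ((2 * (C * n) + 1) ^ p) * real q)"
      using C(2)[rule_format, OF n] q by (simp add: card_box)
    also have "real ((2 * (C * n) + 1) ^ p) \<le> (3 * real C * real n) ^ p"
    proof -
      have "1 \<le> C * n" using C(1) n by simp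
      then have "2 * (C * n) + 1 \<le> 3 * (C * n)" by linarith
      then have "real (2 * (C * n) + 1) \<le> real (3 * (C * n))" by (simp only: of_nat_le_iff)
      then have "real (2 * (C * n) + 1) \<le> 3 * real C * real n" by simp
      then show ?thesis unfolding of_nat_power by (rule power_mono) simp
    qed
    also have "real C * ((3 * real C * real n) ^ p * real q) = real C * real q * (3 * real C) ^ p * (real n ^ p * 1)"
      by (simp add: power_mult_distrib)
    also have "\<dots> \<le> real C * real q * (3 * real C) ^ p * max 1 (real n ^ p * 1)"
      by (intro mult_left_mono) auto
    finally show "real (twisted_growth G S \<psi> n) \<le> real C * real q * (3 * real C) ^ p * max 1 (real (1 * n) ^ p * 1)"
      by (simp add: mult_left_mono mult_right_mono)
  qed (auto intro: power_mono)
  obtain m where m: "m \<ge> 1" "\<And>n. real n ^ p \<le> real (twisted_growth G S \<psi> (m * n))"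
    using growth_lower_trivial by metis
  show "growth_le (\<lambda>n. real n ^ p * 1) (\<lambda>n. real (twisted_growth G S \<psi> n))"
    by (rule growth_leI[where m = m and start = 1 and C = 1]) (use m twisted_growth_mono in \<open>auto simp: le_max_iff_disj\<close>)
qed

end

section \<open>Trivial action on the isolator and vanishing \<psi>' on the central kernel\<close>

locale heis_fixed = heis_coords G \<iota> k a \<psi> S p \<Lambda> g t N M
  for G :: "('a, 'b) monoid_scheme" (structure) and \<iota> k a \<psi> S p \<Lambda> g t N M +
  fixes \<kappa> :: "(nat \<Rightarrow> int) \<Rightarrow> (nat \<Rightarrow> int)" and dd :: nat
  assumes eps_1: "eps = 1" and dd_le: "dd \<le> p"
    and kap: "lattice_param p \<kappa> {w \<in> int_vecs k. D w = 0}"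
    and kap_rad: "x \<in> int_vecs p \<Longrightarrow> \<kappa> x \<in> rad \<longleftrightarrow> (\<forall>i<dd. x i = 0)"
    and L_om: "v \<in> int_vecs k \<Longrightarrow> j < dd \<Longrightarrow> \<Lambda> v j = om (\<kappa> (unit_vec j)) v"
    and f_rad: "w \<in> rad \<Longrightarrow> D w = 0 \<Longrightarrow> f w = 0"
begin

definition mu :: "nat \<Rightarrow> int" where "mu i = f (\<kappa> (unit_vec i))"

text \<open>The height change caused by a stabilising element \<open>w\<close> at the vector \<open>v\<close>.\<close>

definition shift_by :: "(nat \<Rightarrow> int) \<Rightarrow> (nat \<Rightarrow> int) \<Rightarrow> int" where
  "shift_by v w = 2 * om w v - f w"

lemma shift_by_additive: "v \<in> int_vecs k \<Longrightarrow> additive_on k (shift_by v)"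
  using om_additive(2)[of v] f_additive by (simp add: additive_on_def shift_by_def algebra_simps del: plus_fun_apply)

lemma kap_in: "x \<in> int_vecs p \<Longrightarrow> \<kappa> x \<in> int_vecs k" "x \<in> int_vecs p \<Longrightarrow> D (\<kappa> x) = 0"
  using lattice_param_in[OF kap] by auto

text \<open>The basis vectors of the kernel of \<open>D\<close> from \<open>dd\<close> on lie in the
  radical, where both the form and, by assumption, \<open>f\<close> vanish. The others contribute
  the coordinates of \<open>\<Lambda>\<close>.\<close>

lemma shift_by_kap:
  assumes v: "v \<in> int_vecs k" and c: "c \<in> int_vecs p"
  shows "shift_by v (\<kappa> c) = (\<Sum>i<dd. c i * (2 * \<Lambda> v i - mu i))"
proof -
  have "additive_on p (\<lambda>c. shift_by v (\<kappa> c))"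
    by (rule additive_on_comp[OF shift_by_additive[OF v] lattice_param_add[OF kap] kap_in(1)])
  then have "shift_by v (\<kappa> c) = (\<Sum>i<p. c i * shift_by v (\<kappa> (unit_vec i)))"
    using c by (rule additive_on_expand)
  also have "\<dots> = (\<Sum>i<dd. c i * shift_by v (\<kappa> (unit_vec i)))"
  proof (rule sum.mono_neutral_right)
    show "\<forall>i\<in>{..<p} - {..<dd}. c i * shift_by v (\<kappa> (unit_vec i)) = 0"
    proof
      fix i assume i: "i \<in> {..<p} - {..<dd}"
      then have u: "unit_vec i \<in> int_vecs p" by auto
      then have r: "\<kappa> (unit_vec i) \<in> rad" using kap_rad i by (auto simp: unit_vec_def)
      then have "om (\<kappa> (unit_vec i)) v = 0" using v by (simp add: rad_def)
      then show "c i * shift_by v (\<kappa> (unit_vec i)) = 0"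
        using f_rad[OF r kap_in(2)[OF u]] by (simp add: shift_by_def)
    qed
  qed (use dd_le in auto)
  also have "\<dots> = (\<Sum>i<dd. c i * (2 * \<Lambda> v i - mu i))"
    by (rule sum.cong) (auto simp: shift_by_def mu_def L_om[OF v])
  finally show ?thesis .
qed

text \<open>The nonnegative generator of the group of height changes available over vectors with
  \<open>\<Lambda>\<close>-value \<open>\<nu>\<close>.\<close>

definition per :: "(nat \<Rightarrow> int) \<Rightarrow> int" where
  "per \<nu> = vgcd dd (\<lambda>j. 2 * \<nu> j - mu j)"

lemma per_nonneg: "per \<nu> \<ge> 0"
  by (simp add: per_def vgcd_nonneg)

text \<open>A Bezout combination realises the height change \<open>per\<close>. It is applied twice,
  because \<open>zeta t\<close> has height 2t and a single step may be odd.\<close>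

lemma per_period:
  assumes x: "x \<in> carrier G"
  shows "\<exists>h\<in>carrier G. twist h x = x \<otimes> zeta (per (\<Lambda> (vec x)))"
proof -
  have v: "vec x \<in> int_vecs k" using x by simp
  obtain c where c: "c \<in> int_vecs dd" "per (\<Lambda> (vec x)) = (\<Sum>j<dd. c j * (2 * \<Lambda> (vec x) j - mu j))"
    using vgcd_bezout[of dd] unfolding per_def by blast
  have cp: "c \<in> int_vecs p" using c(1) int_vecs_mono[OF dd_le] by blast
  define w where "w = \<kappa> c"
  have w: "w \<in> int_vecs k" "D w = 0" using kap_in[OF cp] by (auto simp: w_def)
  have sw: "shift_by (vec x) w = per (\<Lambda> (vec x))" unfolding w_def shift_by_kap[OF v cp] c(2) ..
  have ww: "w + w \<in> int_vecs k" using w(1) by (rule int_vecs_closed(2)[OF w(1)])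
  define h where "h = lift (w + w)"
  have h: "h \<in> carrier G" "vec h = w + w" using lift[OF ww] by (auto simp: h_def)
  have Dh: "D (vec h) = 0" unfolding h(2) additive_onD[OF D_add w(1) w(1)] w(2) by simp
  have "height (twist h x) = height x + shift_by (vec x) (w + w)"
    using height_twist_fixed[OF h(1) x Dh] unfolding eps_1 h(2) shift_by_def by simp
  also have "\<dots> = height x + 2 * per (\<Lambda> (vec x))"
    unfolding additive_onD[OF shift_by_additive[OF v] w(1) w(1)] sw by simp
  also have "\<dots> = height (x \<otimes> zeta (per (\<Lambda> (vec x))))" using height_mult_zeta[OF x] by simp
  finally have ht: "height (twist h x) = height (x \<otimes> zeta (per (\<Lambda> (vec x))))" .
  have "vec (twist h x) = vec (x \<otimes> zeta (per (\<Lambda> (vec x))))"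
    using vec_twist[OF h(1) x] Dh vec_mult_zeta[OF x] by simp
  then have "twist h x = x \<otimes> zeta (per (\<Lambda> (vec x)))" using ht h(1) x by (intro coords_inj) auto
  then show ?thesis using h(1) by blast
qed

text \<open>An element twisting one translate to another fixes \<open>vec x\<close>, hence lies over
  the kernel of \<open>D\<close>, and the height change 2 (j' - j) is one of the available
  ones.\<close>

lemma class_zeta_dvd:
  assumes x: "x \<in> carrier G"
    and eq: "twisted_class G \<psi> (x \<otimes> zeta j) = twisted_class G \<psi> (x \<otimes> zeta j')"
  shows "per (\<Lambda> (vec x)) dvd 2 * (j' - j)"
proof -
  have v: "vec x \<in> int_vecs k" using x by simp
  obtain h where h: "h \<in> carrier G" "twist h (x \<otimes> zeta j) = x \<otimes> zeta j'"
    using twisted_class_eq_iff[of "x \<otimes> zeta j" "x \<otimes> zeta j'"] eq x by auto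
  have xj: "x \<otimes> zeta j \<in> carrier G" using x by simp
  have "vec x = vec x - D (vec h)"
    using vec_twist[OF h(1) xj] unfolding h(2) vec_mult_zeta[OF x] .
  then have Dh: "D (vec h) = 0" by simp
  then obtain c where c: "c \<in> int_vecs p" "vec h = \<kappa> c"
    using lattice_param_surj[OF kap, of "vec h"] h(1) by auto
  have "height (x \<otimes> zeta j') = height (x \<otimes> zeta j) + shift_by (vec x) (vec h)"
    using height_twist_fixed[OF h(1) xj Dh] unfolding h(2) eps_1 shift_by_def vec_mult_zeta[OF x] by simp
  then have "2 * (j' - j) = shift_by (vec x) (vec h)" unfolding height_mult_zeta[OF x] by presburger
  also have "\<dots> = (\<Sum>i<dd. c i * (2 * \<Lambda> (vec x) i - mu i))" unfolding c(2) by (rule shift_by_kap[OF v c(1)])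
  finally have e: "2 * (j' - j) = (\<Sum>i<dd. c i * (2 * \<Lambda> (vec x) i - mu i))" .
  show ?thesis unfolding e per_def
    by (rule dvd_sum) (intro dvd_mult, rule vgcd_dvd, simp)
qed

text \<open>The factor n^(p - dd) counts the coordinates of \<open>\<Lambda>\<close> that do not
  enter the period. The summand n^2 is the cut-off for the at most one choice of the first
  \<open>dd\<close> coordinates with period 0.\<close>

lemma growth_upper:
  obtains C :: nat where "C \<ge> 1" "\<And>n. n \<ge> 1 \<Longrightarrow> real (twisted_growth G S \<psi> n)
    \<le> real C * real n ^ (p - dd) * ((real n)\<^sup>2 + (\<Sum>u\<in>box dd (C * n) - {0}. real_of_int (vgcd dd u)))"
proof -
  have "\<forall>x\<in>carrier G. \<exists>h\<in>carrier G. twist h x = x \<otimes> zeta (int (nat (per (\<Lambda> (vec x)))))"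
    using per_period per_nonneg by simp
  from twisted_growth_upper[OF this] obtain C :: nat where C: "C \<ge> 1" "\<forall>n\<ge>1. real (twisted_growth G S \<psi> n)
    \<le> real C * (\<Sum>\<nu>\<in>box p (C * n). if nat (per \<nu>) = 0 then (real n)\<^sup>2 else real (nat (per \<nu>)))"
    by blast
  define m where "m = nat (\<Sum>j<dd. \<bar>mu j\<bar>)"
  have m: "\<bar>mu j\<bar> \<le> int m" if "j < dd" for j
  proof -
    have "\<bar>mu j\<bar> \<le> (\<Sum>j<dd. \<bar>mu j\<bar>)" by (rule member_le_sum) (use that in auto)
    also have "\<dots> = int m" by (simp add: m_def sum_nonneg)
    finally show ?thesis .
  qed
  define C' where "C' = C * (3 * C) ^ (p - dd) + 2 * C + m"
  have C'1: "C' \<ge> 1" using C(1) by (simp add: C'_def)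
  have "real (twisted_growth G S \<psi> n)
    \<le> real C' * real n ^ (p - dd) * ((real n)\<^sup>2 + (\<Sum>u\<in>box dd (C' * n) - {0}. real_of_int (vgcd dd u)))"
    if n: "n \<ge> 1" for n
  proof -
    let ?F = "\<lambda>\<nu>. if per \<nu> = 0 then (real n)\<^sup>2 else real_of_int (per \<nu>)"
    have pt: "per (trunc dd \<nu>) = per \<nu>" for \<nu>
      unfolding per_def vgcd_def trunc_def by (intro arg_cong[of _ _ Gcd] image_cong) auto
    have "(\<Sum>\<nu>\<in>box p (C * n). if nat (per \<nu>) = 0 then (real n)\<^sup>2 else real (nat (per \<nu>)))
        = (\<Sum>\<nu>\<in>box p (C * n). ?F (trunc dd \<nu>))"
      unfolding pt
    proof (rule sum.cong[OF refl])
      fix \<nu> show "(if nat (per \<nu>) = 0 then (real n)\<^sup>2 else real (nat (per \<nu>))) = ?F \<nu>"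
        using per_nonneg[of \<nu>] by auto
    qed
    also have "\<dots> = real ((2 * (C * n) + 1) ^ (p - dd)) * (\<Sum>y\<in>box dd (C * n). ?F y)"
      by (rule sum_box_trunc[OF dd_le])
    also have "\<dots> \<le> (3 * real C * real n) ^ (p - dd) *
        ((real n)\<^sup>2 + (\<Sum>u\<in>box dd (C' * n) - {0}. real_of_int (vgcd dd u)))"
    proof (rule mult_mono)
      have "1 \<le> C * n" using C(1) n by simp
      then have "2 * (C * n) + 1 \<le> 3 * (C * n)" by linarith
      then have "real (2 * (C * n) + 1) \<le> real (3 * (C * n))" by (simp only: of_nat_le_iff)
      then have "real (2 * (C * n) + 1) \<le> 3 * real C * real n" by simp
      then show "real ((2 * (C * n) + 1) ^ (p - dd)) \<le> (3 * real C * real n) ^ (p - dd)"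
        unfolding of_nat_power by (rule power_mono) simp
      \<comment> \<open>The shift by \<open>mu\<close> is removed at the price of a larger
        box.\<close>
      have "(\<Sum>y\<in>box dd (C * n). ?F y) \<le> (real n)\<^sup>2 + (\<Sum>u\<in>box dd (2 * (C * n) + m) - {0}. real_of_int (vgcd dd u))"
        unfolding per_def by (rule sum_shifted_le[OF _ m]) auto
      also have "(\<Sum>u\<in>box dd (2 * (C * n) + m) - {0}. real_of_int (vgcd dd u))
          \<le> (\<Sum>u\<in>box dd (C' * n) - {0}. real_of_int (vgcd dd u))"
      proof (rule sum_mono2)
        have "m \<le> m * n" using n by simp
        then have "2 * (C * n) + m \<le> (2 * C + m) * n" by (simp add: algebra_simps)
        also have "\<dots> \<le> C' * n" by (rule mult_le_mono1) (simp add: C'_def)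
        finally have "int (2 * (C * n) + m) \<le> int (C' * n)" by (simp only: of_nat_le_iff)
        then show "box dd (2 * (C * n) + m) - {0} \<subseteq> box dd (C' * n) - {0}"
          unfolding box_def using order_trans by blast
      qed (auto simp: finite_box vgcd_nonneg)
      finally show "(\<Sum>y\<in>box dd (C * n). ?F y)
          \<le> (real n)\<^sup>2 + (\<Sum>u\<in>box dd (C' * n) - {0}. real_of_int (vgcd dd u))" by simp
      show "0 \<le> (\<Sum>y\<in>box dd (C * n). ?F y)" by (intro sum_nonneg) (simp add: per_nonneg)
    qed simp
    finally have "real (twisted_growth G S \<psi> n) \<le> real C * ((3 * real C * real n) ^ (p - dd) *
        ((real n)\<^sup>2 + (\<Sum>u\<in>box dd (C' * n) - {0}. real_of_int (vgcd dd u))))"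
      using C(2)[rule_format, OF n] mult_left_mono[of _ _ "real C"] by (meson of_nat_0_le_iff order_trans)
    also have "\<dots> = real (C * (3 * C) ^ (p - dd)) * (real n ^ (p - dd) *
        ((real n)\<^sup>2 + (\<Sum>u\<in>box dd (C' * n) - {0}. real_of_int (vgcd dd u))))"
      by (simp add: power_mult_distrib mult.assoc)
    also have "\<dots> \<le> real C' * (real n ^ (p - dd) *
        ((real n)\<^sup>2 + (\<Sum>u\<in>box dd (C' * n) - {0}. real_of_int (vgcd dd u))))"
    proof (rule mult_right_mono)
      show "real (C * (3 * C) ^ (p - dd)) \<le> real C'" by (simp only: of_nat_le_iff) (simp add: C'_def)
      show "0 \<le> real n ^ (p - dd) * ((real n)\<^sup>2 + (\<Sum>u\<in>box dd (C' * n) - {0}. real_of_int (vgcd dd u)))"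
        by (intro mult_nonneg_nonneg add_nonneg_nonneg sum_nonneg) (auto simp: vgcd_nonneg)
    qed
    finally show ?thesis by (simp add: mult.assoc)
  qed
  then show ?thesis using that[OF C'1] by blast
qed

text \<open>Over each \<open>x\<close> about half of the period is filled with pairwise inequivalent
  central translates. The period is O(n), so the linear bound on the norm of \<open>zeta j\<close>
  is good enough.\<close>

lemma growth_lower_gcd:
  "\<exists>m::nat. m \<ge> 1 \<and> (\<forall>n\<ge>1.
    real n ^ (p - dd) * (\<Sum>x\<in>box dd n. real_of_int (vgcd dd (\<lambda>j. 2 * (N * x j) - mu j)))
      \<le> 2 * real (twisted_growth G S \<psi> (m * n)))"
proof -
  obtain C where C: "\<And>n x. x \<in> box p n \<Longrightarrow> word_norm G S (sig k (comb x)) \<le> C * n"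
    using word_norm_comb by metis
  define wz where "wz = word_norm G S (zeta 1)"
  \<comment> \<open>Bounds the period by \<open>B * n\<close>, since a nonzero gcd is at most any
    nonzero entry 2Nx - mu.\<close>
  define B where "B = nat (2 * N + (\<Sum>j<dd. \<bar>mu j\<bar>))"
  have sm0: "(\<Sum>j<dd. \<bar>mu j\<bar>) \<ge> 0" by (rule sum_nonneg) simp
  define v where "v x = vgcd dd (\<lambda>j. 2 * (N * x j) - mu j)" for x
  \<comment> \<open>Half of the period, rounded up: for j, j' < J the number 2 (j' - j) is smaller
    in absolute value than the period, so divisibility forces equality.\<close>
  define J where "J x = nat ((v x + 1) div 2)" for x
  define m where "m = C + B * wz + 1"
  have v0: "v x \<ge> 0" for x by (simp add: v_def vgcd_nonneg)
  have vB: "v x \<le> int (B * n)" if x: "x \<in> box p n" and n: "n \<ge> 1" for x n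
  proof (cases "v x = 0")
    case False
    then obtain j where j: "j < dd" "2 * (N * x j) - mu j \<noteq> 0" by (auto simp: v_def vgcd_eq_0)
    have "v x \<le> \<bar>2 * (N * x j) - mu j\<bar>"
      using zdvd_imp_le[of "v x" "\<bar>2 * (N * x j) - mu j\<bar>"] vgcd_dvd[OF j(1), of "\<lambda>j. 2 * (N * x j) - mu j"] j(2)
      by (simp add: v_def)
    also have "\<dots> \<le> 2 * (N * int n) + (\<Sum>j<dd. \<bar>mu j\<bar>)"
    proof -
      have "\<bar>N * x j\<bar> \<le> N * int n" using box_abs[OF x, of j] N_pos by (simp add: abs_mult)
      moreover have "\<bar>mu j\<bar> \<le> (\<Sum>j<dd. \<bar>mu j\<bar>)" by (rule member_le_sum) (use j in auto)
      ultimately show ?thesis by linarith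
    qed
    also have "\<dots> \<le> 2 * (N * int n) + (\<Sum>j<dd. \<bar>mu j\<bar>) * int n"
      using mult_left_mono[of 1 "int n" "\<Sum>j<dd. \<bar>mu j\<bar>"] sm0 n by simp
    also have "\<dots> = int (B * n)" using N_pos sm0 by (simp add: B_def algebra_simps)
    finally show ?thesis .
  qed simp
  have Lx: "\<Lambda> (vec (sig k (comb x))) = (\<lambda>j. N * x j)" if "x \<in> box p n" for x n
    using L_comb[of x] that vec_sig[of k "comb x"] trunc_id[OF comb_in] by (simp add: box_def)
  have main: "real n ^ (p - dd) * (\<Sum>x\<in>box dd n. real_of_int (v x)) \<le> 2 * real (twisted_growth G S \<psi> (m * n))"
    if n: "n \<ge> 1" for n
  proof -
    have "(\<Sum>x\<in>box p n. J x) \<le> twisted_growth G S \<psi> (m * n)"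
    proof (rule twisted_growth_lower)
      fix x j assume x: "x \<in> box p n" and j: "j < J x"
      have c: "sig k (comb x) \<in> carrier G" by (rule sig_closed) simp
      have "int j \<le> v x" using j v0[of x] by (simp add: J_def)
      then have "int j \<le> int (B * n)" using vB[OF x n] by linarith
      then have jB: "j \<le> B * n" by (simp only: of_nat_le_iff)
      have "word_norm G S (sig k (comb x) \<otimes> zeta (int j)) \<le> C * n + j * wz"
        using word_norm_mult[OF c zeta_closed, of "int j"] C[OF x] word_norm_zeta[of j] unfolding wz_def by linarith
      also have "\<dots> \<le> C * n + (B * n) * wz" using jB by (intro add_left_mono mult_le_mono1)
      also have "\<dots> \<le> m * n" by (simp add: m_def algebra_simps)
      finally show "word_norm G S (sig k (comb x) \<otimes> zeta (int j)) \<le> m * n" .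
      fix j' assume j': "j' < J x" and
        eq: "twisted_class G \<psi> (sig k (comb x) \<otimes> zeta (int j)) = twisted_class G \<psi> (sig k (comb x) \<otimes> zeta (int j'))"
      have d: "v x dvd 2 * (int j' - int j)" using class_zeta_dvd[OF c eq] unfolding Lx[OF x] per_def v_def .
      have "2 * int j + 1 \<le> v x" "2 * int j' + 1 \<le> v x" using j j' v0[of x] unfolding J_def by linarith+
      then have "\<bar>2 * (int j' - int j)\<bar> < v x" by presburger
      then have "2 * (int j' - int j) = 0" using d v0[of x] dvd_imp_le_int by (metis abs_of_nonneg not_le)
      then show "j = j'" by simp
    qed
    then have "real (\<Sum>x\<in>box p n. J x) \<le> real (twisted_growth G S \<psi> (m * n))" by (simp only: of_nat_le_iff)
    moreover have "(\<Sum>x\<in>box p n. real_of_int (v x) / 2) \<le> real (\<Sum>x\<in>box p n. J x)"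
      unfolding of_nat_sum
    proof (rule sum_mono)
      fix x
      have "v x \<le> 2 * int (J x)" using v0[of x] unfolding J_def by linarith
      then have "real_of_int (v x) \<le> real_of_int (2 * int (J x))" by (simp only: of_int_le_iff)
      then show "real_of_int (v x) / 2 \<le> real (J x)" by simp
    qed
    ultimately have 1: "(\<Sum>x\<in>box p n. real_of_int (v x)) \<le> 2 * real (twisted_growth G S \<psi> (m * n))"
      by (simp add: sum_divide_distrib[symmetric])
    have vt: "v (trunc dd x) = v x" for x
      unfolding v_def vgcd_def trunc_def by (intro arg_cong[of _ _ Gcd] image_cong) auto
    have "(\<Sum>x\<in>box p n. real_of_int (v x)) = (\<Sum>x\<in>box p n. real_of_int (v (trunc dd x)))" by (simp only: vt)
    also have "\<dots> = real ((2 * n + 1) ^ (p - dd)) * (\<Sum>x\<in>box dd n. real_of_int (v x))"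
      by (rule sum_box_trunc[OF dd_le])
    finally have 2: "(\<Sum>x\<in>box p n. real_of_int (v x)) = real ((2 * n + 1) ^ (p - dd)) * (\<Sum>x\<in>box dd n. real_of_int (v x))" .
    have "real n ^ (p - dd) * (\<Sum>x\<in>box dd n. real_of_int (v x))
        \<le> real ((2 * n + 1) ^ (p - dd)) * (\<Sum>x\<in>box dd n. real_of_int (v x))"
      unfolding of_nat_power by (intro mult_right_mono power_mono sum_nonneg) (auto simp: v0)
    then show ?thesis using 1 2 by linarith
  qed
  have "m \<ge> 1" by (simp add: m_def)
  then show ?thesis using main[unfolded v_def] by blast
qed

text \<open>For dd = 0 the period is 0 and all central translates are inequivalent; by the quadratic
  distortion n^2 of them fit into a ball of radius O(n).\<close>

lemma growth_lower_square:
  assumes "dd = 0"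
  obtains m :: nat where "m \<ge> 1" "\<And>n. n \<ge> 1 \<Longrightarrow>
    real n ^ p * (real n)\<^sup>2 \<le> real (twisted_growth G S \<psi> (m * n))"
proof -
  obtain C where C: "\<And>n x. x \<in> box p n \<Longrightarrow> word_norm G S (sig k (comb x)) \<le> C * n"
    using word_norm_comb by metis
  obtain Cz where Cz: "\<And>n j. n \<ge> 1 \<Longrightarrow> j \<le> n\<^sup>2 \<Longrightarrow> word_norm G S (zeta (int j)) \<le> Cz * n"
    using word_norm_zeta_sqrt by metis
  have main: "real n ^ p * (real n)\<^sup>2 \<le> real (twisted_growth G S \<psi> ((C + Cz + 1) * n))" if n: "n \<ge> 1" for n
  proof -
    have "(\<Sum>x\<in>box p n. n\<^sup>2) \<le> twisted_growth G S \<psi> ((C + Cz + 1) * n)"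
    proof (rule twisted_growth_lower)
      fix x j assume x: "x \<in> box p n" and j: "j < n\<^sup>2"
      have c: "sig k (comb x) \<in> carrier G" by (rule sig_closed) simp
      show "word_norm G S (sig k (comb x) \<otimes> zeta (int j)) \<le> (C + Cz + 1) * n"
        using word_norm_mult[OF c zeta_closed, of "int j"] C[OF x] Cz[OF n less_imp_le[OF j]]
        by (simp add: algebra_simps)
      fix j' assume "twisted_class G \<psi> (sig k (comb x) \<otimes> zeta (int j)) = twisted_class G \<psi> (sig k (comb x) \<otimes> zeta (int j'))"
      from class_zeta_dvd[OF c this] have "per (\<Lambda> (vec (sig k (comb x)))) dvd 2 * (int j' - int j)" .
      moreover have "per (\<Lambda> (vec (sig k (comb x)))) = 0" unfolding per_def using assms by simp
      ultimately show "j = j'" by simp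
    qed
    then have "(2 * n + 1) ^ p * n\<^sup>2 \<le> twisted_growth G S \<psi> ((C + Cz + 1) * n)" by (simp add: card_box)
    moreover have "n ^ p * n\<^sup>2 \<le> (2 * n + 1) ^ p * n\<^sup>2" by (intro mult_le_mono1 power_mono) auto
    ultimately have "real (n ^ p * n\<^sup>2) \<le> real (twisted_growth G S \<psi> ((C + Cz + 1) * n))" by (simp only: of_nat_le_iff)
    then show ?thesis by simp
  qed
  show ?thesis by (rule that[of "C + Cz + 1"]) (simp, rule main)
qed

end

lemma ln_ge_1: "real n \<ge> 3 \<Longrightarrow> 1 \<le> ln (real n)"
  using exp_le ln_ge_iff[of "real n" 1] by simp

section \<open>The growth rate for each value of the defect\<close>

context heis_fixed
begin

lemma twisted_growth_real_mono:
  "x \<le> y \<Longrightarrow> real (twisted_growth G S \<psi> x) \<le> real (twisted_growth G S \<psi> y)"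
  using twisted_growth_mono by simp

lemma growth_defect_0:
  assumes dd: "dd = 0"
  shows "growth_equiv (\<lambda>n. real (twisted_growth G S \<psi> n)) (\<lambda>n. real n ^ p * (real n)\<^sup>2)"
  unfolding growth_equiv_def
proof
  have b: "box 0 B - {0} = {}" for B by (simp add: box_0)
  obtain C :: nat where C: "\<And>n. n \<ge> 1 \<Longrightarrow> real (twisted_growth G S \<psi> n)
      \<le> real C * real n ^ (p - dd) * ((real n)\<^sup>2 + (\<Sum>u\<in>box dd (C * n) - {0}. real_of_int (vgcd dd u)))"
    using growth_upper by metis
  show "growth_le (\<lambda>n. real (twisted_growth G S \<psi> n)) (\<lambda>n. real n ^ p * (real n)\<^sup>2)"
  proof (rule growth_leI[where m = 1 and start = 1 and C = "real C"])
    fix n :: nat assume n: "n \<ge> 1"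
    have "real (twisted_growth G S \<psi> n) \<le> real C * (real n ^ p * (real n)\<^sup>2)"
      using C[OF n] unfolding dd b by simp
    also have "\<dots> \<le> real C * max 1 (real n ^ p * (real n)\<^sup>2)" by (intro mult_left_mono) auto
    finally show "real (twisted_growth G S \<psi> n) \<le> real C * max 1 (real (1 * n) ^ p * (real (1 * n))\<^sup>2)" by simp
  qed (auto intro!: mult_mono power_mono)
  obtain m where m: "m \<ge> 1" "\<And>n. n \<ge> 1 \<Longrightarrow> real n ^ p * (real n)\<^sup>2 \<le> real (twisted_growth G S \<psi> (m * n))"
    using growth_lower_square[OF dd] by metis
  show "growth_le (\<lambda>n. real n ^ p * (real n)\<^sup>2) (\<lambda>n. real (twisted_growth G S \<psi> n))"
    by (rule growth_leI[where m = m and start = 1 and C = 1])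
      (use m twisted_growth_mono in \<open>auto simp: le_max_iff_disj\<close>)
qed

lemma growth_defect_1:
  assumes dd: "dd = 1"
  shows "growth_equiv (\<lambda>n. real (twisted_growth G S \<psi> n)) (\<lambda>n. real n ^ p * real n)"
  unfolding growth_equiv_def
proof
  have pp: "x ^ (p - 1) * x\<^sup>2 = x ^ p * x" for x :: real
  proof -
    have "x ^ (p - 1) * x = x ^ p" by (rule power_minus_mult) (use dd_le dd in simp)
    then show ?thesis by (simp only: power2_eq_square mult.assoc[symmetric])
  qed
  obtain C :: nat where C: "\<And>n. n \<ge> 1 \<Longrightarrow> real (twisted_growth G S \<psi> n)
      \<le> real C * real n ^ (p - dd) * ((real n)\<^sup>2 + (\<Sum>u\<in>box dd (C * n) - {0}. real_of_int (vgcd dd u)))"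
    using growth_upper by metis
  define K where "K = real C * (1 + 3 * (real C)\<^sup>2)"
  show "growth_le (\<lambda>n. real (twisted_growth G S \<psi> n)) (\<lambda>n. real n ^ p * real n)"
  proof (rule growth_leI[where m = 1 and start = 1 and C = K])
    fix n :: nat assume n: "n \<ge> 1"
    have "real (twisted_growth G S \<psi> n)
        \<le> real C * real n ^ (p - 1) * ((real n)\<^sup>2 + (\<Sum>u\<in>box 1 (C * n) - {0}. real_of_int (vgcd 1 u)))"
      using C[OF n] unfolding dd .
    also have "\<dots> \<le> real C * real n ^ (p - 1) * ((real n)\<^sup>2 + 3 * (real (C * n))\<^sup>2)"
      by (intro mult_left_mono add_left_mono sum_vgcd_1) auto
    also have "\<dots> = K * (real n ^ (p - 1) * (real n)\<^sup>2)"
      by (simp add: K_def power_mult_distrib algebra_simps)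
    also have "\<dots> = K * (real n ^ p * real n)" unfolding pp ..
    also have "\<dots> \<le> K * max 1 (real n ^ p * real n)" unfolding K_def by (intro mult_left_mono) auto
    finally show "real (twisted_growth G S \<psi> n) \<le> K * max 1 (real (1 * n) ^ p * real (1 * n))" by simp
  qed (auto intro!: mult_mono power_mono)
  obtain m :: nat where m: "m \<ge> 1" "\<forall>n\<ge>1.
      real n ^ (p - dd) * (\<Sum>x\<in>box dd n. real_of_int (vgcd dd (\<lambda>j. 2 * (N * x j) - mu j)))
        \<le> 2 * real (twisted_growth G S \<psi> (m * n))"
    using growth_lower_gcd by blast
  show "growth_le (\<lambda>n. real n ^ p * real n) (\<lambda>n. real (twisted_growth G S \<psi> n))"
  \<comment> \<open>The factor 8 is 4 from the gcd sum times 2 from the half-filled periods.\<close>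
  proof (rule growth_leI[where m = m and start = "2 * nat \<bar>mu 0\<bar> + 2" and C = 8])
    fix n :: nat assume n: "n \<ge> 2 * nat \<bar>mu 0\<bar> + 2" "n \<ge> 1"
    have "real n ^ p * real n = 4 * (real n ^ (p - 1) * ((real n)\<^sup>2 / 4))" using pp[of "real n"] by simp
    also have "\<dots> \<le> 4 * (real n ^ (p - 1) * (\<Sum>x\<in>box 1 n. real_of_int (vgcd 1 (\<lambda>j. 2 * (N * x j) - mu j))))"
      using sum_vgcd_1_lower[of N mu n] n(1) N_pos by (intro mult_left_mono) auto
    also have "\<dots> \<le> 4 * (2 * real (twisted_growth G S \<psi> (m * n)))"
      using m(2)[rule_format, OF n(2)] unfolding dd by (intro mult_left_mono) auto
    finally show "real n ^ p * real n \<le> 8 * max 1 (real (twisted_growth G S \<psi> (m * n)))" by simp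
  qed (use m twisted_growth_real_mono in auto)
qed

lemma growth_defect_2:
  assumes dd: "dd = 2"
  shows "growth_equiv (\<lambda>n. real (twisted_growth G S \<psi> n)) (\<lambda>n. real n ^ p * ln (real n))"
  unfolding growth_equiv_def
proof
  have pp: "x ^ (p - 2) * x\<^sup>2 = x ^ p" for x :: real
  proof -
    have "p = (p - 2) + 2" using dd_le dd by simp
    then show ?thesis by (metis power_add)
  qed
  obtain C :: nat where C: "C \<ge> 1" "\<And>n. n \<ge> 1 \<Longrightarrow> real (twisted_growth G S \<psi> n)
      \<le> real C * real n ^ (p - dd) * ((real n)\<^sup>2 + (\<Sum>u\<in>box dd (C * n) - {0}. real_of_int (vgcd dd u)))"
    using growth_upper by metis
  define K where "K = real C * (1 + 9 * (real C)\<^sup>2 * (2 + ln (real C)))"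
  have lnC: "ln (real C) \<ge> 0" using C(1) by simp
  show "growth_le (\<lambda>n. real (twisted_growth G S \<psi> n)) (\<lambda>n. real n ^ p * ln (real n))"
  \<comment> \<open>From 3 on the logarithm is at least 1 and absorbs additive constants and the
    cut-off term n^2.\<close>
  proof (rule growth_leI[where m = 1 and start = 3 and C = K])
    fix n :: nat assume n3: "n \<ge> 3" and n: "n \<ge> 1"
    have l1: "1 \<le> ln (real n)" using n3 by (intro ln_ge_1) simp
    have Cn: "1 \<le> C * n" using C(1) n by simp
    have lnCn: "1 + ln (real (C * n)) \<le> (2 + ln (real C)) * ln (real n)"
    proof -
      have "ln (real (C * n)) = ln (real C) + ln (real n)" using C(1) n by (simp add: ln_mult)
      moreover have "ln (real C) \<le> ln (real C) * ln (real n)" using mult_left_mono[OF l1 lnC] by simp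
      ultimately show ?thesis using l1 by (simp add: algebra_simps)
    qed
    have "real (twisted_growth G S \<psi> n)
        \<le> real C * real n ^ (p - 2) * ((real n)\<^sup>2 + (\<Sum>u\<in>box 2 (C * n) - {0}. real_of_int (vgcd 2 u)))"
      using C(2)[OF n] unfolding dd .
    also have "\<dots> \<le> real C * real n ^ (p - 2) * ((real n)\<^sup>2 + 9 * (real (C * n))\<^sup>2 * (1 + ln (real (C * n))))"
      by (intro mult_left_mono add_left_mono sum_vgcd_2 Cn) auto
    also have "\<dots> \<le> real C * real n ^ (p - 2) *
        ((real n)\<^sup>2 * ln (real n) + 9 * (real (C * n))\<^sup>2 * ((2 + ln (real C)) * ln (real n)))"
      using lnCn l1 mult_left_mono[OF l1, of "(real n)\<^sup>2"] by (intro mult_left_mono add_mono) auto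
    also have "\<dots> = K * (real n ^ (p - 2) * (real n)\<^sup>2 * ln (real n))"
      by (simp add: K_def power_mult_distrib algebra_simps)
    also have "\<dots> = K * (real n ^ p * ln (real n))" unfolding pp ..
    also have "\<dots> \<le> K * max 1 (real n ^ p * ln (real n))"
      unfolding K_def using lnC by (intro mult_left_mono) auto
    finally show "real (twisted_growth G S \<psi> n) \<le> K * max 1 (real (1 * n) ^ p * ln (real (1 * n)))" by simp
  qed (auto intro!: mult_mono power_mono)
  obtain m :: nat where m: "m \<ge> 1" "\<forall>n\<ge>1.
      real n ^ (p - dd) * (\<Sum>x\<in>box dd n. real_of_int (vgcd dd (\<lambda>j. 2 * (N * x j) - mu j)))
        \<le> 2 * real (twisted_growth G S \<psi> (m * n))"
    using growth_lower_gcd by blast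
  define L where "L = 512 * real (nat (2 * N)) ^ 5"
  have L0: "L > 0" using N_pos by (simp add: L_def)
  show "growth_le (\<lambda>n. real n ^ p * ln (real n)) (\<lambda>n. real (twisted_growth G S \<psi> n))"
  proof (rule growth_leI[where m = m and C = "2 * L"
        and start = "nat \<bar>mu 0\<bar> + nat \<bar>mu 1\<bar> + 4 * (nat (2 * N)) ^ 4"])
    fix n :: nat assume n: "n \<ge> nat \<bar>mu 0\<bar> + nat \<bar>mu 1\<bar> + 4 * (nat (2 * N)) ^ 4" "n \<ge> 1"
    have "nat \<bar>mu 0\<bar> \<le> n" "nat \<bar>mu 1\<bar> \<le> n" "4 * (nat (2 * N)) ^ 4 \<le> n" using n(1) by linarith+
    then have s: "(real n)\<^sup>2 * ln (real n) / L \<le> (\<Sum>x\<in>box 2 n. real_of_int (vgcd 2 (\<lambda>j. 2 * (N * x j) - mu j)))"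
      unfolding L_def using N_pos by (intro sum_vgcd_2_lower) auto
    have "real n ^ p * ln (real n) = L * (real n ^ (p - 2) * ((real n)\<^sup>2 * ln (real n) / L))"
      using pp[of "real n"] L0 by simp
    also have "\<dots> \<le> L * (real n ^ (p - 2) * (\<Sum>x\<in>box 2 n. real_of_int (vgcd 2 (\<lambda>j. 2 * (N * x j) - mu j))))"
      using s L0 by (intro mult_left_mono) auto
    also have "\<dots> \<le> L * (2 * real (twisted_growth G S \<psi> (m * n)))"
      using m(2)[rule_format, OF n(2)] L0 unfolding dd by (intro mult_left_mono) auto
    also have "\<dots> = 2 * L * real (twisted_growth G S \<psi> (m * n))" by simp
    also have "\<dots> \<le> 2 * L * max 1 (real (twisted_growth G S \<psi> (m * n)))" using L0 by (intro mult_left_mono) auto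
    finally show "real n ^ p * ln (real n) \<le> 2 * L * max 1 (real (twisted_growth G S \<psi> (m * n)))" .
  qed (use m twisted_growth_real_mono in auto)
qed

lemma growth_defect_ge_3:
  assumes dd: "dd \<ge> 3"
  shows "growth_equiv (\<lambda>n. real (twisted_growth G S \<psi> n)) (\<lambda>n. real n ^ p * 1)"
  unfolding growth_equiv_def
proof
  obtain C :: nat where C: "C \<ge> 1" "\<And>n. n \<ge> 1 \<Longrightarrow> real (twisted_growth G S \<psi> n)
      \<le> real C * real n ^ (p - dd) * ((real n)\<^sup>2 + (\<Sum>u\<in>box dd (C * n) - {0}. real_of_int (vgcd dd u)))"
    using growth_upper by metis
  define K where "K = real C * (1 + 2 * (3 * real C) ^ dd)"
  show "growth_le (\<lambda>n. real (twisted_growth G S \<psi> n)) (\<lambda>n. real n ^ p * 1)"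
  proof (rule growth_leI[where m = 1 and start = 1 and C = K])
    fix n :: nat assume n: "n \<ge> 1"
    have "real (twisted_growth G S \<psi> n)
        \<le> real C * real n ^ (p - dd) * ((real n)\<^sup>2 + (\<Sum>u\<in>box dd (C * n) - {0}. real_of_int (vgcd dd u)))"
      using C(2)[OF n] .
    also have "\<dots> \<le> real C * real n ^ (p - dd) * (real n ^ dd + 2 * (3 * real (C * n)) ^ dd)"
      \<comment> \<open>Since dd \<ge> 2 the cut-off n^2 is absorbed by n^dd.\<close>
      by (intro mult_left_mono add_mono sum_vgcd_ge_3 dd power_increasing) (use dd n in auto)
    also have "\<dots> = K * (real n ^ (p - dd) * real n ^ dd)"
      by (simp add: K_def power_mult_distrib algebra_simps)
    also have "\<dots> = K * (real n ^ p * 1)" using dd_le by (simp add: power_add[symmetric])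
    also have "\<dots> \<le> K * max 1 (real n ^ p * 1)" unfolding K_def by (intro mult_left_mono) auto
    finally show "real (twisted_growth G S \<psi> n) \<le> K * max 1 (real (1 * n) ^ p * 1)" by simp
  qed (auto intro: power_mono)
  obtain m where m: "m \<ge> 1" "\<And>n. real n ^ p \<le> real (twisted_growth G S \<psi> (m * n))"
    using growth_lower_trivial by metis
  show "growth_le (\<lambda>n. real n ^ p * 1) (\<lambda>n. real (twisted_growth G S \<psi> n))"
    by (rule growth_leI[where m = m and start = 1 and C = 1]) (use m twisted_growth_mono in \<open>auto simp: le_max_iff_disj\<close>)
qed

end

section \<open>Assembly of the cases\<close>

context heis_count
begin

text \<open>If A preserves the form and fixes \<open>w\<close>, then the form with \<open>w\<close>
  takes equal values at v and A v.\<close>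

lemma twisted_form_om: "eps = 1 \<Longrightarrow> twisted_form k D om"
proof
  assume e: "eps = 1"
  show "additive_on k D" by (rule D_add)
  show "D x \<in> int_vecs k" if "x \<in> int_vecs k" for x using that by (rule D_in)
  show "additive_on k (\<lambda>w. om w v)" if "v \<in> int_vecs k" for v using that by (rule om_additive(2))
  show "additive_on k (om w)" if "w \<in> int_vecs k" for w using that by (rule om_additive(1))
  show "om w (D v) = 0" if wv: "w \<in> int_vecs k" "v \<in> int_vecs k" "D w = 0" for w v
  proof -
    have "A w = w" using wv(3) by (simp add: D_def)
    then have "om w (A v) = om w v" using om_A[OF wv(1,2)] e by simp
    then show ?thesis unfolding D_def
      using additive_on_diff[OF om_additive(1)[OF wv(1)] A_in[OF wv(2)] wv(2)] by simp
  qed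
qed

text \<open>Used for \<open>eps = -1\<close>. There the pairing of a fixed \<open>w\<close> with
  \<open>D v\<close> is -2 \<open>om w v\<close>, so the true form is not compatible; but only
  coordinates on the cokernel of \<open>D\<close> are wanted, and the zero form provides
  them.\<close>

lemma twisted_form_trivial: "twisted_form k D (\<lambda>_ _. 0)"
  by standard (simp_all add: D_add D_in, simp_all add: additive_on_def)

theorem growth_rate:
  "growth_equiv (\<lambda>n. real (twisted_growth G S \<psi> n))
     (\<lambda>n. real n powi (int (d_c G) - int (r_c G \<psi>)) * d_psi G \<iota> k a \<psi> n)"
proof (cases "eps = 1")
  case False
  then have e: "eps = - 1" using eps_cases by blast
  interpret tf: twisted_form k D "\<lambda>_ _. 0" by (rule twisted_form_trivial)
  obtain r p dd dz rz \<theta>D \<theta>R \<theta>DR \<kappa> \<Lambda> g t N M where *: "r + p = k"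
    "lattice_param r \<theta>D (D ` int_vecs k)" "additive_on k \<Lambda>" "\<forall>v. \<Lambda> v \<in> int_vecs p"
    "\<forall>v\<in>int_vecs k. \<Lambda> (D v) = 0" "(N::int) > 0" "\<forall>i<p. t i \<in> int_vecs k \<and> \<Lambda> (t i) = (\<lambda>j. N * unit_vec i j)"
    "(M::int) > 0" "additive_on k g" "\<forall>u\<in>int_vecs k. g u \<in> int_vecs k"
    "\<forall>u\<in>int_vecs k. \<Lambda> u = 0 \<longrightarrow> D (g u) = (\<lambda>j. M * u j)"
    by (rule tf.adapted_coordinates)
  interpret hc: heis_coords G \<iota> k a \<psi> S p \<Lambda> g t N M
    by standard (use * in auto)
  have "growth_equiv (\<lambda>n. real (twisted_growth G S \<psi> n)) (\<lambda>n. real n ^ p * 1)"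
  \<comment> \<open>Twisting by \<open>zeta 1\<close> changes the height by (1 - eps) times 2, which
    is 4, the height of \<open>zeta 2\<close>.\<close>
  proof (rule hc.growth_bounded_period[of 2])
    fix x assume x: "x \<in> carrier G"
    have D0: "D 0 = 0" using additive_on_0[OF D_add] .
    have h: "height (twist (zeta 1) x) = height x + 4"
      using height_twist_fixed[OF zeta_closed x, of 1] D0 additive_on_0[OF f_additive] om_zero(2)[OF vec_in[OF x]] e
      by (simp del: zero_fun_apply)
    have "twist (zeta 1) x = x \<otimes> zeta (int 2)"
    proof (rule coords_inj)
      show "vec (twist (zeta 1) x) = vec (x \<otimes> zeta (int 2))"
        using vec_twist[OF zeta_closed x, of 1] D0 vec_mult_zeta[OF x] by (simp del: zero_fun_apply)
      show "height (twist (zeta 1) x) = height (x \<otimes> zeta (int 2))" using h height_mult_zeta[OF x] by simp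
    qed (use x in auto)
    then show "\<exists>h\<in>carrier G. twist h x = x \<otimes> zeta (int 2)" using zeta_closed by blast
  qed simp
  moreover have "int (d_c G) - int (r_c G \<psi>) = int p"
    using *(1) d_c_eq r_c_eq[OF *(2)] by simp
  moreover have "d_psi G \<iota> k a \<psi> n = 1" for n
    using psi_inverts_iff e unfolding d_psi_def by simp
  ultimately show ?thesis by (simp only: power_int_of_nat)
next
  case True
  interpret tf: twisted_form k D om by (rule twisted_form_om[OF True])
  have rad_eq: "tf.rad = rad" by (simp add: tf.rad_def rad_def)
  obtain r p dd dz rz \<theta>D \<theta>R \<theta>DR \<kappa> \<Lambda> g t N M where *: "r + p = k" "dd \<le> p"
    "int k - int r - (int dz - int rz) = int dd"
    "lattice_param r \<theta>D (D ` int_vecs k)" "lattice_param dz \<theta>R tf.rad"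
    "lattice_param rz \<theta>DR (D ` tf.rad)" "lattice_param p \<kappa> {w \<in> int_vecs k. D w = 0}"
    "\<forall>x\<in>int_vecs p. \<kappa> x \<in> tf.rad \<longleftrightarrow> (\<forall>i<dd. x i = 0)"
    "additive_on k \<Lambda>" "\<forall>v. \<Lambda> v \<in> int_vecs p"
    "\<forall>v\<in>int_vecs k. \<Lambda> (D v) = 0" "\<forall>v\<in>int_vecs k. \<forall>j<dd. \<Lambda> v j = om (\<kappa> (unit_vec j)) v"
    "(N::int) > 0" "\<forall>i<p. t i \<in> int_vecs k \<and> \<Lambda> (t i) = (\<lambda>j. N * unit_vec i j)"
    "(M::int) > 0" "additive_on k g" "\<forall>u\<in>int_vecs k. g u \<in> int_vecs k"
    "\<forall>u\<in>int_vecs k. \<Lambda> u = 0 \<longrightarrow> D (g u) = (\<lambda>j. M * u j)"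
    by (rule tf.adapted_coordinates)
  note * = *[unfolded rad_eq]
  interpret hc: heis_coords G \<iota> k a \<psi> S p \<Lambda> g t N M
    by standard (use * in auto)
  have exp: "int (d_c G) - int (r_c G \<psi>) = int p" using *(1) d_c_eq r_c_eq[OF *(4)] by simp
  have def: "defect G \<psi> = int dd"
    using *(3) d_c_eq r_c_eq[OF *(4)] d_zc_eq[OF *(5)] r_zc_eq[OF *(5,6)] by (simp add: defect_def)
  have cond1: "\<not> (\<forall>x\<in>isolator G. \<psi> x = inv x)" using psi_inverts_iff True by simp
  have ker: "psi_prime G \<iota> k a \<psi> ` kernel (quot_zc G) (quot_zc G) (minus_id (quot_zc G) (induced_map \<psi>))
    = f ` {x \<in> rad. D x = 0}" by (rule psi_prime_kernel[OF *(5)])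
  show ?thesis
  proof (cases "\<exists>w\<in>rad. D w = 0 \<and> f w \<noteq> 0")
    case w: True
    then obtain w where w: "w \<in> rad" "D w = 0" "f w \<noteq> 0" by blast
    have "f ` {x \<in> rad. D x = 0} \<noteq> {0}" using w by blast
    then have d: "d_psi G \<iota> k a \<psi> n = 1" for n unfolding d_psi_def ker by simp
    \<comment> \<open>The sign makes the height change, which is -f, positive.\<close>
    define w' where "w' = (if f w < 0 then w else - w)"
    have wk: "w \<in> int_vecs k" using w(1) by (rule rad_in)
    have w': "w' \<in> int_vecs k" "D w' = 0" "f w' = - \<bar>f w\<bar>" "\<And>v. v \<in> int_vecs k \<Longrightarrow> om w' v = 0"
    proof -
      show "w' \<in> int_vecs k" using wk by (auto simp: w'_def)
      show "D w' = 0" using w(2) additive_on_minus[OF D_add wk] by (auto simp: w'_def)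
      show "f w' = - \<bar>f w\<bar>" using additive_on_minus[OF f_additive wk] by (auto simp: w'_def)
      show "om w' v = 0" if v: "v \<in> int_vecs k" for v
        using w(1) v additive_on_minus[OF om_additive(2)[OF v] wk] by (auto simp: w'_def rad_def)
    qed
    have ww: "w' + w' \<in> int_vecs k" by (rule int_vecs_closed(2)[OF w'(1) w'(1)])
    have "growth_equiv (\<lambda>n. real (twisted_growth G S \<psi> n)) (\<lambda>n. real n ^ p * 1)"
    proof (rule hc.growth_bounded_period[of "nat \<bar>f w\<bar>"])
      show "1 \<le> nat \<bar>f w\<bar>" using w(3) by linarith
      fix x assume x: "x \<in> carrier G"
      \<comment> \<open>Doubling makes the height change even, so that it is that of an element of
        the isolator.\<close>
      define h where "h = lift (w' + w')"
      have h: "h \<in> carrier G" "vec h = w' + w'" using lift[OF ww] by (auto simp: h_def)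
      have Dh: "D (vec h) = 0" unfolding h(2) additive_onD[OF D_add w'(1) w'(1)] w'(2) by simp
      have "height (twist h x) = height x + 2 * \<bar>f w\<bar>"
        using height_twist_fixed[OF h(1) x Dh] unfolding h(2) True additive_onD[OF f_additive w'(1) w'(1)]
          om_add_left[OF w'(1) w'(1) vec_in[OF x]] w'(3) w'(4)[OF vec_in[OF x]] by simp
      then have "twist h x = x \<otimes> zeta (int (nat \<bar>f w\<bar>))"
        using vec_twist[OF h(1) x] Dh vec_mult_zeta[OF x] height_mult_zeta[OF x] h(1) x
        by (intro coords_inj) auto
      then show "\<exists>h\<in>carrier G. twist h x = x \<otimes> zeta (int (nat \<bar>f w\<bar>))" using h(1) by blast
    qed
    then show ?thesis unfolding exp d by (simp only: power_int_of_nat)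
  next
    case w: False
    interpret hf: heis_fixed G \<iota> k a \<psi> S p \<Lambda> g t N M \<kappa> dd
      by standard (use * True w in auto)
    \<comment> \<open>The condition in \<open>d_psi\<close> compares an image with {0}, so the image
      must also be shown to be nonempty.\<close>
    have "0 \<in> rad" by (auto simp: rad_def om_zero(2) simp del: zero_fun_apply)
    moreover have "D 0 = 0" "f 0 = 0" using additive_on_0[OF D_add] additive_on_0[OF f_additive] by auto
    ultimately have "0 \<in> f ` {x \<in> rad. D x = 0}" by (metis (mono_tags, lifting) image_eqI mem_Collect_eq)
    then have f0: "f ` {x \<in> rad. D x = 0} = {0}" using w by blast
    have d: "d_psi G \<iota> k a \<psi> = (\<lambda>n. if dd \<ge> 3 then 1 else if dd = 2 then ln (real n)
        else if dd = 1 then real n else (real n)\<^sup>2)"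
      using cond1 by (intro ext) (auto simp: d_psi_def ker f0 def)
    consider "dd = 0" | "dd = 1" | "dd = 2" | "dd \<ge> 3" by linarith
    then show ?thesis
    proof cases
      case 1
      then show ?thesis using hf.growth_defect_0 unfolding exp d by (simp only: power_int_of_nat) simp
    next
      case 2
      then show ?thesis using hf.growth_defect_1 unfolding exp d by (simp only: power_int_of_nat) simp
    next
      case 3
      then show ?thesis using hf.growth_defect_2 unfolding exp d by (simp only: power_int_of_nat) simp
    next
      case 4
      then show ?thesis using hf.growth_defect_ge_3 unfolding exp d by (simp only: power_int_of_nat) simp
    qed
  qed
qed

end

text \<open>The identification \<open>\<iota>\<close> and the lifted basis \<open>a\<close> enter
  the right-hand side through \<psi>'; quantifying over both covers every choice of the embedding.
  The exponent is a difference formed in \<int>; it equals the rank \<open>p\<close> of the kernel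
  of \<open>D\<close>, so the power is an ordinary one.\<close>

theorem theoremB:
  fixes G :: "('a, 'b) monoid_scheme"
    and \<psi> :: "'a \<Rightarrow> 'a" and S :: "'a set"
    and \<iota> :: "'a \<Rightarrow> int" and k :: nat and a :: "nat \<Rightarrow> 'a"
  assumes "generalised_Heisenberg G"
    and "\<psi> \<in> iso G G"
    and "finite_generating_set G S"
    and "\<iota> \<in> iso (G\<lparr>carrier := isolator G\<rparr>) integer_group"
    and "lifts_basis G k a"
  shows "growth_equiv
           (\<lambda>n. real (twisted_growth G S \<psi> n))
           (\<lambda>n. real n powi (int (d_c G) - int (r_c G \<psi>)) * d_psi G \<iota> k a \<psi> n)"
proof -
  have "group G" "derived G (carrier G) \<subseteq> group_center G"
    using assms(1) by (auto simp: generalised_Heisenberg_def two_step_nilpotent_def)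
  then interpret heis_count G \<iota> k a \<psi> S
    using assms(2-5)
    by (simp add: heis_count_def heisenberg_aut_def heisenberg_aut_axioms_def heisenberg_def
        heisenberg_axioms_def two_step_def two_step_axioms_def fin_gen_group_def fin_gen_group_axioms_def)
  show ?thesis by (rule growth_rate)
qed

end
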